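(* Under the simple Hopf pair assumption of the context, assume $\sigma_{\mathrm H,c}^2=\lim_{\alpha\to\alpha_{\mathrm c}^-}\|B^\top\boldsymbol{w}_{\mathrm H}\|_2^2>0$. Let $\boldsymbol{x}=\boldsymbol{x}^*(\alpha)+\boldsymbol{z}$ with $\boldsymbol{z}\sim\mathcal{N}(\boldsymbol{0},C(\alpha))$. Let $\Theta$ be uniformly distributed on $[0,2\pi)$ and define $$\boldsymbol{u}_\Theta=(\cos\Theta)\,\boldsymbol{p}_{\mathrm c}+(\sin\Theta)\,\boldsymbol{q}_{\mathrm c},$$ where $\boldsymbol{p}_{\mathrm c}=\operatorname{Re}\boldsymbol{v}_{\mathrm H,c}$, $\boldsymbol{q}_{\mathrm c}=\operatorname{Im}\boldsymbol{v}_{\mathrm H,c}$, $\boldsymbol{v}_{\mathrm H,c}=\lim_{\alpha\to\alpha_{\mathrm c}^-}\boldsymbol{v}_{\mathrm H}(\alpha)$. Then, as $\alpha\to\alpha_{\mathrm c}^-$, $$g_1\xrightarrow{\mathrm d}\frac{\mu_3(\boldsymbol{u}_\Theta)}{\mu_2(\boldsymbol{u}_\Theta)^{3/2}},\qquad g_2\xrightarrow{\mathrm d}\frac{\mu_4(\boldsymbol{u}_\Theta)}{\mu_2(\boldsymbol{u}_\Theta)^2},\qquad I_{\mathrm M}\xrightarrow{\mathrm d}\frac NW\,\frac{(P\boldsymbol{u}_\Theta)^\top A(P\boldsymbol{u}_\Theta)}{(P\boldsymbol{u}_\Theta)^\top(P\boldsymbol{u}_\Theta)}.$$ The quantities in the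 denominators are nonzero with probability one. (In particular none of these three statistics diverges.)
   Context: Setting. $N\ge2$. Consider the It\^o SDE $\mathrm d\boldsymbol{x}=F(\boldsymbol{x};\alpha)\,\mathrm dt+B\,\mathrm d\boldsymbol{W}$ in $\mathbb{R}^N$, with $B\in\mathbb{R}^{N\times m}$ constant, $\boldsymbol{W}$ an $m$-dimensional standard Wiener process, and $F$ sufficiently smooth in $(\boldsymbol{x},\alpha)$ ($C^2$ in a neighborhood of the equilibrium branch, including its endpoint at $\alpha_{\mathrm c}$, suffices). $\boldsymbol{x}^*(\alpha)$ is a branch of equilibria, asymptotically stable for $\alpha<\alpha_{\mathrm c}$; $M(\alpha)=-\frac{\partial F}{\partial\boldsymbol{x}}\big|_{\boldsymbol{x}=\boldsymbol{x}^*(\alpha)}$; $C(\alpha)$ solves $MC+CM^\top=BB^\top$. Simple Hopf pair assumption. $\boldsymbol{x}^*(\alpha)$ has a finite limit $\boldsymbol{x}^*_{\mathrm c}$ as $\alpha\to\alpha_{\mathrm c}^-$. For $\alpha<\alpha_{\mathrm c}$ close to $\alpha_{\mathrm c}$, the real matrix $M(\alpha)$ is diagonalizable over $\mathbb{C}$ and has a simple complex-conjugate eigenvalue pair $\lambda_\pm(\alpha)=\eta(\alpha)\pm\mathrm i\,\Omega(\alpha)$ with $\eta(\alpha)>0$, $\eta(\alpha)\to0$, $\Omega(\alpha)\to\Omega_{\mathrm c}>0$; all other eigenvalues satisfy $\operatorname{Re}\lambda_k(\alpha)\ge\delta>0$ with $\delta$ independent of $\alpha$. $\boldsymbol{v}_{\mathrm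 H},\overline{\boldsymbol{v}_{\mathrm H}}$ are right eigenvectors for $\lambda_+,\lambda_-$ and $\boldsymbol{w}_{\mathrm H},\overline{\boldsymbol{w}_{\mathrm H}}$ the corresponding left eigenvectors ($\boldsymbol{w}_{\mathrm H}^\top M=\lambda_+\boldsymbol{w}_{\mathrm H}^\top$), with $\|\boldsymbol{v}_{\mathrm H}\|_2=1$, $\boldsymbol{w}_{\mathrm H}^\top\boldsymbol{v}_{\mathrm H}=1$, $\boldsymbol{w}_{\mathrm H}^\top\overline{\boldsymbol{v}_{\mathrm H}}=0$ (plain transpose, no conjugation). $\boldsymbol{v}_{\mathrm H}$ and $\boldsymbol{w}_{\mathrm H}$ have finite limits as $\alpha\to\alpha_{\mathrm c}^-$. Statistics. For $\boldsymbol{u}\in\mathbb{R}^N$: $\bar u=N^{-1}\sum_iu_i$, $\mu_k(\boldsymbol{u})=\frac1N\sum_i(u_i-\bar u)^k=\frac1N\sum_i(P\boldsymbol{u})_i^k$ with $P=I-\frac1N\boldsymbol{1}\boldsymbol{1}^\top$. $A=(A_{ij})\in\mathbb{R}^{N\times N}$ is the fixed adjacency matrix, $W=\sum_{i,j}A_{ij}>0$. $g_1=\mu_3(\boldsymbol{x})/\mu_2(\boldsymbol{x})^{3/2}$, $g_2=\mu_4(\boldsymbol{x})/\mu_2(\boldsymbol{x})^2$, $I_{\mathrm M}=\frac{N}{W}\frac{\sum_{i,j}A_{ij}(x_i-\bar x)(x_j-\bar x)}{\sum_i(x_i-\bar x)^2}$. *)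

theory Defs
  imports "HOL-Probability.Probability"
begin

definition C2_on :: "'a::real_normed_vector set \<Rightarrow> ('a \<Rightarrow> 'b::real_normed_vector) \<Rightarrow> bool" where
  "C2_on U f \<longleftrightarrow>
     (\<exists>(f' :: 'a \<Rightarrow> 'a \<Rightarrow>\<^sub>L 'b) (f'' :: 'a \<Rightarrow> 'a \<Rightarrow>\<^sub>L ('a \<Rightarrow>\<^sub>L 'b)).
        (\<forall>x\<in>U. (f has_derivative blinfun_apply (f' x)) (at x)) \<and>
        (\<forall>x\<in>U. (f' has_derivative blinfun_apply (f'' x)) (at x)) \<and>
        continuous_on U f'')"

text \<open>
  Lyapunov stability and local attractivity of an equilibrium of \<open>y' = f y\<close>. Solutions on
  bounded intervals are included in the first clause so that solutions leaving the
  neighbourhood before blowing up are not ignored.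
\<close>
definition asymptotically_stable :: "('a::real_normed_vector \<Rightarrow> 'a) \<Rightarrow> 'a \<Rightarrow> bool" where
  "asymptotically_stable f p \<longleftrightarrow>
     f p = 0 \<and>
     (\<forall>\<epsilon>>0. \<exists>d>0. \<forall>T>0. \<forall>y.
        dist (y 0) p < d \<and>
        (\<forall>t\<in>{0..<T}. (y has_vector_derivative f (y t)) (at t within {0..<T})) \<longrightarrow>
        (\<forall>t\<in>{0..<T}. dist (y t) p < \<epsilon>)) \<and>
     (\<exists>d>0. \<forall>y.
        dist (y 0) p < d \<and>
        (\<forall>t\<in>{0..}. (y has_vector_derivative f (y t)) (at t within {0..})) \<longrightarrow>
        (y \<longlongrightarrow> p) at_top)"

definition stability_matrix ::
  "(real^'n \<Rightarrow> real \<Rightarrow> real^'n) \<Rightarrow> (real \<Rightarrow> real^'n) \<Rightarrow> real \<Rightarrow> real^'n^'n" where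
  "stability_matrix F xs a = - jacobian (\<lambda>x. F x a) (at (xs a))"

abbreviation complex_matrix :: "real^'m^'n \<Rightarrow> complex^'m^'n" where
  "complex_matrix \<equiv> map_matrix complex_of_real"

definition eigenvalue :: "complex^'n^'n \<Rightarrow> complex \<Rightarrow> bool" where
  "eigenvalue M l \<longleftrightarrow> (\<exists>v. v \<noteq> 0 \<and> M *v v = l *s v)"

definition charpoly :: "complex^'n^'n \<Rightarrow> complex poly" where
  "charpoly M = det (mat [:0, 1:] - map_matrix (\<lambda>c. [:c:]) M)"

definition simple_eigenvalue :: "complex^'n^'n \<Rightarrow> complex \<Rightarrow> bool" where
  "simple_eigenvalue M l \<longleftrightarrow> eigenvalue M l \<and> order l (charpoly M) = 1"

definition diagonalizable :: "complex^'n^'n \<Rightarrow> bool" where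
  "diagonalizable M \<longleftrightarrow>
     (\<exists>S D :: complex^'n^'n. invertible S \<and> (\<forall>i j. i \<noteq> j \<longrightarrow> D $ i $ j = 0) \<and> M = S ** D ** matrix_inv S)"

definition cnj_vec :: "complex^'n \<Rightarrow> complex^'n" where
  "cnj_vec v = (\<chi> i. cnj (v $ i))"

definition Re_vec :: "complex^'n \<Rightarrow> real^'n" where
  "Re_vec v = (\<chi> i. Re (v $ i))"

definition Im_vec :: "complex^'n \<Rightarrow> real^'n" where
  "Im_vec v = (\<chi> i. Im (v $ i))"

text \<open>
  The matrix family \<open>M\<close> has, for parameters just below \<open>ac\<close>, the simple eigenvalue pair
  \<open>\<eta> a \<plusminus> \<i> \<Omega> a\<close>; \<open>v a\<close> and \<open>w a\<close> are the right and left eigenvectors for \<open>\<eta> a + \<i> \<Omega> a\<close>, with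
  limits \<open>vc\<close> and \<open>wc\<close>. Since \<open>M a\<close> is real, their conjugates are eigenvectors for the conjugate
  eigenvalue. The pairing \<^const>\<open>scalar_product\<close> is bilinear (no conjugation), whereas
  \<^const>\<open>norm\<close> on \<open>complex^'n\<close> is the Hermitian 2-norm.
\<close>
definition simple_hopf_pair ::
  "(real \<Rightarrow> real^'n^'n) \<Rightarrow> real \<Rightarrow> (real \<Rightarrow> real) \<Rightarrow> (real \<Rightarrow> real) \<Rightarrow>
   (real \<Rightarrow> complex^'n) \<Rightarrow> (real \<Rightarrow> complex^'n) \<Rightarrow> complex^'n \<Rightarrow> complex^'n \<Rightarrow> bool" where
  "simple_hopf_pair M ac \<eta> \<Omega> v w vc wc \<longleftrightarrow>
     (\<forall>\<^sub>F a in at_left ac.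
        diagonalizable (complex_matrix (M a)) \<and>
        simple_eigenvalue (complex_matrix (M a)) (Complex (\<eta> a) (\<Omega> a)) \<and>
        simple_eigenvalue (complex_matrix (M a)) (Complex (\<eta> a) (- \<Omega> a)) \<and>
        \<eta> a > 0) \<and>
     (\<eta> \<longlongrightarrow> 0) (at_left ac) \<and>
     (\<exists>\<Omega>c>0. (\<Omega> \<longlongrightarrow> \<Omega>c) (at_left ac)) \<and>
     (\<exists>\<delta>>0. \<forall>\<^sub>F a in at_left ac. \<forall>l. eigenvalue (complex_matrix (M a)) l \<longrightarrow>
        l \<noteq> Complex (\<eta> a) (\<Omega> a) \<longrightarrow> l \<noteq> Complex (\<eta> a) (- \<Omega> a) \<longrightarrow> Re l \<ge> \<delta>) \<and>
     (\<forall>\<^sub>F a in at_left ac.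
        complex_matrix (M a) *v v a = Complex (\<eta> a) (\<Omega> a) *s v a \<and>
        w a v* complex_matrix (M a) = Complex (\<eta> a) (\<Omega> a) *s w a \<and>
        norm (v a) = 1 \<and>
        scalar_product (w a) (v a) = 1 \<and>
        scalar_product (w a) (cnj_vec (v a)) = 0) \<and>
     (v \<longlongrightarrow> vc) (at_left ac) \<and>
     (w \<longlongrightarrow> wc) (at_left ac)"

text \<open>
  Gaussian vectors with a possibly singular covariance matrix: every linear functional is
  univariate normal, a normal law of variance zero being a point mass.
\<close>
definition gaussian_vector ::
  "'w measure \<Rightarrow> ('w \<Rightarrow> real^'n) \<Rightarrow> real^'n \<Rightarrow> real^'n^'n \<Rightarrow> bool" where
  "gaussian_vector S z m C \<longleftrightarrow>
     z \<in> borel_measurable S \<and> transpose C = C \<and> (\<forall>u. u \<bullet> (C *v u) \<ge> 0) \<and>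
     (\<forall>u. if u \<bullet> (C *v u) = 0
          then AE \<omega> in S. u \<bullet> z \<omega> = u \<bullet> m
          else distributed S lborel (\<lambda>\<omega>. u \<bullet> z \<omega>)
                 (normal_density (u \<bullet> m) (sqrt (u \<bullet> (C *v u)))))"

text \<open>Versions of \<^const>\<open>weak_conv_m\<close> and \<^const>\<open>tight\<close> for a general filter.\<close>

definition weak_conv_along :: "'a filter \<Rightarrow> ('a \<Rightarrow> real measure) \<Rightarrow> real measure \<Rightarrow> bool" where
  "weak_conv_along F \<mu> L \<longleftrightarrow>
     (\<forall>x. isCont (cdf L) x \<longrightarrow> ((\<lambda>a. cdf (\<mu> a) x) \<longlongrightarrow> cdf L x) F)"

lemma weak_conv_along_sequentially: "weak_conv_along sequentially \<mu> L \<longleftrightarrow> weak_conv_m \<mu> L"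
  by (simp add: weak_conv_along_def weak_conv_m_def weak_conv_def)

definition tight_along :: "'a filter \<Rightarrow> ('a \<Rightarrow> real measure) \<Rightarrow> bool" where
  "tight_along F \<mu> \<longleftrightarrow>
     (\<forall>\<epsilon>>0. \<exists>a b. a < b \<and> (\<forall>\<^sub>F t in F. measure (\<mu> t) {a<..b} > 1 - \<epsilon>))"

definition coord_mean :: "real^'n \<Rightarrow> real" where
  "coord_mean u = (\<Sum>i\<in>UNIV. u $ i) / real CARD('n)"

definition central_moment :: "nat \<Rightarrow> real^'n \<Rightarrow> real" where
  "central_moment k u = (\<Sum>i\<in>UNIV. (u $ i - coord_mean u) ^ k) / real CARD('n)"

definition centering :: "real^'n^'n" where
  "centering = mat 1 - (\<chi> i j. 1 / real CARD('n))"

lemma centering_mult_nth: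
  fixes u :: "real^'n"
  shows "(centering *v u) $ i = u $ i - coord_mean u"
proof -
  have "(centering *v u) $ i = (\<Sum>j\<in>UNIV. (if j = i then u $ j else 0) - u $ j / real CARD('n))"
    by (auto simp: centering_def matrix_vector_mult_def mat_def algebra_simps intro!: sum.cong)
  also have "\<dots> = u $ i - coord_mean u"
    by (simp add: sum_subtractf coord_mean_def sum_divide_distrib)
  finally show ?thesis .
qed

lemma central_moment_centering:
  fixes u :: "real^'n"
  shows "central_moment k u = (\<Sum>i\<in>UNIV. (centering *v u) $ i ^ k) / real CARD('n)"
  by (simp add: central_moment_def centering_mult_nth)

definition skewness :: "real^'n \<Rightarrow> real" where
  "skewness u = central_moment 3 u / central_moment 2 u powr (3/2)"

definition kurtosis :: "real^'n \<Rightarrow> real" where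
  "kurtosis u = central_moment 4 u / (central_moment 2 u)\<^sup>2"

definition total_weight :: "real^'n^'n \<Rightarrow> real" where
  "total_weight A = (\<Sum>i\<in>UNIV. \<Sum>j\<in>UNIV. A $ i $ j)"

definition moran_I :: "real^'n^'n \<Rightarrow> real^'n \<Rightarrow> real" where
  "moran_I A x = real CARD('n) / total_weight A *
     ((\<Sum>i\<in>UNIV. \<Sum>j\<in>UNIV. A $ i $ j * (x $ i - coord_mean x) * (x $ j - coord_mean x)) /
      (\<Sum>i\<in>UNIV. (x $ i - coord_mean x)\<^sup>2))"

end

theory Submission
  imports Defs "HOL-Computational_Algebra.Fundamental_Theorem_Algebra"
begin

text \<open>
  The rescaled covariance \<open>\<eta> C\<close> converges to \<open>\<sigma>\<^sup>2 (p p\<^sup>T + q q\<^sup>T)\<close>: testing the Lyapunov equation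
  against the critical left eigenvectors fixes the critical block, and a normalized limit of the
  remainder would solve the homogeneous equation at the critical point without having a critical
  block, so it vanishes. (The other eigenvectors need not stay bounded, so no spectral expansion
  of \<open>C\<close> is used.) Hence \<open>\<surd>\<eta> x\<close> is close in probability to \<open>\<sigma> (\<xi>\<^sub>1 p + \<xi>\<^sub>2 q)\<close> with independent
  standard normal \<open>\<xi>\<^sub>1, \<xi>\<^sub>2\<close>. The statistics are invariant under positive scaling and continuous off
  the vectors with constant entries, so only the angle of \<open>(\<xi>\<^sub>1, \<xi>\<^sub>2)\<close> matters, and it is uniform by
  rotation invariance. The limit avoids constant vectors because \<open>p + \<i> q\<close> is an eigenvector of a real
  matrix for a non-real eigenvalue.
\<close>

section \<open>Uniqueness for the Sylvester equation\<close>

text \<open>The obstacle is that spectral information is needed exactly at the critical parameter,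
  where the pair sits on the imaginary axis and the matrix need not be diagonalizable. It is carried
  there by a continuous quantity: adding the spectral projections of the critical pair moves both
  eigenvalues one unit to the right, and the determinant of the shifted matrix minus
  \<open>l\<close> then stays away from 0 uniformly in the parameter for every \<open>l\<close> with
  nonpositive real part. The scaling by \<eta> is forced by the pairing of the Lyapunov equation
  with the left eigenvector and its conjugate, which carries the factor
  \<open>\<lambda> + cnj \<lambda> = 2 \<eta>\<close>. The pairing of the left eigenvector with
  itself carries \<open>2 \<lambda>\<close>, which does not degenerate, so that entry is lost after
  multiplication by \<eta>. The vectors for different parameters live on unrelated probability
  spaces. The approximating pair is therefore built on each space out of the given Gaussian vector,
  with the same law for all parameters close to the critical one. As Gaussianity is stated through
  linear functionals, the joint law of the pair is recovered from characteristic functions.\<close>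

definition matrix_poly_apply :: "complex^'n^'n \<Rightarrow> complex poly \<Rightarrow> complex^'n \<Rightarrow> complex^'n" where
  "matrix_poly_apply A p y = (\<Sum>i\<le>degree p. coeff p i *s (((*v) A) ^^ i) y)"

lemma matrix_poly_apply_bound:
  assumes "degree p \<le> m"
  shows "matrix_poly_apply A p y = (\<Sum>i\<le>m. coeff p i *s (((*v) A) ^^ i) y)"
  unfolding matrix_poly_apply_def
  by (rule sum.mono_neutral_left) (use assms in \<open>auto simp: coeff_eq_0 not_le\<close>)

text \<open>The linear factor is made to act first, directly on \<open>y\<close>. In the
  coefficients, multiplication by the factor is an index shift (\<open>pCons 0 q\<close>) minus
  \<mu> times \<open>q\<close>.\<close>

lemma matrix_poly_apply_root_factor:
  "matrix_poly_apply A ([:-\<mu>, 1:] * q) y = matrix_poly_apply A q (A *v y - \<mu> *s y)"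
proof -
  let ?P = "\<lambda>i. (((*v) A) ^^ i)"
  have lin: "?P i (A *v y - \<mu> *s y) = ?P (Suc i) y - \<mu> *s ?P i y" for i
    by (induction i) (simp_all add: matrix_vector_mult_diff_distrib vector_scalar_commute)
  define m where "m = Suc (degree q)"
  have deg: "degree ([:-\<mu>, 1:] * q) \<le> m"
    unfolding m_def by (rule order_trans[OF degree_mult_le]) simp
  have "matrix_poly_apply A ([:-\<mu>, 1:] * q) y
      = (\<Sum>i\<le>m. (coeff (pCons 0 q) i - \<mu> * coeff q i) *s ?P i y)"
    by (simp only: matrix_poly_apply_bound[OF deg]) (simp add: algebra_simps)
  also have "\<dots> = (\<Sum>i\<le>m. coeff (pCons 0 q) i *s ?P i y) - (\<Sum>i\<le>m. (\<mu> * coeff q i) *s ?P i y)"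
    by (simp only: vector_sub_rdistrib sum_subtractf)
  also have "(\<Sum>i\<le>m. coeff (pCons 0 q) i *s ?P i y) = (\<Sum>i\<le>degree q. coeff q i *s ?P (Suc i) y)"
    unfolding m_def by (subst sum.atMost_Suc_shift) simp
  also have "(\<Sum>i\<le>m. (\<mu> * coeff q i) *s ?P i y) = (\<Sum>i\<le>degree q. (\<mu> * coeff q i) *s ?P i y)"
    unfolding m_def by (simp add: coeff_eq_0)
  finally show ?thesis
    by (simp add: matrix_poly_apply_def lin vector_ssub_ldistrib sum_subtractf mult.commute)
qed

text \<open>A polynomial in \<open>A\<close> commutes with \<open>A - \<mu>\<close>. Having the
  factor outside turns an annihilation statement into an eigenvector equation for
  \<open>matrix_poly_apply A q y\<close>.\<close>

lemma matrix_poly_apply_commute: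
  "A *v matrix_poly_apply A q y - \<mu> *s matrix_poly_apply A q y = matrix_poly_apply A q (A *v y - \<mu> *s y)"
proof -
  let ?P = "\<lambda>i. (((*v) A) ^^ i)"
  have lin: "?P i (A *v y - \<mu> *s y) = A *v ?P i y - \<mu> *s ?P i y" for i
    by (induction i) (simp_all add: matrix_vector_mult_diff_distrib vector_scalar_commute)
  have sum: "A *v (\<Sum>i\<in>I. g i) = (\<Sum>i\<in>I. A *v g i)" for I :: "nat set" and g
    by (induction I rule: infinite_finite_induct) (simp_all add: matrix_vector_right_distrib)
  show ?thesis
    unfolding matrix_poly_apply_def lin sum
    by (simp add: vector_ssub_ldistrib sum_subtractf vec.scale_sum_right mult.commute
         vector_scalar_commute)
qed

text \<open>One more iterate than the real dimension cannot be linearly independent, and a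
  dependency is the coefficient list of \<open>p\<close>. Dependence is a property of the set of
  iterates, so a collision of two iterates is treated separately; there the difference of two
  monomials annihilates \<open>y\<close>.\<close>

lemma exists_annihilating_poly:
  fixes A :: "complex^'n^'n"
  obtains p where "p \<noteq> 0" "matrix_poly_apply A p y = 0"
proof -
  let ?P = "\<lambda>i. (((*v) A) ^^ i) y"
  let ?d = "DIM(complex^'n)"
  show thesis
  proof (cases "inj_on ?P {..?d}")
    case True
    have "card (?P ` {..?d}) > ?d" using True by (simp add: card_image)
    then have "dependent (?P ` {..?d})" using dependent_biggerset by blast
    then obtain u where u: "\<exists>v\<in>?P ` {..?d}. u v \<noteq> 0" "(\<Sum>v\<in>?P ` {..?d}. u v *\<^sub>R v) = 0"
      by (subst (asm) real_vector.dependent_finite) auto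
    define p where "p = (\<Sum>i\<le>?d. monom (complex_of_real (u (?P i))) i)"
    have co: "coeff p i = (if i \<le> ?d then complex_of_real (u (?P i)) else 0)" for i
      unfolding p_def by (simp add: coeff_sum if_distrib cong: if_cong)
    have deg: "degree p \<le> ?d" by (rule degree_le) (simp add: co)
    have sc: "complex_of_real r *s v = r *\<^sub>R v" for r and v :: "complex^'n"
      by (simp add: vec_eq_iff scaleR_conv_of_real[where 'a=complex])
    have "matrix_poly_apply A p y = (\<Sum>i\<le>?d. u (?P i) *\<^sub>R ?P i)"
      unfolding matrix_poly_apply_bound[OF deg] by (rule sum.cong) (auto simp: co sc)
    also have "\<dots> = 0" using u(2) sum.reindex[OF True, of "\<lambda>v. u v *\<^sub>R v"] by simp
    finally have "matrix_poly_apply A p y = 0" .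
    moreover from u(1) obtain i where "i \<le> ?d" "u (?P i) \<noteq> 0" by auto
    then have "coeff p i \<noteq> 0" by (simp add: co)
    then have "p \<noteq> 0" by auto
    ultimately show thesis using that by blast
  next
    case False
    then obtain i j where ij: "i \<noteq> j" "?P i = ?P j" by (auto simp: inj_on_def)
    define p where "p = monom (1::complex) i - monom 1 j"
    have co: "coeff p k = (if k = i then 1 else 0) - (if k = j then 1 else 0)" for k
      unfolding p_def by simp
    have deg: "degree p \<le> max i j" by (rule degree_le) (auto simp: co)
    have "matrix_poly_apply A p y = ?P i - ?P j"
      unfolding matrix_poly_apply_bound[OF deg] co vector_sub_rdistrib sum_subtractf
      by (simp add: if_distrib[of "\<lambda>c. c *s _"] cong: if_cong)
    then have "matrix_poly_apply A p y = 0" using ij by simp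
    moreover have "coeff p i \<noteq> 0" using ij by (simp add: co)
    then have "p \<noteq> 0" by auto
    ultimately show thesis using that by blast
  qed
qed

text \<open>Uniqueness for the Sylvester equation, by killing \<open>y\<close> with a polynomial in \<open>L\<close> and
  peeling off its linear factors: every factor is injective either on the left or on the right.\<close>
lemma sylvester_unique:
  fixes N L E :: "complex^'n^'n"
  assumes eq: "N ** E = - (E ** L)"
    and N: "\<And>l y. Re l \<le> 0 \<Longrightarrow> N *v y = l *s y \<Longrightarrow> y = 0"
    and L: "\<And>l y. Re l \<le> 0 \<Longrightarrow> L *v y = l *s y \<Longrightarrow> y = 0"
  shows "E = 0"
proof -
  have ann: "E *v y = 0" if "degree p = n" "p \<noteq> 0" "matrix_poly_apply L p y = 0" for p y n
    using that
  proof (induction n arbitrary: p y)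
    case 0
    then obtain c where "p = [:c:]" by (metis degree_eq_zeroE)
    with 0 have "y = 0" by (simp add: matrix_poly_apply_def)
    then show ?case by simp
  next
    case (Suc n)
    have "\<not> constant (poly p)" using Suc.prems(1) by (simp add: constant_degree)
    then obtain \<mu> where "poly p \<mu> = 0" using fundamental_theorem_of_algebra by blast
    then obtain q where p: "p = [:-\<mu>, 1:] * q" by (auto simp: poly_eq_0_iff_dvd)
    have q: "q \<noteq> 0" using Suc.prems(2) p by auto
    have dq: "degree q = n" using Suc.prems(1) q unfolding p by (subst (asm) degree_mult_eq) auto
    have z: "matrix_poly_apply L q (L *v y - \<mu> *s y) = 0"
      using Suc.prems(3) unfolding p matrix_poly_apply_root_factor .
    \<comment> \<open>A root with nonnegative real part is removed on the side of \<open>N\<close>: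
      \<open>E *v y\<close> satisfies the eigenvector equation of \<open>N\<close> for
      \<open>-\<mu>\<close>. Any other root is no eigenvalue of \<open>L\<close>, so the remaining
      factor \<open>q\<close> annihilates \<open>y\<close> already.\<close>
    show ?case
    proof (cases "Re \<mu> \<ge> 0")
      case True
      have "E *v (L *v y - \<mu> *s y) = 0" by (rule Suc.IH[OF dq q z])
      then have "(E ** L) *v y = \<mu> *s (E *v y)"
        by (simp add: matrix_vector_mult_diff_distrib matrix_vector_mul_assoc vector_scalar_commute)
      then have "N *v (E *v y) = (-\<mu>) *s (E *v y)"
        by (simp add: matrix_vector_mul_assoc eq) (simp add: matrix_vector_mult_def vec_eq_iff sum_negf)
      then show ?thesis using N[of "-\<mu>"] True by auto
    next
      case False
      have "L *v matrix_poly_apply L q y = \<mu> *s matrix_poly_apply L q y"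
        using z unfolding matrix_poly_apply_commute[symmetric] by simp
      then have "matrix_poly_apply L q y = 0" using L[of \<mu>] False by auto
      then show ?thesis by (rule Suc.IH[OF dq q])
    qed
  qed
  have "E *v y = 0" for y
    using exists_annihilating_poly[of L y] ann by metis
  then show ?thesis by (metis matrix_eq matrix_vector_mult_0)
qed

section \<open>Shifting simple eigenvalues\<close>

text \<open>The rank-one matrix of v times the transpose of w, without conjugation, in keeping with
  \<open>scalar_product\<close>. For a right and a left eigenvector of the same simple eigenvalue
  with pairing 1 it is the spectral projection.\<close>

definition outer_prod :: "'a::semiring_1^'n \<Rightarrow> 'a^'m \<Rightarrow> 'a^'m^'n" where
  "outer_prod v w = (\<chi> i j. v $ i * w $ j)"

lemma matrix_mult_outer_prod:
  fixes A :: "'a::comm_semiring_1^'n^'k"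
  shows "A ** outer_prod v w = outer_prod (A *v v) w"
  by (simp add: vec_eq_iff outer_prod_def matrix_matrix_mult_def matrix_vector_mult_def
      sum_distrib_right mult.assoc)

lemma outer_prod_mult_matrix:
  fixes A :: "'a::comm_semiring_1^'k^'m"
  shows "outer_prod v w ** A = outer_prod v (w v* A)"
  by (simp add: vec_eq_iff outer_prod_def matrix_matrix_mult_def vector_matrix_mult_def
      sum_distrib_left ac_simps)

lemma outer_prod_mult_vec:
  fixes v :: "'a::comm_semiring_1^'n"
  shows "outer_prod v w *v y = scalar_product w y *s v"
  by (simp add: vec_eq_iff outer_prod_def matrix_vector_mult_def scalar_product_def
      sum_distrib_left sum_distrib_right ac_simps)

lemma vec_mult_outer_prod:
  fixes v :: "'a::comm_semiring_1^'n"
  shows "y v* outer_prod v w = scalar_product y v *s w"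
  by (simp add: vec_eq_iff outer_prod_def vector_matrix_mult_def scalar_product_def
      sum_distrib_left sum_distrib_right ac_simps)

lemma scalar_product_matrix:
  fixes A :: "'a::comm_semiring_1^'n^'m"
  shows "scalar_product w (A *v y) = scalar_product (w v* A) y"
  unfolding scalar_product_def matrix_vector_mult_def vector_matrix_mult_def
  by (simp add: sum_distrib_left sum_distrib_right ac_simps) (rule sum.swap)

lemma matrix_add_rdistrib: "(A + B) ** C = A ** C + B ** C"
  by (simp add: vec_eq_iff matrix_matrix_mult_def distrib_right sum.distrib)

text \<open>Stated over a commutative ring with an explicit right inverse \<open>T\<close>, because
  it serves both for complex matrices and for matrices of polynomials with \<open>l\<close> the
  indeterminate.\<close>

lemma det_diagonalized:
  fixes S :: "'a::comm_ring_1^'n^'n"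
  assumes "S ** T = mat 1" "M = S ** D ** T" "\<And>i j. i \<noteq> j \<Longrightarrow> D $ i $ j = 0"
  shows "det (M - mat l) = (\<Prod>i\<in>UNIV. D $ i $ i - l)"
proof -
  have "S ** mat l ** T = mat l"
  proof -
    have "S ** mat l = mat l ** S"
      by (simp add: vec_eq_iff matrix_matrix_mult_def mat_def if_distrib if_distribR mult.commute
           sum.delta cong: if_cong)
    then show ?thesis by (simp add: assms(1) flip: matrix_mul_assoc)
  qed
  moreover have sub: "S ** (D - mat l) ** T = S ** D ** T - S ** mat l ** T"
    by (simp add: vec_eq_iff matrix_matrix_mult_def algebra_simps sum_subtractf)
  ultimately have "M - mat l = S ** (D - mat l) ** T"
    by (simp add: assms(2) sub)
  then have "det (M - mat l) = det (D - mat l) * det (S ** T)"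
    by (simp add: det_mul)
  also have "det (D - mat l) = (\<Prod>i\<in>UNIV. D $ i $ i - l)"
    by (subst det_diagonal) (auto simp: assms mat_def)
  also have "det (S ** T) = 1" by (simp add: assms(1) det_I)
  finally show ?thesis by simp
qed

text \<open>Embedding scalars as constant polynomials is a ring homomorphism, so a diagonalization
  over the complex numbers is one over the polynomials. The sign between \<open>X - M\<close> and
  \<open>M - X\<close> is distributed over the linear factors.\<close>

lemma charpoly_diagonalized:
  fixes S :: "complex^'n^'n"
  assumes "S ** T = mat 1" "M = S ** D ** T" "\<And>i j. i \<noteq> j \<Longrightarrow> D $ i $ j = 0"
  shows "charpoly M = (\<Prod>i\<in>UNIV. [:- (D $ i $ i), 1:])"
proof -
  let ?K = "map_matrix (\<lambda>c::complex. [:c:])"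
  have mult: "?K (A ** B) = ?K A ** ?K B" for A B :: "complex^'n^'n"
  proof -
    have "[:sum f UNIV:] = (\<Sum>k\<in>UNIV. [:f k:])" for f :: "'n \<Rightarrow> complex"
      by (induction "UNIV :: 'n set" rule: infinite_finite_induct) (auto simp flip: sum_to_poly)
    then show ?thesis
      by (simp add: vec_eq_iff map_matrix_def matrix_matrix_mult_def mult.commute)
  qed
  have "?K S ** ?K T = ?K (mat 1)" by (simp only: assms(1) mult[symmetric])
  also have "\<dots> = mat 1" by (simp add: vec_eq_iff map_matrix_def mat_def one_pCons)
  finally have one: "?K S ** ?K T = mat 1" .
  have "det (?K M - mat [:0, 1:]) = (\<Prod>i\<in>UNIV. ?K D $ i $ i - [:0,1:])"
    by (rule det_diagonalized[OF one]) (simp_all add: assms(2) mult, simp add: map_matrix_def assms(3))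
  moreover have "charpoly M = det (- (?K M - mat [:0, 1:]))"
    unfolding charpoly_def by simp
  moreover have "\<dots> = (-1) ^ CARD('n) * det (?K M - mat [:0, 1:])"
  proof -
    have "det (- A) = (-1) ^ CARD('n) * det A" for A :: "complex poly^'n^'n"
    proof -
      have "- A = (\<chi> i. (-1) *s (A $ i))" by (simp add: vec_eq_iff)
      then show ?thesis
        by (simp only: det_rows_mul[of "\<lambda>_. -1" "\<lambda>i. A $ i"] vec_lambda_eta) simp
    qed
    then show ?thesis .
  qed
  moreover have "(-1) ^ CARD('n) * (\<Prod>i\<in>UNIV. ?K D $ i $ i - [:0,1:])
      = (\<Prod>i\<in>UNIV. (-1) * (?K D $ i $ i - [:0,1:]))"
    by (simp only: prod.distrib) simp
  ultimately show ?thesis by (simp add: map_matrix_def)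
qed

text \<open>Two equal diagonal entries would put the square of the linear factor into the
  characteristic polynomial, against root order 1.\<close>

lemma simple_eigenvalue_diagonalized:
  fixes S :: "complex^'n^'n"
  assumes "S ** T = mat 1" "M = S ** D ** T" "\<And>i j. i \<noteq> j \<Longrightarrow> D $ i $ j = 0"
    and "simple_eigenvalue M l"
  shows "\<exists>!i. D $ i $ i = l"
proof -
  have ch: "charpoly M = (\<Prod>i\<in>UNIV. [:- (D $ i $ i), 1:])"
    by (rule charpoly_diagonalized) fact+
  have nz: "charpoly M \<noteq> 0" unfolding ch by simp
  have ord: "order l (charpoly M) = 1" using assms(4) by (simp add: simple_eigenvalue_def)
  then have "poly (charpoly M) l = 0" by (simp add: order_root nz)
  then obtain i where i: "D $ i $ i = l" unfolding ch by (auto simp: poly_prod)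
  moreover have "j = i" if "D $ j $ j = l" for j
  proof (rule ccontr)
    assume "j \<noteq> i"
    have "(\<Prod>k\<in>{i, j}. [:- (D $ k $ k), 1:]) dvd charpoly M"
      unfolding ch by (rule prod_dvd_prod_subset) auto
    then have "[:- l, 1:] ^ 2 dvd charpoly M"
      using \<open>j \<noteq> i\<close> i that by (simp add: power2_eq_square)
    then have "2 \<le> order l (charpoly M)" by (simp add: order_divides nz)
    with ord show False by simp
  qed
  ultimately show ?thesis by auto
qed

text \<open>In the eigenbasis, the coordinates of \<open>v\<close> and \<open>w\<close> are
  supported at the single index \<open>k\<close> carrying \<open>l\<close>, and the normalization
  makes their product there equal to 1. The update thus adds 1 to one diagonal entry. The same
  \<open>S\<close> and \<open>T\<close> diagonalize the result, so that the lemma can be applied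
  again to the second eigenvalue.\<close>

lemma shift_simple_eigenvalue:
  fixes S :: "complex^'n^'n"
  assumes ST: "S ** T = mat 1" and TS: "T ** S = mat 1"
    and M: "M = S ** D ** T" and D: "\<And>i j. i \<noteq> j \<Longrightarrow> D $ i $ j = 0"
    and uniq: "\<exists>!i. D $ i $ i = l"
    and v: "M *v v = l *s v" and w: "w v* M = l *s w" and wv: "scalar_product w v = 1"
  obtains D' where "M + outer_prod v w = S ** D' ** T" "\<And>i j. i \<noteq> j \<Longrightarrow> D' $ i $ j = 0"
    "\<And>i. D' $ i $ i = (if D $ i $ i = l then l + 1 else D $ i $ i)"
proof -
  define c where "c = T *v v"
  define r where "r = w v* S"
  have TM: "T ** M = D ** T" unfolding M by (simp add: matrix_mul_assoc TS)
  have MS: "M ** S = S ** D" unfolding M by (simp add: TS flip: matrix_mul_assoc)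
  have "D *v c = l *s c"
    unfolding c_def by (simp add: matrix_vector_mul_assoc flip: TM)
       (simp add: v vector_scalar_commute flip: matrix_vector_mul_assoc)
  moreover have "(D *v c) $ i = D $ i $ i * c $ i" for i
    unfolding matrix_vector_mult_def using D
    by (simp add: sum.remove[of _ i])
  ultimately have c: "c $ i = 0" if "D $ i $ i \<noteq> l" for i
    using that by (auto simp: vec_eq_iff)
  have "r v* D = (w v* M) v* S"
    unfolding r_def by (simp add: vector_matrix_mul_assoc MS)
  also have "\<dots> = l *s r"
    unfolding r_def w
    by (simp add: vec_eq_iff vector_matrix_mult_def sum_distrib_left ac_simps)
  finally have "r v* D = l *s r" .
  moreover have "(r v* D) $ i = D $ i $ i * r $ i" for i
    unfolding vector_matrix_mult_def using D
    by (simp add: sum.remove[of _ i])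
  ultimately have r: "r $ i = 0" if "D $ i $ i \<noteq> l" for i
    using that by (auto simp: vec_eq_iff)
  obtain k where k: "D $ k $ k = l" "\<And>i. D $ i $ i = l \<Longrightarrow> i = k" using uniq by auto
  have "scalar_product r c = 1"
    unfolding r_def c_def scalar_product_matrix[symmetric]
    by (simp add: matrix_vector_mul_assoc ST wv)
  moreover have "(\<Sum>i\<in>UNIV - {k}. r $ i * c $ i) = 0"
    using r k(2) by (intro sum.neutral) auto
  ultimately have rc: "r $ k * c $ k = 1"
    by (simp add: scalar_product_def sum.remove[of _ k])
  define D' where "D' = D + outer_prod c r"
  have "S ** outer_prod c r ** T = outer_prod v w"
    unfolding matrix_mult_outer_prod outer_prod_mult_matrix c_def r_def
    by (simp add: matrix_vector_mul_assoc vector_matrix_mul_assoc ST)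
  then have "M + outer_prod v w = S ** D' ** T"
    unfolding D'_def
    by (simp add: M vec_eq_iff matrix_matrix_mult_def algebra_simps sum.distrib)
  moreover have "D' $ i $ j = 0" if "i \<noteq> j" for i j
  proof -
    have "c $ i * r $ j = 0" using that c[of i] r[of j] k(2)[of i] k(2)[of j] by auto
    then show ?thesis using D that unfolding D'_def outer_prod_def by simp
  qed
  moreover have "D' $ i $ i = (if D $ i $ i = l then l + 1 else D $ i $ i)" for i
  proof (cases "D $ i $ i = l")
    case True
    then have "i = k" by (rule k(2))
    then show ?thesis using rc k(1) by (simp add: D'_def outer_prod_def mult.commute)
  next
    case False
    then show ?thesis using c[OF False] by (simp add: D'_def outer_prod_def)
  qed
  ultimately show thesis using that by blast
qed

text \<open>A lower bound on a determinant survives the passage to the critical parameter, where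
  diagonalizability may be lost.\<close>
lemma det_shifted_pair_bound:
  fixes M :: "complex^'n^'n"
  assumes diag: "diagonalizable M"
    and simple: "simple_eigenvalue M l1" "simple_eigenvalue M l2" and Im: "Im l1 \<noteq> Im l2"
    and pos: "Re l1 > 0" "Re l2 > 0"
    and gap: "\<And>l. eigenvalue M l \<Longrightarrow> l \<noteq> l1 \<Longrightarrow> l \<noteq> l2 \<Longrightarrow> Re l \<ge> \<delta>"
    and v1: "M *v v1 = l1 *s v1" "w1 v* M = l1 *s w1" "scalar_product w1 v1 = 1"
    and v2: "M *v v2 = l2 *s v2" "w2 v* M = l2 *s w2" "scalar_product w2 v2 = 1"
    and orth: "scalar_product w1 v2 = 0" "scalar_product w2 v1 = 0"
    and \<delta>: "\<delta> > 0" and l: "Re l \<le> 0"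
  shows "min \<delta> 1 ^ CARD('n) \<le> norm (det (M + outer_prod v1 w1 + outer_prod v2 w2 - mat l))"
proof -
  obtain S D :: "complex^'n^'n" where inv: "invertible S" and D0: "\<forall>i j. i \<noteq> j \<longrightarrow> D $ i $ j = 0"
    and M: "M = S ** D ** matrix_inv S"
    using diag unfolding diagonalizable_def by blast
  have D: "D $ i $ j = 0" if "i \<noteq> j" for i j using D0 that by blast
  have ST: "S ** matrix_inv S = mat 1" and TS: "matrix_inv S ** S = mat 1"
    using inv unfolding invertible_def matrix_inv_def by (metis (mono_tags, lifting) someI_ex)+
  have ev: "eigenvalue M (D $ i $ i)" for i
  proof -
    have "M *v (S *v axis i 1) = (D $ i $ i) *s (S *v axis i 1)"
    proof -
      have "M *v (S *v axis i 1) = S *v (D *v axis i 1)"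
        by (simp add: M matrix_vector_mul_assoc TS flip: matrix_mul_assoc)
      also have "D *v axis i 1 = (D $ i $ i) *s axis i 1"
        using D by (auto simp: vec_eq_iff matrix_vector_mult_def axis_def if_distrib cong: if_cong)
      finally show ?thesis by (simp add: vector_scalar_commute)
    qed
    moreover have "S *v axis i 1 \<noteq> 0"
    proof
      assume "S *v axis i 1 = 0"
      then have "matrix_inv S *v (S *v axis i 1) = 0" by simp
      then have "axis i (1::complex) = 0" by (simp add: matrix_vector_mul_assoc TS)
      then show False by (simp add: axis_eq_0_iff)
    qed
    ultimately show ?thesis unfolding eigenvalue_def by blast
  qed
  have u: "\<exists>!i. D $ i $ i = l1" "\<exists>!i. D $ i $ i = l2"
    using simple_eigenvalue_diagonalized[OF ST M D] simple by blast+
  obtain D1 where D1: "M + outer_prod v1 w1 = S ** D1 ** matrix_inv S"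
      "\<And>i j. i \<noteq> j \<Longrightarrow> D1 $ i $ j = 0"
      "\<And>i. D1 $ i $ i = (if D $ i $ i = l1 then l1 + 1 else D $ i $ i)"
    using shift_simple_eigenvalue[OF ST TS M D u(1) v1] by metis
  \<comment> \<open>The first shift must neither move the entry \<open>l2\<close> nor create a
    second copy of it; both are excluded by the different imaginary parts.\<close>
  have ne: "l1 + 1 \<noteq> l2" "l1 \<noteq> l2" using Im by auto
  have u1: "\<exists>!i. D1 $ i $ i = l2"
    using u(2) ne by (auto simp: D1(3))
  have "(M + outer_prod v1 w1) *v v2 = l2 *s v2"
    by (simp add: matrix_vector_mult_add_rdistrib v2 outer_prod_mult_vec orth)
  moreover have "w2 v* (M + outer_prod v1 w1) = l2 *s w2"
    by (simp add: vector_matrix_left_distrib vector_matrix_mult_add_rdistrib v2 vec_mult_outer_prod orth)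
  ultimately obtain D2 where D2: "M + outer_prod v1 w1 + outer_prod v2 w2 = S ** D2 ** matrix_inv S"
      "\<And>i j. i \<noteq> j \<Longrightarrow> D2 $ i $ j = 0"
      "\<And>i. D2 $ i $ i = (if D1 $ i $ i = l2 then l2 + 1 else D1 $ i $ i)"
    using shift_simple_eigenvalue[OF ST TS D1(1,2) u1 _ _ v2(3)] by metis
  \<comment> \<open>The two shifted entries have real part above 1, all others at least \<delta>;
    this is the origin of \<open>min \<delta> 1\<close>.\<close>
  have Re: "Re (D2 $ i $ i) \<ge> min \<delta> 1" for i
    using gap[OF ev[of i]] pos unfolding D2(3) D1(3) by auto
  have "min \<delta> 1 ^ CARD('n) = (\<Prod>i\<in>(UNIV::'n set). min \<delta> 1)" by simp
  also have "\<dots> \<le> (\<Prod>i\<in>UNIV. norm (D2 $ i $ i - l))"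
  proof (rule prod_mono)
    fix i
    have "min \<delta> 1 \<le> Re (D2 $ i $ i - l)" using Re[of i] l by simp
    also have "\<dots> \<le> norm (D2 $ i $ i - l)" by (rule complex_Re_le_cmod)
    finally show "0 \<le> min \<delta> 1 \<and> min \<delta> 1 \<le> norm (D2 $ i $ i - l)" using \<delta> by simp
  qed
  also have "\<dots> = norm (\<Prod>i\<in>UNIV. D2 $ i $ i - l)" by (rule prod_norm)
  also have "(\<Prod>i\<in>UNIV. D2 $ i $ i - l) = det (M + outer_prod v1 w1 + outer_prod v2 w2 - mat l)"
    by (rule det_diagonalized[OF ST D2(1), symmetric]) (rule D2(2))
  finally show ?thesis .
qed

section \<open>The limit of the rescaled covariance\<close>

lemma tendsto_matrix_matrix_mult [tendsto_intros]:
  fixes f :: "'a \<Rightarrow> 'b::real_normed_algebra_1^'n^'m"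
  assumes "(f \<longlongrightarrow> a) F" "(g \<longlongrightarrow> b) F"
  shows "((\<lambda>x. f x ** g x) \<longlongrightarrow> a ** b) F"
  unfolding matrix_matrix_mult_def using assms
  by (intro vec_tendstoI) (auto intro!: tendsto_sum tendsto_mult tendsto_vec_nth)

lemma tendsto_matrix_vector_mult [tendsto_intros]:
  fixes f :: "'a \<Rightarrow> 'b::real_normed_algebra_1^'n^'m"
  assumes "(f \<longlongrightarrow> a) F" "(g \<longlongrightarrow> b) F"
  shows "((\<lambda>x. f x *v g x) \<longlongrightarrow> a *v b) F"
  unfolding matrix_vector_mult_def using assms
  by (intro vec_tendstoI) (auto intro!: tendsto_sum tendsto_mult tendsto_vec_nth)

lemma tendsto_vector_matrix_mult [tendsto_intros]:
  fixes f :: "'a \<Rightarrow> 'b::real_normed_algebra_1^'n^'m"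
  assumes "(f \<longlongrightarrow> a) F" "(g \<longlongrightarrow> b) F"
  shows "((\<lambda>x. g x v* f x) \<longlongrightarrow> b v* a) F"
  unfolding vector_matrix_mult_def using assms
  by (intro vec_tendstoI) (auto intro!: tendsto_sum tendsto_mult tendsto_vec_nth)

lemma tendsto_scalar_product [tendsto_intros]:
  fixes f :: "'a \<Rightarrow> 'b::real_normed_algebra_1^'n"
  assumes "(f \<longlongrightarrow> a) F" "(g \<longlongrightarrow> b) F"
  shows "((\<lambda>x. scalar_product (f x) (g x)) \<longlongrightarrow> scalar_product a b) F"
  unfolding scalar_product_def using assms
  by (intro tendsto_sum tendsto_mult tendsto_vec_nth)

lemma tendsto_outer_prod [tendsto_intros]:
  fixes f :: "'a \<Rightarrow> 'b::real_normed_algebra_1^'n"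
  assumes "(f \<longlongrightarrow> a) F" "(g \<longlongrightarrow> b) F"
  shows "((\<lambda>x. outer_prod (f x) (g x)) \<longlongrightarrow> outer_prod a b) F"
  unfolding outer_prod_def using assms
  by (intro vec_tendstoI) (auto intro!: tendsto_mult tendsto_vec_nth)

lemma tendsto_cnj_vec [tendsto_intros]:
  assumes "(f \<longlongrightarrow> a) F"
  shows "((\<lambda>x. cnj_vec (f x)) \<longlongrightarrow> cnj_vec a) F"
  unfolding cnj_vec_def using assms
  by (intro vec_tendstoI) (auto intro!: tendsto_cnj tendsto_vec_nth)

lemma tendsto_scalar_mult_vec [tendsto_intros]:
  fixes f :: "'a \<Rightarrow> 'b::real_normed_algebra_1"
  assumes "(f \<longlongrightarrow> a) F" "(g \<longlongrightarrow> b) F"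
  shows "((\<lambda>x. f x *s g x) \<longlongrightarrow> a *s b) F"
  using assms by (intro vec_tendstoI) (auto intro!: tendsto_mult tendsto_vec_nth)

lemma tendsto_transpose [tendsto_intros]:
  assumes "(f \<longlongrightarrow> a) F"
  shows "((\<lambda>x. transpose (f x)) \<longlongrightarrow> transpose a) F"
  unfolding transpose_def using assms
  by (intro vec_tendstoI) (auto intro!: tendsto_vec_nth)

lemma tendsto_complex_matrix [tendsto_intros]:
  assumes "(f \<longlongrightarrow> a) F"
  shows "((\<lambda>x. complex_matrix (f x)) \<longlongrightarrow> complex_matrix a) F"
  unfolding map_matrix_def using assms
  by (intro vec_tendstoI) (auto intro!: tendsto_of_real tendsto_vec_nth)

lemma tendsto_det [tendsto_intros]:
  fixes f :: "'a \<Rightarrow> complex^'n^'n"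
  assumes "(f \<longlongrightarrow> a) F"
  shows "((\<lambda>x. det (f x)) \<longlongrightarrow> det a) F"
  unfolding det_def using assms
  by (intro tendsto_sum tendsto_mult tendsto_const tendsto_prod tendsto_vec_nth)

section \<open>Complexification, conjugation and the bilinear pairing\<close>

lemma complex_matrix_mult: "complex_matrix (A ** B) = complex_matrix A ** complex_matrix B"
  by (simp add: vec_eq_iff map_matrix_def matrix_matrix_mult_def)

lemma complex_matrix_add: "complex_matrix (A + B) = complex_matrix A + complex_matrix B"
  by (simp add: vec_eq_iff map_matrix_def)

lemma complex_matrix_transpose: "complex_matrix (transpose A) = transpose (complex_matrix A)"
  by (simp add: vec_eq_iff map_matrix_def transpose_def)

lemma cnj_vec_cnj_vec [simp]: "cnj_vec (cnj_vec v) = v"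
  by (simp add: vec_eq_iff cnj_vec_def)

lemma cnj_vec_scalar_mult: "cnj_vec (c *s v) = cnj c *s cnj_vec v"
  by (simp add: vec_eq_iff cnj_vec_def)

lemma complex_matrix_mult_cnj_vec: "complex_matrix A *v cnj_vec v = cnj_vec (complex_matrix A *v v)"
  by (simp add: vec_eq_iff cnj_vec_def map_matrix_def matrix_vector_mult_def)

lemma cnj_vec_mult_complex_matrix: "cnj_vec w v* complex_matrix A = cnj_vec (w v* complex_matrix A)"
  by (simp add: vec_eq_iff cnj_vec_def map_matrix_def vector_matrix_mult_def)

lemma scalar_product_cnj_vec: "scalar_product (cnj_vec w) (cnj_vec v) = cnj (scalar_product w v)"
  by (simp add: scalar_product_def cnj_vec_def)

lemma scalar_product_commute:
  "scalar_product v w = scalar_product w (v :: 'a::comm_semiring_1^'n)"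
  by (simp add: scalar_product_def mult.commute)

lemma scalar_product_scalar_mult_left:
  "scalar_product (c *s v) w = c * scalar_product v (w :: 'a::comm_semiring_1^'n)"
  by (simp add: scalar_product_def sum_distrib_left mult.assoc)

lemma scalar_product_scalar_mult_right:
  "scalar_product v (c *s w) = c * scalar_product v (w :: 'a::comm_semiring_1^'n)"
  by (simp add: scalar_product_def sum_distrib_left ac_simps)

lemma scalar_product_self_cnj: "scalar_product v (cnj_vec v) = of_real ((norm v)\<^sup>2)"
  by (simp add: scalar_product_def cnj_vec_def norm_vec_def L2_set_def sum_nonneg
      complex_norm_square[symmetric] del: of_real_power)

section \<open>Compactness and uniqueness at the critical parameter\<close>

lemma det_nonzero_no_eigenvector:
  fixes N :: "complex^'n^'n"
  assumes "det (N - mat l) \<noteq> 0" "N *v y = l *s y"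
  shows "y = 0"
proof -
  have "(N - mat l) *v y = 0"
  proof -
    have "mat l *v y = l *s y"
      by (simp add: vec_eq_iff matrix_vector_mult_def mat_def if_distrib if_distribR cong: if_cong)
    then show ?thesis using assms(2) by (simp add: matrix_vector_mult_diff_rdistrib)
  qed
  moreover obtain K where "K ** (N - mat l) = mat 1"
    using assms(1) invertible_det_nz unfolding invertible_def by blast
  ultimately show ?thesis
    by (metis matrix_vector_mul_assoc matrix_vector_mul_lid matrix_vector_mult_0_right)
qed

text \<open>If \<open>R\<close> does not tend to 0, its norm is at least some \<open>e > 0\<close>
  along a sequence, and compactness of the unit sphere yields a limit direction. Only directions are
  compared, so no a priori bound on \<open>R\<close> enters.\<close>

lemma tendsto_0_by_normalized_limits:
  fixes R :: "real \<Rightarrow> 'x::euclidean_space"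
  assumes "\<And>X E e. filterlim X (at_left c) sequentially \<Longrightarrow> e > 0 \<Longrightarrow> (\<And>k. norm (R (X k)) \<ge> e) \<Longrightarrow>
      (\<lambda>k. R (X k) /\<^sub>R norm (R (X k))) \<longlonglongrightarrow> E \<Longrightarrow> norm E = 1 \<Longrightarrow> False"
  shows "(R \<longlongrightarrow> 0) (at_left c)"
proof (rule ccontr)
  assume "\<not> (R \<longlongrightarrow> 0) (at_left c)"
  then obtain Y where Y: "\<And>i. Y i < c" "Y \<longlonglongrightarrow> c" "\<not> (\<lambda>i. R (Y i)) \<longlonglongrightarrow> 0"
    unfolding tendsto_at_iff_sequentially comp_def by auto
  from Y(3) obtain e where e: "e > 0" "\<And>m. \<exists>i\<ge>m. norm (R (Y i)) \<ge> e"
    unfolding lim_sequentially by (auto simp: not_less)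
  then have "infinite {i. norm (R (Y i)) \<ge> e}"
    unfolding infinite_nat_iff_unbounded_le by auto
  then have "\<exists>r::nat \<Rightarrow> nat. strict_mono r \<and> (\<forall>k. r k \<in> {i. norm (R (Y i)) \<ge> e})"
    by (rule infinite_enumerate)
  then obtain r :: "nat \<Rightarrow> nat" where r: "strict_mono r" "\<And>k. norm (R (Y (r k))) \<ge> e" by blast
  define u where "u k = R (Y (r k)) /\<^sub>R norm (R (Y (r k)))" for k
  have "u k \<in> sphere 0 1" for k
  proof -
    have "R (Y (r k)) \<noteq> 0" using r(2)[of k] e(1) by auto
    then show ?thesis by (simp add: u_def)
  qed
  then obtain E q where q: "E \<in> sphere 0 1" "strict_mono q" "(u \<circ> q) \<longlonglongrightarrow> E"
    using compact_sphere[of "0::'x" 1] unfolding compact_def by blast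
  define X where "X k = Y (r (q k))" for k
  have "(\<lambda>k. Y (r (q k))) \<longlonglongrightarrow> c"
    using LIMSEQ_subseq_LIMSEQ[OF Y(2) strict_mono_o[OF r(1) q(2)]] by (simp add: comp_def)
  then have "filterlim X (at_left c) sequentially"
    unfolding X_def filterlim_at using Y(1) by (simp add: less_imp_neq)
  then show False
    using assms[of X e E] e(1) r(2) q unfolding X_def u_def comp_def by auto
qed

text \<open>Norms bounded below cannot spoil a null sequence. Hence every linear relation that
  \<open>R\<close> satisfies asymptotically is satisfied exactly by a limit of its
  normalizations.\<close>

lemma normalized_tendsto_0:
  fixes f :: "nat \<Rightarrow> 'b::real_normed_vector"
  assumes "f \<longlonglongrightarrow> 0" "e > 0" "\<And>k. n k \<ge> (e::real)"
  shows "(\<lambda>k. f k /\<^sub>R n k) \<longlonglongrightarrow> 0"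
proof (rule Lim_null_comparison)
  have "norm (f k /\<^sub>R n k) \<le> norm (f k) / e" for k
  proof -
    have "inverse (n k) \<le> inverse e" "n k > 0"
      using assms(2) assms(3)[of k] by (auto intro: le_imp_inverse_le)
    then show ?thesis
      by (auto simp: divide_inverse mult.commute intro!: mult_right_mono)
  qed
  then show "\<forall>\<^sub>F k in sequentially. norm (f k /\<^sub>R n k) \<le> norm (f k) / e" by simp
  show "(\<lambda>k. norm (f k) / e) \<longlonglongrightarrow> 0"
    using tendsto_divide[OF tendsto_norm[OF assms(1)] tendsto_const, of e] assms(2) by simp
qed

text \<open>\<open>E w\<close> and its conjugate counterpart are annihilated by the left eigenvectors, so they are
  eigenvectors of \<open>N\<close> for imaginary eigenvalues and vanish; hence \<open>E\<close> solves the same equation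
  with \<open>N\<close> in place of \<open>M\<close>, and the spectrum of \<open>N\<close> lies in the open right half-plane.\<close>
lemma critical_lyapunov_unique:
  fixes M :: "real^'n^'n" and E :: "complex^'n^'n" and v w :: "complex^'n" and \<omega> :: real
  defines "N \<equiv> complex_matrix M + outer_prod v w + outer_prod (cnj_vec v) (cnj_vec w)"
  assumes w: "w v* complex_matrix M = (\<i> * of_real \<omega>) *s w"
    and det: "\<And>l. Re l \<le> 0 \<Longrightarrow> det (N - mat l) \<noteq> 0"
    and sym: "transpose E = E"
    and eq: "complex_matrix M ** E + E ** transpose (complex_matrix M) = 0"
    and E: "scalar_product w (E *v w) = 0" "scalar_product w (E *v cnj_vec w) = 0"
      "scalar_product (cnj_vec w) (E *v cnj_vec w) = 0"
  shows "E = 0"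
proof -
  let ?M = "complex_matrix M"
  have ker: "y = 0" if "Re l \<le> 0" "N *v y = l *s y" for l y
    using det_nonzero_no_eigenvector det that by blast
  have kerT: "y = 0" if "Re l \<le> 0" "transpose N *v y = l *s y" for l y
  proof -
    have "transpose N - mat l = transpose (N - mat l)"
      by (simp add: vec_eq_iff transpose_def mat_def)
    then have "det (transpose N - mat l) \<noteq> 0" using det[OF that(1)] by simp
    then show ?thesis using det_nonzero_no_eigenvector that(2) by blast
  qed
  have eq': "?M ** E = - (E ** transpose ?M)" using eq by (simp add: eq_neg_iff_add_eq_0)
  have kill: "E *v y = 0" if y: "y v* ?M = l *s y" "Re l = 0"
    and orth: "scalar_product w (E *v y) = 0" "scalar_product (cnj_vec w) (E *v y) = 0" for y l
  proof -
    have "N *v (E *v y) = ?M *v (E *v y)"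
      unfolding N_def by (simp add: matrix_vector_mult_add_rdistrib outer_prod_mult_vec orth)
    also have "\<dots> = - (E *v (transpose ?M *v y))"
    proof -
      have "(- (E ** transpose ?M)) *v y = - ((E ** transpose ?M) *v y)"
        by (simp add: matrix_vector_mult_def vec_eq_iff sum_negf)
      then show ?thesis by (simp only: matrix_vector_mul_assoc eq')
    qed
    also have "\<dots> = (- l) *s (E *v y)"
      by (simp add: transpose_matrix_vector y vector_scalar_commute vec_eq_iff)
    finally show ?thesis using ker[of "- l"] y(2) by auto
  qed
  \<comment> \<open>The fourth pairing follows from the symmetry of \<open>E\<close>; therefore
    three pairings among the hypotheses suffice to describe the critical block.\<close>
  have "scalar_product (cnj_vec w) (E *v w) = 0"
    using E(2) sym by (metis scalar_product_commute scalar_product_matrix transpose_matrix_vector)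
  then have Ew: "E *v w = 0" using kill[OF w] E(1) by simp
  have "cnj_vec w v* ?M = (- (\<i> * of_real \<omega>)) *s cnj_vec w"
    unfolding cnj_vec_mult_complex_matrix w cnj_vec_scalar_mult by simp
  then have Ew': "E *v cnj_vec w = 0" by (rule kill) (use E in auto)
  have wE: "w v* E = 0" "cnj_vec w v* E = 0"
    using Ew Ew' sym by (metis transpose_matrix_vector)+
  have "N ** E = ?M ** E"
    unfolding N_def
    by (simp add: matrix_add_rdistrib outer_prod_mult_matrix wE) (simp add: outer_prod_def vec_eq_iff)
  moreover have "E ** transpose N = E ** transpose ?M"
  proof -
    have "transpose N = transpose ?M + outer_prod w v + outer_prod (cnj_vec w) (cnj_vec v)"
      by (simp add: N_def vec_eq_iff transpose_def outer_prod_def mult.commute)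
    then show ?thesis
      by (simp add: matrix_add_ldistrib matrix_mult_outer_prod Ew Ew') (simp add: outer_prod_def vec_eq_iff)
  qed
  ultimately have "N ** E = - (E ** transpose N)" using eq' by simp
  then show ?thesis using sylvester_unique ker kerT by blast
qed

text \<open>The claimed limit solves the homogeneous Lyapunov equation at the critical point and has
  the right pairings with the critical left eigenvectors; everything else in the rescaled covariance
  is forced to vanish by \<open>critical_lyapunov_unique\<close>. The further conclusions are the
  limits of the eigenvector relations, from which the dual vectors and the nonconstancy of the limit
  are obtained later.\<close>

lemma scaled_covariance_tendsto:
  fixes M C :: "real \<Rightarrow> real^'n^'n" and B :: "real^'m^'n"
  assumes hopf: "simple_hopf_pair M ac \<eta> \<Omega> v w vc wc"
    and M: "(M \<longlongrightarrow> Mc) (at_left ac)"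
    and lyap: "\<forall>\<^sub>F a in at_left ac. M a ** C a + C a ** transpose (M a) = B ** transpose B"
    and sym: "\<forall>\<^sub>F a in at_left ac. transpose (C a) = C a"
    and noise: "((\<lambda>a. (norm (transpose (complex_matrix B) *v w a))\<^sup>2) \<longlongrightarrow> s) (at_left ac)"
  shows "((\<lambda>a. \<eta> a *\<^sub>R C a) \<longlongrightarrow>
      s *\<^sub>R (outer_prod (Re_vec vc) (Re_vec vc) + outer_prod (Im_vec vc) (Im_vec vc))) (at_left ac)"
    and "norm vc = 1" "scalar_product wc vc = 1" "scalar_product wc (cnj_vec vc) = 0"
    and "\<exists>\<omega>>0. complex_matrix Mc *v vc = (\<i> * of_real \<omega>) *s vc"
proof -
  let ?F = "at_left ac"
  let ?c = complex_matrix
  define l where "l a = Complex (\<eta> a) (\<Omega> a)" for a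
  note h = hopf[unfolded simple_hopf_pair_def, folded l_def]
  have h1: "\<forall>\<^sub>F a in ?F. diagonalizable (?c (M a)) \<and> simple_eigenvalue (?c (M a)) (l a) \<and>
      simple_eigenvalue (?c (M a)) (cnj (l a)) \<and> \<eta> a > 0"
    using h by (simp add: l_def complex_cnj)
  have \<eta>: "(\<eta> \<longlongrightarrow> 0) ?F" and v: "(v \<longlongrightarrow> vc) ?F" and w: "(w \<longlongrightarrow> wc) ?F"
    using h by auto
  obtain \<omega> where \<omega>: "\<omega> > 0" "(\<Omega> \<longlongrightarrow> \<omega>) ?F" using h by auto
  obtain \<delta> where \<delta>: "\<delta> > 0" "\<forall>\<^sub>F a in ?F. \<forall>k. eigenvalue (?c (M a)) k \<longrightarrow>
        k \<noteq> l a \<longrightarrow> k \<noteq> cnj (l a) \<longrightarrow> Re k \<ge> \<delta>"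
    using h by (auto simp: l_def complex_cnj)
  have h2: "\<forall>\<^sub>F a in ?F. ?c (M a) *v v a = l a *s v a \<and> w a v* ?c (M a) = l a *s w a \<and>
        norm (v a) = 1 \<and> scalar_product (w a) (v a) = 1 \<and> scalar_product (w a) (cnj_vec (v a)) = 0"
    using h by simp
  have lc: "(l \<longlongrightarrow> \<i> * of_real \<omega>) ?F"
  proof -
    have "((\<lambda>a. Complex (\<eta> a) (\<Omega> a)) \<longlongrightarrow> Complex 0 \<omega>) ?F"
      by (intro tendsto_Complex \<eta> \<omega>)
    moreover have "l = (\<lambda>a. Complex (\<eta> a) (\<Omega> a))" by (simp add: l_def fun_eq_iff)
    moreover have "Complex 0 \<omega> = \<i> * of_real \<omega>" by (simp add: complex_eq_iff)
    ultimately show ?thesis by simp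
  qed
  have nontriv: "?F \<noteq> bot" by simp
  note lims = v w lc \<eta> M
  have eqlim: "A = A'" if "(f \<longlongrightarrow> A) ?F" "(g \<longlongrightarrow> A') ?F" "\<forall>\<^sub>F a in ?F. f a = g a"
    for f g :: "real \<Rightarrow> 'z::t2_space" and A A'
    using tendsto_unique[OF nontriv _ that(2)] tendsto_cong[OF that(3)] that(1) by blast

  have vc: "?c Mc *v vc = (\<i> * of_real \<omega>) *s vc"
    by (rule eqlim[OF tendsto_matrix_vector_mult[OF tendsto_complex_matrix[OF M] v]
          tendsto_scalar_mult_vec[OF lc v]]) (use h2 in eventually_elim, simp)
  have wc: "wc v* ?c Mc = (\<i> * of_real \<omega>) *s wc"
    by (rule eqlim[OF tendsto_vector_matrix_mult[OF tendsto_complex_matrix[OF M] w]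
          tendsto_scalar_mult_vec[OF lc w]]) (use h2 in eventually_elim, simp)
  show nvc: "norm vc = 1"
    by (rule eqlim[OF tendsto_norm[OF v] tendsto_const]) (use h2 in eventually_elim, simp)
  show wv: "scalar_product wc vc = 1"
    by (rule eqlim[OF tendsto_scalar_product[OF w v] tendsto_const]) (use h2 in eventually_elim, simp)
  show wv': "scalar_product wc (cnj_vec vc) = 0"
    by (rule eqlim[OF tendsto_scalar_product[OF w tendsto_cnj_vec[OF v]] tendsto_const])
       (use h2 in eventually_elim, simp)
  show "\<exists>\<omega>>0. complex_matrix Mc *v vc = (\<i> * of_real \<omega>) *s vc" using vc \<omega>(1) by blast

  \<comment> \<open>A positive frequency separates the imaginary parts of the conjugate pair, as the
    determinant bound requires.\<close>
  have Om: "\<forall>\<^sub>F a in ?F. \<Omega> a > 0" using order_tendstoD(1)[OF \<omega>(2)] \<omega>(1) by blast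
  have detc: "det (?c Mc + outer_prod vc wc + outer_prod (cnj_vec vc) (cnj_vec wc) - mat k) \<noteq> 0"
    if k: "Re k \<le> 0" for k
  proof -
    have ev: "\<forall>\<^sub>F a in ?F. min \<delta> 1 ^ CARD('n) \<le> norm (det (?c (M a) + outer_prod (v a) (w a)
        + outer_prod (cnj_vec (v a)) (cnj_vec (w a)) - mat k))"
      using h1 h2 \<delta>(2) Om
    proof eventually_elim
      case (elim a)
      show ?case
      proof (rule det_shifted_pair_bound[where ?l1.0 = "l a" and ?l2.0 = "cnj (l a)"])
        show "Im (l a) \<noteq> Im (cnj (l a))" "Re (l a) > 0" "Re (cnj (l a)) > 0"
          using elim by (auto simp: l_def)
        show "?c (M a) *v cnj_vec (v a) = cnj (l a) *s cnj_vec (v a)"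
          "cnj_vec (w a) v* ?c (M a) = cnj (l a) *s cnj_vec (w a)"
          using elim by (simp_all add: complex_matrix_mult_cnj_vec cnj_vec_mult_complex_matrix cnj_vec_scalar_mult)
        show "scalar_product (cnj_vec (w a)) (cnj_vec (v a)) = 1"
          using elim by (simp add: scalar_product_cnj_vec)
        have "scalar_product (cnj_vec (w a)) (cnj_vec (cnj_vec (v a))) = 0"
          unfolding scalar_product_cnj_vec using elim by simp
        then show "scalar_product (cnj_vec (w a)) (v a) = 0" by simp
      qed (use elim k \<delta>(1) in auto)
    qed
    have "min \<delta> 1 ^ CARD('n) \<le> norm (det (?c Mc + outer_prod vc wc + outer_prod (cnj_vec vc) (cnj_vec wc) - mat k))"
      by (rule tendsto_lowerbound[OF _ ev nontriv]) (intro tendsto_intros lims)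
    moreover have "min \<delta> 1 ^ CARD('n) > 0" using \<delta>(1) by simp
    ultimately show ?thesis by auto
  qed

  \<comment> \<open>The complex form of the claimed limit: an entry is \<open>s\<close> times the
    real part of \<open>vc $ i * cnj (vc $ j)\<close>. The factor 1/2 matches the pairing
    \<open>s / 2\<close> with the left eigenvector and its conjugate.\<close>
  define G where "G = (s / 2) *\<^sub>R (outer_prod vc (cnj_vec vc) + outer_prod (cnj_vec vc) vc)"
  define R where "R a = \<eta> a *\<^sub>R ?c (C a) - G" for a
  have scR: "r *\<^sub>R A *v y = r *\<^sub>R (A *v y)" for r and A :: "complex^'n^'n" and y
    by (simp add: vec_eq_iff matrix_vector_mult_def scaleR_sum_right)
  have scl: "A ** (r *\<^sub>R D) = r *\<^sub>R (A ** D)" "(r *\<^sub>R A) ** D = r *\<^sub>R (A ** D)" for r and A D :: "complex^'n^'n"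
    by (simp_all add: vec_eq_iff matrix_matrix_mult_def scaleR_sum_right)
  have sub: "A ** (D - D') = A ** D - A ** D'" "(D - D') ** A = D ** A - D' ** A" for A D D' :: "complex^'n^'n"
    by (simp_all add: vec_eq_iff matrix_matrix_mult_def algebra_simps sum_subtractf)
  have sps: "scalar_product y (r *\<^sub>R x) = r *\<^sub>R scalar_product y x" for r and x y :: "complex^'n"
    by (simp add: scalar_product_def scaleR_sum_right)
  have spd: "scalar_product y (x - x') = scalar_product y x - scalar_product y x'"
      "scalar_product y (x + x') = scalar_product y x + scalar_product y x'" for x x' y :: "complex^'n"
    by (simp_all add: scalar_product_def algebra_simps sum_subtractf sum.distrib)

  have Gsym: "transpose G = G"
    by (simp add: G_def vec_eq_iff transpose_def outer_prod_def)
  have GM: "?c Mc ** G + G ** transpose (?c Mc) = 0"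
  proof -
    have "?c Mc *v cnj_vec vc = (- \<i> * of_real \<omega>) *s cnj_vec vc"
      by (simp add: complex_matrix_mult_cnj_vec vc cnj_vec_scalar_mult)
    then show ?thesis
      unfolding G_def scl matrix_add_ldistrib matrix_add_rdistrib matrix_mult_outer_prod
        outer_prod_mult_matrix vector_transpose_matrix
      by (simp add: vc) (simp add: vec_eq_iff outer_prod_def algebra_simps)
  qed
  \<comment> \<open>The noise term is multiplied by \<eta> and disappears, while \<open>G\<close>
    solves the limiting homogeneous equation. In \<open>G\<close> the eigenvalues of the two factors
    are conjugate and purely imaginary, so they cancel.\<close>
  have R1: "((\<lambda>a. ?c (M a) ** R a + R a ** transpose (?c (M a))) \<longlongrightarrow> 0) ?F"
  proof -
    have "\<forall>\<^sub>F a in ?F. \<eta> a *\<^sub>R ?c (B ** transpose B) - (?c (M a) ** G + G ** transpose (?c (M a)))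
        = ?c (M a) ** R a + R a ** transpose (?c (M a))"
      using lyap
    proof eventually_elim
      case (elim a)
      have "?c (B ** transpose B) = ?c (M a) ** ?c (C a) + ?c (C a) ** transpose (?c (M a))"
        by (simp add: complex_matrix_mult complex_matrix_add complex_matrix_transpose flip: elim)
      then show ?case unfolding R_def sub scl by (simp add: algebra_simps)
    qed
    moreover have "((\<lambda>a. \<eta> a *\<^sub>R ?c (B ** transpose B) - (?c (M a) ** G + G ** transpose (?c (M a))))
        \<longlongrightarrow> 0 *\<^sub>R ?c (B ** transpose B) - (?c Mc ** G + G ** transpose (?c Mc))) ?F"
      by (intro tendsto_intros lims)
    ultimately show ?thesis using tendsto_cong by (force simp: GM)
  qed
  \<comment> \<open>Pairing the Lyapunov equation with \<open>w a\<close> on the left and a left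
    eigenvector for \<open>k\<close> on the right multiplies the pairing of \<open>C a\<close> by
    \<open>l a + k\<close>. This is \<open>2 * l a\<close> for \<open>w a\<close> itself and
    \<open>2 * \<eta> a\<close> for its conjugate.\<close>
  have lyw: "\<forall>\<^sub>F a in ?F. 2 * l a * scalar_product (w a) (?c (C a) *v w a)
        = scalar_product (w a) (?c (B ** transpose B) *v w a)
      \<and> 2 * \<eta> a * scalar_product (w a) (?c (C a) *v cnj_vec (w a)) = (norm (transpose (?c B) *v w a))\<^sup>2"
    using lyap h2
  proof eventually_elim
    case (elim a)
    have L: "scalar_product (w a) (?c (B ** transpose B) *v y)
       = l a * scalar_product (w a) (?c (C a) *v y) + k * scalar_product (w a) (?c (C a) *v y)"
      if "y v* ?c (M a) = k *s y" for y k
    proof -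
      have "scalar_product (w a) (?c (M a) *v (?c (C a) *v y)) = l a * scalar_product (w a) (?c (C a) *v y)"
        using elim by (simp add: scalar_product_matrix[of _ "?c (M a)"] scalar_product_scalar_mult_left)
      moreover have "?c (C a) *v (transpose (?c (M a)) *v y) = k *s (?c (C a) *v y)"
        by (simp only: transpose_matrix_vector that vector_scalar_commute)
      ultimately show ?thesis
        unfolding elim(1)[symmetric]
        by (simp add: complex_matrix_add complex_matrix_mult complex_matrix_transpose
            matrix_vector_mult_add_rdistrib spd scalar_product_scalar_mult_right flip: matrix_vector_mul_assoc)
    qed
    have "cnj_vec (w a) v* ?c (M a) = cnj (l a) *s cnj_vec (w a)"
      using elim by (simp add: cnj_vec_mult_complex_matrix cnj_vec_scalar_mult)
    note L' = L[OF this]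
    have "scalar_product (w a) (?c (B ** transpose B) *v cnj_vec (w a))
       = scalar_product (w a v* ?c B) (cnj_vec (w a v* ?c B))"
      by (simp add: complex_matrix_mult complex_matrix_transpose scalar_product_matrix
          transpose_matrix_vector cnj_vec_mult_complex_matrix flip: matrix_vector_mul_assoc)
    also have "\<dots> = (norm (transpose (?c B) *v w a))\<^sup>2"
      by (simp add: scalar_product_self_cnj transpose_matrix_vector)
    finally have "(norm (transpose (?c B) *v w a))\<^sup>2
        = (l a + cnj (l a)) * scalar_product (w a) (?c (C a) *v cnj_vec (w a))"
      unfolding L' by (simp add: algebra_simps)
    moreover have "l a + cnj (l a) = 2 * \<eta> a" by (simp add: complex_eq_iff l_def)
    ultimately show ?case using L[of "w a" "l a"] elim by simp
  qed
  have Gw: "scalar_product wc (G *v wc) = 0" "scalar_product wc (G *v cnj_vec wc) = s / 2"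
  proof -
    have 1: "scalar_product (cnj_vec vc) wc = 0" using wv' by (simp add: scalar_product_commute)
    have 2: "scalar_product (cnj_vec vc) (cnj_vec wc) = 1"
      using wv by (simp add: scalar_product_cnj_vec scalar_product_commute)
    have G: "scalar_product wc (G *v y) = (s / 2) *\<^sub>R scalar_product (cnj_vec vc) y" for y
      unfolding G_def scR matrix_vector_mult_add_rdistrib outer_prod_mult_vec sps spd
        scalar_product_scalar_mult_right wv wv' by simp
    show "scalar_product wc (G *v wc) = 0" unfolding G 1 by simp
    show "scalar_product wc (G *v cnj_vec wc) = s / 2" unfolding G 2 by (simp add: scaleR_conv_of_real)
  qed
  have Rw: "scalar_product y (R a *v x) = \<eta> a * scalar_product y (?c (C a) *v x) - scalar_product y (G *v x)" for a x y
    unfolding R_def matrix_vector_mult_diff_rdistrib scR spd sps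
    by (simp add: scaleR_conv_of_real[where 'a=complex])
  have l0: "\<forall>\<^sub>F a in ?F. l a \<noteq> 0" using Om by eventually_elim (auto simp: l_def complex_eq_iff)
  \<comment> \<open>Division by \<open>2 * l a\<close> is harmless because \<open>l a\<close> tends
    to a nonzero imaginary number; the remaining factor \<eta> sends the term to 0.\<close>
  have R2: "((\<lambda>a. scalar_product (w a) (R a *v w a)) \<longlongrightarrow> 0) ?F"
  proof -
    have "\<forall>\<^sub>F a in ?F. of_real (\<eta> a) * (scalar_product (w a) (?c (B ** transpose B) *v w a) / (2 * l a))
        - scalar_product (w a) (G *v w a) = scalar_product (w a) (R a *v w a)"
      using lyw l0 by eventually_elim (auto simp: Rw field_simps)
    moreover have "((\<lambda>a. of_real (\<eta> a) * (scalar_product (w a) (?c (B ** transpose B) *v w a) / (2 * l a))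
        - scalar_product (w a) (G *v w a)) \<longlongrightarrow> of_real 0 * (scalar_product wc (?c (B ** transpose B) *v wc) / (2 * (\<i> * of_real \<omega>)))
        - scalar_product wc (G *v wc)) ?F"
      using \<omega>(1) by (intro tendsto_intros lims) auto
    ultimately show ?thesis using tendsto_cong by (force simp: Gw)
  qed
  have R3: "((\<lambda>a. scalar_product (w a) (R a *v cnj_vec (w a))) \<longlongrightarrow> 0) ?F"
  proof -
    have "\<forall>\<^sub>F a in ?F. complex_of_real ((norm (transpose (?c B) *v w a))\<^sup>2) / 2
        - scalar_product (w a) (G *v cnj_vec (w a)) = scalar_product (w a) (R a *v cnj_vec (w a))"
      using lyw by eventually_elim (auto simp: Rw field_simps)
    moreover have "((\<lambda>a. complex_of_real ((norm (transpose (?c B) *v w a))\<^sup>2) / 2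
        - scalar_product (w a) (G *v cnj_vec (w a))) \<longlongrightarrow> of_real s / 2 - scalar_product wc (G *v cnj_vec wc)) ?F"
      by (intro tendsto_intros lims noise) auto
    ultimately show ?thesis using tendsto_cong by (force simp: Gw)
  qed
  have R4: "((\<lambda>a. transpose (R a) - R a) \<longlongrightarrow> 0) ?F"
  proof -
    have "\<forall>\<^sub>F a in ?F. transpose (R a) - R a = 0"
      using sym
    proof eventually_elim
      case (elim a)
      have "transpose (R a) = \<eta> a *\<^sub>R transpose (?c (C a)) - transpose G"
        by (simp add: R_def transpose_def vec_eq_iff)
      then show ?case unfolding complex_matrix_transpose[symmetric] elim Gsym by (simp add: R_def)
    qed
    then show ?thesis by (rule tendsto_eventually)
  qed

  \<comment> \<open>The relations \<open>R1\<close> to \<open>R4\<close> are linear in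
    \<open>R\<close>, symmetry included in the form of a null limit, so they become exact for any
    limit \<open>E\<close> of normalized remainders.\<close>
  have "(R \<longlongrightarrow> 0) ?F"
  proof (rule tendsto_0_by_normalized_limits)
    fix X E and e :: real
    assume X: "filterlim X ?F sequentially" and e: "e > 0" "\<And>k. norm (R (X k)) \<ge> e"
      and E: "(\<lambda>k. R (X k) /\<^sub>R norm (R (X k))) \<longlonglongrightarrow> E" "norm E = 1"
    define n where "n k = norm (R (X k))" for k
    note along = filterlim_compose[OF _ X]
    note seqs = along[OF v] along[OF w] along[OF M] E(1)[folded n_def]
    have zero: "L = 0" if "(f \<longlongrightarrow> 0) ?F" "(\<lambda>k. g k) \<longlonglongrightarrow> L" "\<And>k. f (X k) /\<^sub>R n k = g k"
      for f :: "real \<Rightarrow> 'z::real_normed_vector" and g L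
    proof (rule LIMSEQ_unique[OF that(2)])
      show "g \<longlonglongrightarrow> 0"
        using normalized_tendsto_0[OF along[OF that(1)] e(1), of n] e(2) that(3) by (simp add: n_def)
    qed
    have E1: "?c Mc ** E + E ** transpose (?c Mc) = 0"
      by (rule zero[OF R1, of "\<lambda>k. ?c (M (X k)) ** (R (X k) /\<^sub>R n k) + (R (X k) /\<^sub>R n k) ** transpose (?c (M (X k)))"])
         (intro tendsto_intros seqs, simp add: scl scaleR_add_right)
    have E2: "scalar_product wc (E *v wc) = 0"
      by (rule zero[OF R2, of "\<lambda>k. scalar_product (w (X k)) ((R (X k) /\<^sub>R n k) *v w (X k))"])
         (intro tendsto_intros seqs, simp add: scR sps)
    have E3: "scalar_product wc (E *v cnj_vec wc) = 0"
      by (rule zero[OF R3, of "\<lambda>k. scalar_product (w (X k)) ((R (X k) /\<^sub>R n k) *v cnj_vec (w (X k)))"])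
         (intro tendsto_intros seqs, simp add: scR sps)
    have "transpose E - E = 0"
      by (rule zero[OF R4, of "\<lambda>k. transpose (R (X k) /\<^sub>R n k) - R (X k) /\<^sub>R n k"])
         (intro tendsto_intros seqs, simp add: vec_eq_iff transpose_def scaleR_diff_right)
    then have E4: "transpose E = E" by simp
    \<comment> \<open>The remainder has real entries, so the pairing with two conjugated
      eigenvectors is the conjugate of the one in \<open>R2\<close>.\<close>
    have cR: "cnj_vec (R a *v y) = R a *v cnj_vec y" for a y
    proof -
      have "cnj (R a $ i $ j) = R a $ i $ j" for i j
        by (simp add: R_def G_def outer_prod_def cnj_vec_def map_matrix_def mult.commute add.commute)
      then show ?thesis by (simp add: vec_eq_iff cnj_vec_def matrix_vector_mult_def)
    qed
    have R5: "((\<lambda>a. scalar_product (cnj_vec (w a)) (R a *v cnj_vec (w a))) \<longlongrightarrow> 0) ?F"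
      using tendsto_cnj[OF R2] by (simp add: cR flip: scalar_product_cnj_vec)
    have E5: "scalar_product (cnj_vec wc) (E *v cnj_vec wc) = 0"
      by (rule zero[OF R5, of "\<lambda>k. scalar_product (cnj_vec (w (X k))) ((R (X k) /\<^sub>R n k) *v cnj_vec (w (X k)))"])
         (intro tendsto_intros seqs, simp add: scR sps)
    have "E = 0"
      by (rule critical_lyapunov_unique[OF wc detc E4 E1 E2 E3 E5])
    with E(2) show False by simp
  qed
  then have lim: "((\<lambda>a. R a + G) \<longlongrightarrow> 0 + G) ?F" by (intro tendsto_intros)
  show "((\<lambda>a. \<eta> a *\<^sub>R C a) \<longlongrightarrow>
      s *\<^sub>R (outer_prod (Re_vec vc) (Re_vec vc) + outer_prod (Im_vec vc) (Im_vec vc))) ?F"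
  proof (intro vec_tendstoI)
    fix i j
    have "((\<lambda>a. Re ((R a + G) $ i $ j)) \<longlongrightarrow> Re (G $ i $ j)) ?F"
      using tendsto_Re[OF tendsto_vec_nth[OF tendsto_vec_nth[OF lim]], of i j] by simp
    then show "((\<lambda>a. (\<eta> a *\<^sub>R C a) $ i $ j) \<longlongrightarrow>
      (s *\<^sub>R (outer_prod (Re_vec vc) (Re_vec vc) + outer_prod (Im_vec vc) (Im_vec vc))) $ i $ j) ?F"
      by (simp add: R_def G_def outer_prod_def Re_vec_def Im_vec_def cnj_vec_def map_matrix_def algebra_simps)
  qed
qed

section \<open>Pairs of standard normal variables\<close>

lemma (in prob_space) integrable_bounded_complex:
  fixes f :: "'a \<Rightarrow> complex"
  assumes "f \<in> borel_measurable M" "\<And>x. norm (f x) \<le> b"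
  shows "integrable M f"
  by (rule integrable_const_bound[of _ b]) (use assms in auto)

text \<open>Reweighting by \<open>g\<close> divided by its mean is a change of probability measure,
  and the hypothesis says that it leaves the characteristic function of \<open>X\<close> unchanged.
  By uniqueness it leaves the law of \<open>X\<close> unchanged. The lower bound 1 keeps the density
  positive and the mean away from 0.\<close>

lemma (in prob_space) char_weighted_factor:
  fixes X g :: "'a \<Rightarrow> real"
  assumes [measurable]: "X \<in> borel_measurable M" "g \<in> borel_measurable M"
    and g: "\<And>x. 1 \<le> g x" "\<And>x. g x \<le> b"
    and char: "\<And>s. expectation (\<lambda>x. iexp (s * X x) * g x) = expectation (\<lambda>x. iexp (s * X x)) * expectation g"
    and [measurable]: "A \<in> sets borel"
  shows "expectation (\<lambda>x. indicator A (X x) * g x) = prob (X -` A \<inter> space M) * expectation g"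
proof -
  have gi: "integrable M g"
  proof (rule integrable_const_bound[of _ b])
    have "norm (g x) \<le> b" for x using g(1)[of x] g(2)[of x] by simp
    then show "AE x in M. norm (g x) \<le> b" by simp
  qed simp
  define c where "c = expectation g"
  have "expectation (\<lambda>_. 1) \<le> c" unfolding c_def by (rule integral_mono) (use gi g in auto)
  then have c: "c \<ge> 1" by (simp add: prob_space)
  have gc: "0 \<le> g x / c" for x using g(1)[of x] c by (intro divide_nonneg_nonneg) auto
  define N where "N = density M (\<lambda>x. ennreal (g x / c))"
  interpret N: prob_space N
  proof
    have "emeasure N (space N) = (\<integral>\<^sup>+x. ennreal (g x / c) \<partial>M)"
      unfolding N_def by (simp add: emeasure_density cong: nn_integral_cong)
    also have "\<dots> = ennreal (expectation (\<lambda>x. g x / c))"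
      by (rule nn_integral_eq_integral) (use gi gc in auto)
    also have "\<dots> = 1" using c by (simp add: c_def)
    finally show "emeasure N (space N) = 1" .
  qed
  have XN[measurable]: "X \<in> borel_measurable N" unfolding N_def by simp
  have "distr N borel X = distr M borel X"
  proof (rule Levy_uniqueness)
    show "real_distribution (distr N borel X)" by (rule N.real_distribution_distr) simp
    show "real_distribution (distr M borel X)" by (rule real_distribution_distr) simp
    show "char (distr N borel X) = char (distr M borel X)"
    proof
      fix t
      have "char (distr N borel X) t = integral\<^sup>L N (\<lambda>x. iexp (t * X x))"
        unfolding char_def by (subst integral_distr) auto
      also have "\<dots> = expectation (\<lambda>x. (g x / c) *\<^sub>R iexp (t * X x))"
        unfolding N_def by (subst integral_density) (use gc in auto)
      also have "\<dots> = expectation (\<lambda>x. (iexp (t * X x) * g x) / c)"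
        by (rule Bochner_Integration.integral_cong) (auto simp: scaleR_conv_of_real mult.commute)
      also have "\<dots> = expectation (\<lambda>x. iexp (t * X x) * g x) / c" by simp
      also have "\<dots> = expectation (\<lambda>x. iexp (t * X x))"
        unfolding char using c by (simp add: c_def)
      also have "\<dots> = char (distr M borel X) t"
        unfolding char_def by (subst integral_distr) auto
      finally show "char (distr N borel X) t = char (distr M borel X) t" .
    qed
  qed
  then have "measure N (X -` A \<inter> space N) = prob (X -` A \<inter> space M)"
    by (metis XN \<open>A \<in> sets borel\<close> \<open>X \<in> borel_measurable M\<close> measure_distr)
  moreover have "measure N (X -` A \<inter> space N) = integral\<^sup>L N (\<lambda>x. indicator A (X x))"
  proof -
    have "integral\<^sup>L N (\<lambda>x. indicator A (X x) :: real) = integral\<^sup>L N (indicator (X -` A \<inter> space N))"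
      by (rule Bochner_Integration.integral_cong) (auto simp: indicator_def)
    then show ?thesis by simp
  qed
  moreover have "\<dots> = expectation (\<lambda>x. (g x / c) *\<^sub>R indicator A (X x))"
    unfolding N_def by (subst integral_density) (use gc in auto)
  moreover have "\<dots> = expectation (\<lambda>x. indicator A (X x) * g x / c)"
    by (simp add: mult.commute)
  ultimately show ?thesis using c by (simp add: c_def field_simps)
qed

text \<open>Kac's theorem.\<close>
lemma (in prob_space) indep_var_if_char_factors:
  fixes X Y :: "'a \<Rightarrow> real"
  assumes [measurable]: "X \<in> borel_measurable M" "Y \<in> borel_measurable M"
    and fac: "\<And>s t. expectation (\<lambda>x. iexp (s * X x + t * Y x))
        = expectation (\<lambda>x. iexp (s * X x)) * expectation (\<lambda>x. iexp (t * Y x))"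
  shows "indep_var borel X borel Y"
proof -
  have int: "integrable M (\<lambda>x. iexp (f x))" if "f \<in> borel_measurable M" for f
    by (rule integrable_bounded_complex[of _ 1]) (use that in auto)
  have cs: "of_real (cos y) = (iexp y + iexp (- y)) / 2" "of_real (sin y) = (iexp y - iexp (- y)) / (2 * \<i>)" for y
    by (simp_all add: cos_exp_eq sin_exp_eq flip: cos_of_real sin_of_real)
  have fac': "expectation (\<lambda>x. iexp (s * X x) * iexp (t * Y x))
        = expectation (\<lambda>x. iexp (s * X x)) * expectation (\<lambda>x. iexp (t * Y x))" for s t
    using fac[of s t] by (simp add: exp_add[symmetric] distrib_left)
  have intp: "integrable M (\<lambda>x. iexp (s * X x) * iexp (t * Y x))" for s t
    using int[of "\<lambda>x. s * X x + t * Y x"] by (simp add: exp_add[symmetric] distrib_left)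
  \<comment> \<open>A density has to be real, so the factorization is first split into its cosine
    and sine parts in \<open>Y\<close>.\<close>
  have Ecos: "expectation (\<lambda>x. iexp (s * X x) * of_real (cos (t * Y x)))
      = expectation (\<lambda>x. iexp (s * X x)) * of_real (expectation (\<lambda>x. cos (t * Y x)))" for s t
  proof -
    have "expectation (\<lambda>x. iexp (s * X x) * of_real (cos (t * Y x)))
       = expectation (\<lambda>x. (iexp (s * X x) * iexp (t * Y x) + iexp (s * X x) * iexp ((- t) * Y x)) / 2)"
      unfolding cs by (simp add: distrib_left)
    also have "\<dots> = (expectation (\<lambda>x. iexp (s * X x) * iexp (t * Y x))
        + expectation (\<lambda>x. iexp (s * X x) * iexp ((- t) * Y x))) / 2"
      using intp[of s t] intp[of s "- t"] by simp
    also have "\<dots> = expectation (\<lambda>x. iexp (s * X x)) *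
        ((expectation (\<lambda>x. iexp (t * Y x)) + expectation (\<lambda>x. iexp ((- t) * Y x))) / 2)"
      unfolding fac' by (simp add: algebra_simps)
    also have "(expectation (\<lambda>x. iexp (t * Y x)) + expectation (\<lambda>x. iexp ((- t) * Y x))) / 2
        = expectation (\<lambda>x. (iexp (t * Y x) + iexp ((- t) * Y x)) / 2)"
      using int[of "\<lambda>x. t * Y x"] int[of "\<lambda>x. (-t) * Y x"] by simp
    also have "\<dots> = expectation (\<lambda>x. of_real (cos (t * Y x)))"
      unfolding cs by simp
    finally show ?thesis by simp
  qed
  have Esin: "expectation (\<lambda>x. iexp (s * X x) * of_real (sin (t * Y x)))
      = expectation (\<lambda>x. iexp (s * X x)) * of_real (expectation (\<lambda>x. sin (t * Y x)))" for s t
  proof -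
    have "expectation (\<lambda>x. iexp (s * X x) * of_real (sin (t * Y x)))
       = expectation (\<lambda>x. (iexp (s * X x) * iexp (t * Y x) - iexp (s * X x) * iexp ((- t) * Y x)) / (2 * \<i>))"
      unfolding cs by (rule Bochner_Integration.integral_cong) (simp_all add: right_diff_distrib)
    also have "\<dots> = (expectation (\<lambda>x. iexp (s * X x) * iexp (t * Y x))
        - expectation (\<lambda>x. iexp (s * X x) * iexp ((- t) * Y x))) / (2 * \<i>)"
      using intp[of s t] intp[of s "- t"] by simp
    also have "\<dots> = expectation (\<lambda>x. iexp (s * X x)) *
        ((expectation (\<lambda>x. iexp (t * Y x)) - expectation (\<lambda>x. iexp ((- t) * Y x))) / (2 * \<i>))"
      unfolding fac' by (simp add: algebra_simps)
    also have "(expectation (\<lambda>x. iexp (t * Y x)) - expectation (\<lambda>x. iexp ((- t) * Y x))) / (2 * \<i>)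
        = expectation (\<lambda>x. (iexp (t * Y x) - iexp ((- t) * Y x)) / (2 * \<i>))"
      using int[of "\<lambda>x. t * Y x"] int[of "\<lambda>x. (-t) * Y x"] by simp
    also have "\<dots> = expectation (\<lambda>x. of_real (sin (t * Y x)))"
      unfolding cs by simp
    finally show ?thesis by simp
  qed
  \<comment> \<open>Adding 2 to a function bounded by 1 gives an admissible weight with values
    between 1 and 3; the contribution of the constant is subtracted at the end.\<close>
  have weight: "expectation (\<lambda>x. indicator A (X x) * h (t * Y x))
      = prob (X -` A \<inter> space M) * expectation (\<lambda>x. h (t * Y x))"
    if A[measurable]: "A \<in> sets borel" and [measurable]: "h \<in> borel_measurable borel"
      and h: "\<And>y. \<bar>h y\<bar> \<le> (1::real)"
      and E: "\<And>s. expectation (\<lambda>x. iexp (s * X x) * of_real (h (t * Y x)))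
      = expectation (\<lambda>x. iexp (s * X x)) * of_real (expectation (\<lambda>x. h (t * Y x)))" for A h t
  proof -
    have hi: "integrable M (\<lambda>x. h (t * Y x))"
      by (rule integrable_const_bound[of _ 1]) (use h in auto)
    have ei: "integrable M (\<lambda>x. iexp (s * X x) * of_real (h (t * Y x)))" for s
      by (rule integrable_bounded_complex[of _ 1]) (use h in \<open>auto simp: norm_mult\<close>)
    have ai: "integrable M (\<lambda>x. indicator A (X x) :: real)"
      by (rule integrable_const_bound[of _ 1]) (auto simp: indicator_def)
    have ahi: "integrable M (\<lambda>x. indicator A (X x) * h (t * Y x))"
      by (rule integrable_const_bound[of _ 1]) (use h in \<open>auto simp: indicator_def\<close>)
    have ei2: "integrable M (\<lambda>x. iexp (s * X x))" for s by (rule int) auto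
    have "expectation (\<lambda>x. indicator A (X x) * (2 + h (t * Y x)))
        = prob (X -` A \<inter> space M) * expectation (\<lambda>x. 2 + h (t * Y x))"
    proof (rule char_weighted_factor[where b = 3])
      fix x show "1 \<le> 2 + h (t * Y x)" "2 + h (t * Y x) \<le> 3"
        using h[of "t * Y x"] by (auto simp: abs_le_iff)
    next
      fix s
      have "expectation (\<lambda>x. iexp (s * X x) * of_real (2 + h (t * Y x)))
        = expectation (\<lambda>x. iexp (s * X x) * 2 + iexp (s * X x) * of_real (h (t * Y x)))"
        by (simp add: distrib_left)
      also have "\<dots> = expectation (\<lambda>x. iexp (s * X x)) * 2 + expectation (\<lambda>x. iexp (s * X x) * of_real (h (t * Y x)))"
        using ei ei2 by simp
      also have "\<dots> = expectation (\<lambda>x. iexp (s * X x)) * of_real (expectation (\<lambda>x. 2 + h (t * Y x)))"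
        unfolding E using hi by (simp add: prob_space algebra_simps)
      finally show "expectation (\<lambda>x. iexp (s * X x) * of_real (2 + h (t * Y x)))
        = expectation (\<lambda>x. iexp (s * X x)) * of_real (expectation (\<lambda>x. 2 + h (t * Y x)))" .
    qed auto
    moreover have "expectation (\<lambda>x. indicator A (X x) * (2 + h (t * Y x)))
        = expectation (\<lambda>x. indicator A (X x)) * 2 + expectation (\<lambda>x. indicator A (X x) * h (t * Y x))"
      using ai ahi by (simp add: distrib_left)
    moreover have "expectation (\<lambda>x. indicator A (X x)) = prob (X -` A \<inter> space M)"
    proof -
      have "expectation (\<lambda>x. indicator A (X x) :: real) = expectation (indicator (X -` A \<inter> space M))"
        by (rule Bochner_Integration.integral_cong) (auto simp: indicator_def)
      then show ?thesis by simp
    qed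
    ultimately show ?thesis using hi by (simp add: prob_space algebra_simps)
  qed
  \<comment> \<open>The same argument with the roles exchanged: now
    \<open>1 + indicator A (X x)\<close> is the weight and the law of \<open>Y\<close> is tested.
    Its characteristic function under this weight is known from the cosine and sine cases of
    \<open>weight\<close>.\<close>
  have prod: "prob (X -` A \<inter> Y -` B \<inter> space M) = prob (X -` A \<inter> space M) * prob (Y -` B \<inter> space M)"
    if [measurable]: "A \<in> sets borel" "B \<in> sets borel" for A B
  proof -
    have ind: "expectation (\<lambda>x. indicator C (Z x) :: real) = prob (Z -` C \<inter> space M)"
      for C :: "real set" and Z :: "'a \<Rightarrow> real"
    proof -
      have "expectation (\<lambda>x. indicator C (Z x) :: real) = expectation (indicator (Z -` C \<inter> space M))"
        by (rule Bochner_Integration.integral_cong) (auto simp: indicator_def)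
      then show ?thesis by simp
    qed
    have ai: "integrable M (\<lambda>x. indicator A (X x) :: real)" "integrable M (\<lambda>x. indicator B (Y x) :: real)"
      "integrable M (\<lambda>x. indicator B (Y x) * indicator A (X x) :: real)"
      by (rule integrable_const_bound[of _ 1]; auto simp: indicator_def)+
    let ?a = "prob (X -` A \<inter> space M)"
    have E1: "expectation (\<lambda>x. 1 + indicator A (X x)) = 1 + ?a"
      using ai by (simp add: prob_space ind)
    have "expectation (\<lambda>x. indicator B (Y x) * (1 + indicator A (X x)))
        = prob (Y -` B \<inter> space M) * expectation (\<lambda>x. 1 + indicator A (X x))"
    proof (rule char_weighted_factor[where b = 2])
      fix t
      have ic: "integrable M (\<lambda>x. indicator A (X x) * cos (t * Y x))"
         "integrable M (\<lambda>x. indicator A (X x) * sin (t * Y x))"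
        by (rule integrable_const_bound[of _ 1]; auto simp: indicator_def)+
      have ic': "integrable M (\<lambda>x. cos (t * Y x))" "integrable M (\<lambda>x. sin (t * Y x))"
        by (rule integrable_const_bound[of _ 1]; auto)+
      have iexp: "iexp y = of_real (cos y) + \<i> * of_real (sin y)" for y
        by (simp add: cis_conv_exp[symmetric] complex_eq_iff)
      have "expectation (\<lambda>x. iexp (t * Y x) * of_real (indicator A (X x)))
        = expectation (\<lambda>x. of_real (indicator A (X x) * cos (t * Y x)) + \<i> * of_real (indicator A (X x) * sin (t * Y x)))"
        unfolding iexp by (rule Bochner_Integration.integral_cong) (auto simp: algebra_simps)
      also have "\<dots> = of_real (expectation (\<lambda>x. indicator A (X x) * cos (t * Y x)))
           + \<i> * of_real (expectation (\<lambda>x. indicator A (X x) * sin (t * Y x)))"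
        using ic by (simp del: of_real_mult)
      also have "\<dots> = of_real (?a * expectation (\<lambda>x. cos (t * Y x))) + \<i> * of_real (?a * expectation (\<lambda>x. sin (t * Y x)))"
        using weight[of A cos t] weight[of A sin t] Ecos Esin by auto
      also have "\<dots> = (of_real (expectation (\<lambda>x. cos (t * Y x))) + \<i> * of_real (expectation (\<lambda>x. sin (t * Y x)))) * ?a"
        by (simp add: algebra_simps)
      also have "\<dots> = expectation (\<lambda>x. iexp (t * Y x)) * ?a"
        unfolding iexp using ic' by simp
      finally have *: "expectation (\<lambda>x. iexp (t * Y x) * of_real (indicator A (X x))) = expectation (\<lambda>x. iexp (t * Y x)) * ?a" .
      have ei: "integrable M (\<lambda>x. iexp (t * Y x) * of_real (indicator A (X x)))"
        by (rule integrable_bounded_complex[of _ 1]) (auto simp: norm_mult indicator_def)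
      have "expectation (\<lambda>x. iexp (t * Y x) * of_real (1 + indicator A (X x)))
         = expectation (\<lambda>x. iexp (t * Y x) + iexp (t * Y x) * of_real (indicator A (X x)))"
        by (simp add: distrib_left)
      also have "\<dots> = expectation (\<lambda>x. iexp (t * Y x)) + expectation (\<lambda>x. iexp (t * Y x)) * ?a"
        using ei int[of "\<lambda>x. t * Y x"] * by simp
      finally show "expectation (\<lambda>x. iexp (t * Y x) * of_real (1 + indicator A (X x)))
        = expectation (\<lambda>x. iexp (t * Y x)) * of_real (expectation (\<lambda>x. 1 + indicator A (X x)))"
        unfolding E1 by (simp add: algebra_simps)
    qed (auto simp: indicator_def)
    moreover have "expectation (\<lambda>x. indicator B (Y x) * (1 + indicator A (X x)))
       = prob (Y -` B \<inter> space M) + expectation (\<lambda>x. indicator B (Y x) * indicator A (X x))"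
      using ai by (simp add: distrib_left ind)
    moreover have "expectation (\<lambda>x. indicator B (Y x) * indicator A (X x) :: real)
       = prob (X -` A \<inter> Y -` B \<inter> space M)"
    proof -
      have "expectation (\<lambda>x. indicator B (Y x) * indicator A (X x) :: real)
          = expectation (indicator (X -` A \<inter> Y -` B \<inter> space M))"
        by (rule Bochner_Integration.integral_cong) (auto simp: indicator_def)
      then show ?thesis by simp
    qed
    ultimately show ?thesis unfolding E1 by (simp add: algebra_simps)
  qed
  show ?thesis
    unfolding indep_var_eq
  proof (intro conjI)
    \<comment> \<open>The preimages of Borel sets already form a sigma-algebra, so the product
      formula for them is the whole of independence.\<close>
    have sig: "sigma_sets (space M) {Z -` A \<inter> space M |A. A \<in> sets borel} = {Z -` A \<inter> space M |A. A \<in> sets borel}"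
      for Z :: "'a \<Rightarrow> real"
      using sets_vimage_algebra[of "space M" Z borel] sets_vimage_algebra2[of Z "space M" borel] by auto
    show "indep_set (sigma_sets (space M) {X -` A \<inter> space M |A. A \<in> sets borel})
      (sigma_sets (space M) {Y -` A \<inter> space M |A. A \<in> sets borel})"
      unfolding sig indep_sets2_eq
    proof (intro conjI ballI)
      fix a b assume "a \<in> {X -` A \<inter> space M |A. A \<in> sets borel}" "b \<in> {Y -` A \<inter> space M |A. A \<in> sets borel}"
      then obtain A B where "a = X -` A \<inter> space M" "b = Y -` B \<inter> space M" "A \<in> sets borel" "B \<in> sets borel" by auto
      moreover have "(X -` A \<inter> space M) \<inter> (Y -` B \<inter> space M) = X -` A \<inter> Y -` B \<inter> space M" by auto
      ultimately show "prob (a \<inter> b) = prob a * prob b" using prod[of A B] by simp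
    qed auto
  qed auto
qed

text \<open>The Cramer-Wold principle for two coordinates. Every \<open>(s, t)\<close> is a multiple
  of a unit vector, so unit directions determine the joint characteristic function; as it splits
  into two Gaussian factors, the coordinates are independent.\<close>

lemma (in prob_space) std_normal_pair_law:
  assumes N: "\<And>s t. s\<^sup>2 + t\<^sup>2 = 1 \<Longrightarrow> distributed M lborel (\<lambda>x. s * X x + t * Y x) std_normal_density"
  shows "X \<in> borel_measurable M" "Y \<in> borel_measurable M"
    "distr M (borel \<Otimes>\<^sub>M borel) (\<lambda>x. (X x, Y x))
      = distr std_normal_distribution borel (\<lambda>x. x) \<Otimes>\<^sub>M distr std_normal_distribution borel (\<lambda>x. x)"
proof -
  have law: "(\<lambda>x. s * X x + t * Y x) \<in> borel_measurable M"
      "distr M borel (\<lambda>x. s * X x + t * Y x) = distr std_normal_distribution borel (\<lambda>x. x)"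
    if "s\<^sup>2 + t\<^sup>2 = 1" for s t
  proof -
    show *: "(\<lambda>x. s * X x + t * Y x) \<in> borel_measurable M"
      using distributed_measurable[OF N[OF that]] by simp
    have "distr M borel (\<lambda>x. s * X x + t * Y x) = distr M lborel (\<lambda>x. s * X x + t * Y x)"
      by (rule distr_cong) auto
    also have "\<dots> = std_normal_distribution"
      using distributed_distr_eq_density[OF N[OF that]] by simp
    also have "\<dots> = distr std_normal_distribution borel (\<lambda>x. x)"
      by (rule distr_id2[symmetric]) simp
    finally show "distr M borel (\<lambda>x. s * X x + t * Y x) = distr std_normal_distribution borel (\<lambda>x. x)" .
  qed
  show [measurable]: "X \<in> borel_measurable M" "Y \<in> borel_measurable M"
    using law(1)[of 1 0] law(1)[of 0 1] by simp_all
  have char: "expectation (\<lambda>x. iexp (s * X x + t * Y x)) = of_real (exp (- s\<^sup>2 / 2)) * of_real (exp (- t\<^sup>2 / 2))" for s t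
  proof (cases "s = 0 \<and> t = 0")
    case True
    then show ?thesis by (simp add: prob_space)
  next
    case False
    define c where "c = sqrt (s\<^sup>2 + t\<^sup>2)"
    have "s\<^sup>2 + t\<^sup>2 > 0" using False by (simp add: sum_power2_gt_zero_iff)
    then have c: "c > 0" "c\<^sup>2 = s\<^sup>2 + t\<^sup>2" by (simp_all add: c_def)
    have u: "(s / c)\<^sup>2 + (t / c)\<^sup>2 = 1"
      using \<open>s\<^sup>2 + t\<^sup>2 > 0\<close> unfolding power_divide c(2) add_divide_distrib[symmetric]
      by (simp add: sum_power2_gt_zero_iff)
    have "expectation (\<lambda>x. iexp (s * X x + t * Y x)) = expectation (\<lambda>x. iexp (c * (s / c * X x + t / c * Y x)))"
      using c by (simp add: distrib_left)
    also have "\<dots> = char (distr M borel (\<lambda>x. s / c * X x + t / c * Y x)) c"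
      unfolding char_def by (subst integral_distr) auto
    also have "\<dots> = char std_normal_distribution c"
      unfolding law(2)[OF u] by (subst distr_id2) auto
    also have "\<dots> = of_real (exp (- c\<^sup>2 / 2))" by (simp add: char_std_normal_distribution)
    also have "exp (- c\<^sup>2 / 2) = exp (- s\<^sup>2 / 2) * exp (- t\<^sup>2 / 2)"
      unfolding c(2) by (simp add: exp_add[symmetric] add_divide_distrib)
    finally show ?thesis by simp
  qed
  have "indep_var borel X borel Y"
  proof (rule indep_var_if_char_factors)
    fix s t
    show "expectation (\<lambda>x. iexp (s * X x + t * Y x))
        = expectation (\<lambda>x. iexp (s * X x)) * expectation (\<lambda>x. iexp (t * Y x))"
      using char[of s t] char[of s 0] char[of 0 t] by simp
  qed auto
  then show "distr M (borel \<Otimes>\<^sub>M borel) (\<lambda>x. (X x, Y x))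
      = distr std_normal_distribution borel (\<lambda>x. x) \<Otimes>\<^sub>M distr std_normal_distribution borel (\<lambda>x. x)"
    using law(2)[of 1 0] law(2)[of 0 1] unfolding indep_var_distribution_eq by simp
qed

text \<open>Translation moves the window to \<open>{\<phi>..<p + \<phi>}\<close>; the part beyond
  \<open>p\<close> is brought back by one period and fills the gap left below \<phi>.\<close>

lemma emeasure_periodic_shift:
  fixes Q :: "real set"
  assumes [measurable]: "Q \<in> sets borel" and per: "\<And>x. x + p \<in> Q \<longleftrightarrow> x \<in> Q" and \<phi>: "0 \<le> \<phi>" "\<phi> \<le> p"
  shows "emeasure lborel {x \<in> {0..<p}. x + \<phi> \<in> Q} = emeasure lborel {x \<in> {0..<p}. x \<in> Q}"
proof -
  have shift: "emeasure lborel {x. c + x \<in> A} = emeasure lborel A" if [measurable]: "A \<in> sets borel" for A and c :: real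
  proof -
    have "emeasure lborel A = emeasure (distr lborel borel ((+) c)) A" by (simp add: lborel_distr_plus)
    also have "\<dots> = emeasure lborel ((+) c -` A \<inter> space lborel)" by (rule emeasure_distr) auto
    finally show ?thesis by (simp add: vimage_def)
  qed
  have "{x \<in> {0..<p}. x + \<phi> \<in> Q} = {x. \<phi> + x \<in> {\<phi>..<p + \<phi>} \<inter> Q}" by (auto simp: add.commute)
  then have "emeasure lborel {x \<in> {0..<p}. x + \<phi> \<in> Q} = emeasure lborel ({\<phi>..<p + \<phi>} \<inter> Q)"
    using shift[of "{\<phi>..<p + \<phi>} \<inter> Q" \<phi>] by simp
  also have "{\<phi>..<p + \<phi>} \<inter> Q = ({\<phi>..<p} \<inter> Q) \<union> ({p..<p + \<phi>} \<inter> Q)" using \<phi> by auto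
  also have "emeasure lborel \<dots> = emeasure lborel ({\<phi>..<p} \<inter> Q) + emeasure lborel ({p..<p + \<phi>} \<inter> Q)"
    by (rule plus_emeasure[symmetric]) auto
  also have "emeasure lborel ({p..<p + \<phi>} \<inter> Q) = emeasure lborel {x. p + x \<in> {p..<p + \<phi>} \<inter> Q}"
    by (rule shift[symmetric]) auto
  also have "{x. p + x \<in> {p..<p + \<phi>} \<inter> Q} = {0..<\<phi>} \<inter> Q" using per by (auto simp: add.commute)
  also have "emeasure lborel ({\<phi>..<p} \<inter> Q) + emeasure lborel ({0..<\<phi>} \<inter> Q)
      = emeasure lborel (({\<phi>..<p} \<inter> Q) \<union> ({0..<\<phi>} \<inter> Q))"
    by (rule plus_emeasure) auto
  also have "({\<phi>..<p} \<inter> Q) \<union> ({0..<\<phi>} \<inter> Q) = {x \<in> {0..<p}. x \<in> Q}" using \<phi> by auto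
  finally show ?thesis .
qed

text \<open>The Gaussian pair is rotation invariant; averaging over all rotations replaces its angle
  by a uniform one.\<close>
lemma std_normal_pair_angle:
  fixes X Y :: "'a \<Rightarrow> real" and K :: "(real \<times> real) set"
  assumes "prob_space M"
    and N: "\<And>s t. s\<^sup>2 + t\<^sup>2 = 1 \<Longrightarrow> distributed M lborel (\<lambda>x. s * X x + t * Y x) std_normal_density"
    and [measurable]: "\<Theta> \<in> borel_measurable T"
    and unif: "distr T lborel \<Theta> = uniform_measure lborel {0..<2 * pi}"
    and K[measurable]: "K \<in> sets borel" and cone: "\<And>c x y. c > 0 \<Longrightarrow> (c * x, c * y) \<in> K \<longleftrightarrow> (x, y) \<in> K"
  shows "measure M {\<omega> \<in> space M. (X \<omega>, Y \<omega>) \<in> K} = measure T {\<omega> \<in> space T. (cos (\<Theta> \<omega>), sin (\<Theta> \<omega>)) \<in> K}"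
proof -
  interpret prob_space M by fact
  have [measurable]: "X \<in> borel_measurable M" "Y \<in> borel_measurable M"
    using std_normal_pair_law(1,2) N by blast+
  define U where "U = uniform_measure lborel {0..<2 * pi}"
  have [measurable_cong]: "sets U = sets borel" by (simp add: U_def uniform_measure_def)
  have sU: "space U = UNIV" by (simp add: U_def uniform_measure_def)
  interpret U: prob_space U unfolding U_def by (rule prob_space_uniform_measure) auto
  define Q where "Q = {\<theta>. (cos \<theta>, sin \<theta>) \<in> K}"
  have [measurable]: "Q \<in> sets borel" unfolding Q_def by measurable
  define k where "k = emeasure U Q"
  \<comment> \<open>A rotation permutes the unit directions, so the rotated pair satisfies the
    hypothesis \<open>N\<close> as well and has the same joint law.\<close>
  have rot: "emeasure M {\<omega> \<in> space M. (cos \<theta> * X \<omega> - sin \<theta> * Y \<omega>, sin \<theta> * X \<omega> + cos \<theta> * Y \<omega>) \<in> K}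
      = emeasure M {\<omega> \<in> space M. (X \<omega>, Y \<omega>) \<in> K}" for \<theta>
  proof -
    have N': "distributed M lborel (\<lambda>x. s * (cos \<theta> * X x - sin \<theta> * Y x) + t * (sin \<theta> * X x + cos \<theta> * Y x)) std_normal_density"
      if "s\<^sup>2 + t\<^sup>2 = 1" for s t
    proof -
      have "(s * cos \<theta> + t * sin \<theta>)\<^sup>2 + (t * cos \<theta> - s * sin \<theta>)\<^sup>2
          = (s\<^sup>2 + t\<^sup>2) * ((sin \<theta>)\<^sup>2 + (cos \<theta>)\<^sup>2)" by (simp only: power2_eq_square) algebra
      then have "distributed M lborel (\<lambda>x. (s * cos \<theta> + t * sin \<theta>) * X x + (t * cos \<theta> - s * sin \<theta>) * Y x) std_normal_density"
        using that by (intro N) simp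
      then show ?thesis by (simp add: algebra_simps)
    qed
    have eq: "distr M (borel \<Otimes>\<^sub>M borel) (\<lambda>x. (cos \<theta> * X x - sin \<theta> * Y x, sin \<theta> * X x + cos \<theta> * Y x))
        = distr M (borel \<Otimes>\<^sub>M borel) (\<lambda>x. (X x, Y x))"
      by (rule trans[OF std_normal_pair_law(3) std_normal_pair_law(3)[symmetric]])
         (simp_all add: N N')
    have [measurable]: "K \<in> sets (borel \<Otimes>\<^sub>M borel)" using K unfolding borel_prod .
    have em: "emeasure (distr M (borel \<Otimes>\<^sub>M borel) (\<lambda>x. (V x, W x))) K = emeasure M {\<omega> \<in> space M. (V \<omega>, W \<omega>) \<in> K}"
      if [measurable]: "V \<in> borel_measurable M" "W \<in> borel_measurable M" for V W :: "'a \<Rightarrow> real"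
      by (subst emeasure_distr) (auto intro!: arg_cong[where f = "emeasure M"])
    show ?thesis using arg_cong[OF eq, of "\<lambda>N. emeasure N K"] by (simp add: em)
  qed
  \<comment> \<open>In polar coordinates the rotation adds \<theta> to the angle \<phi> of the
    point. The radius is removed because \<open>K\<close> is a cone, and \<phi> because the uniform
    law is invariant under shifts modulo \<open>2 * pi\<close>. The origin has no angle and is
    excluded.\<close>
  have avg: "(\<integral>\<^sup>+\<theta>. indicator K (cos \<theta> * x - sin \<theta> * y, sin \<theta> * x + cos \<theta> * y) \<partial>U) = k"
    if "x \<noteq> 0 \<or> y \<noteq> 0" for x y
  proof -
    define r where "r = sqrt (x\<^sup>2 + y\<^sup>2)"
    have "x\<^sup>2 + y\<^sup>2 > 0" using that by (simp add: sum_power2_gt_zero_iff)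
    then have r: "r > 0" "r\<^sup>2 = x\<^sup>2 + y\<^sup>2" by (simp_all add: r_def)
    have "(x / r)\<^sup>2 + (y / r)\<^sup>2 = 1"
      using \<open>x\<^sup>2 + y\<^sup>2 > 0\<close> unfolding power_divide r(2) add_divide_distrib[symmetric]
      by (simp add: sum_power2_gt_zero_iff)
    then obtain \<phi> where \<phi>: "0 \<le> \<phi>" "\<phi> < 2 * pi" "x / r = cos \<phi>" "y / r = sin \<phi>"
      using sincos_total_2pi[of "x / r" "y / r"] by metis
    have xy: "x = r * cos \<phi>" "y = r * sin \<phi>" using \<phi> r by (simp_all add: field_simps)
    have "(cos \<theta> * x - sin \<theta> * y, sin \<theta> * x + cos \<theta> * y) \<in> K \<longleftrightarrow> \<theta> + \<phi> \<in> Q" for \<theta>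
    proof -
      have "cos \<theta> * x - sin \<theta> * y = r * cos (\<theta> + \<phi>)" "sin \<theta> * x + cos \<theta> * y = r * sin (\<theta> + \<phi>)"
        unfolding xy by (simp_all add: cos_add sin_add algebra_simps)
      then show ?thesis using cone[OF r(1)] by (simp add: Q_def)
    qed
    then have "(\<integral>\<^sup>+\<theta>. indicator K (cos \<theta> * x - sin \<theta> * y, sin \<theta> * x + cos \<theta> * y) \<partial>U)
       = (\<integral>\<^sup>+\<theta>. indicator {\<theta>. \<theta> + \<phi> \<in> Q} \<theta> \<partial>U)"
      by (intro nn_integral_cong) (auto simp: indicator_def)
    also have "\<dots> = emeasure U {\<theta>. \<theta> + \<phi> \<in> Q}" by (rule nn_integral_indicator) measurable
    also have "\<dots> = emeasure lborel {x \<in> {0..<2 * pi}. x + \<phi> \<in> Q} / emeasure lborel {0..<2 * pi}"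
      unfolding U_def by (subst emeasure_uniform_measure) (auto intro!: arg_cong2[where f = "(/)"] arg_cong[where f = "emeasure lborel"])
    also have "emeasure lborel {x \<in> {0..<2 * pi}. x + \<phi> \<in> Q} = emeasure lborel {x \<in> {0..<2 * pi}. x \<in> Q}"
      by (rule emeasure_periodic_shift) (use \<phi> in \<open>auto simp: Q_def\<close>)
    also have "\<dots> / emeasure lborel {0..<2 * pi} = k"
      unfolding k_def U_def by (subst emeasure_uniform_measure) (auto intro!: arg_cong2[where f = "(/)"] arg_cong[where f = "emeasure lborel"])
    finally show ?thesis .
  qed
  have ae: "AE \<omega> in M. X \<omega> \<noteq> 0 \<or> Y \<omega> \<noteq> 0"
  proof -
    have "AE x in lborel. x \<noteq> (0::real)" by (rule AE_lborel_singleton)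
    then have "AE x in density lborel std_normal_density. x \<noteq> 0"
      by (subst AE_density) (auto elim: eventually_mono)
    moreover have "distr M lborel X = density lborel std_normal_density"
      using distributed_distr_eq_density[OF N[of 1 0]] by simp
    ultimately have "AE x in distr M lborel X. x \<noteq> 0" by (simp only:)
    then have "AE \<omega> in M. X \<omega> \<noteq> 0" by (subst (asm) AE_distr_iff) auto
    then show ?thesis by eventually_elim simp
  qed
  interpret P: pair_sigma_finite U M ..
  have "emeasure M {\<omega> \<in> space M. (X \<omega>, Y \<omega>) \<in> K}
     = (\<integral>\<^sup>+\<theta>. emeasure M {\<omega> \<in> space M. (X \<omega>, Y \<omega>) \<in> K} \<partial>U)"
    by (simp add: U.emeasure_space_1)
  also have "\<dots> = (\<integral>\<^sup>+\<theta>. (\<integral>\<^sup>+\<omega>. indicator K (cos \<theta> * X \<omega> - sin \<theta> * Y \<omega>, sin \<theta> * X \<omega> + cos \<theta> * Y \<omega>) \<partial>M) \<partial>U)"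
  proof (rule nn_integral_cong)
    fix \<theta>
    have "(\<integral>\<^sup>+\<omega>. indicator K (cos \<theta> * X \<omega> - sin \<theta> * Y \<omega>, sin \<theta> * X \<omega> + cos \<theta> * Y \<omega>) \<partial>M)
      = (\<integral>\<^sup>+\<omega>. indicator {\<omega> \<in> space M. (cos \<theta> * X \<omega> - sin \<theta> * Y \<omega>, sin \<theta> * X \<omega> + cos \<theta> * Y \<omega>) \<in> K} \<omega> \<partial>M)"
      by (rule nn_integral_cong) (auto simp: indicator_def)
    also have "\<dots> = emeasure M {\<omega> \<in> space M. (cos \<theta> * X \<omega> - sin \<theta> * Y \<omega>, sin \<theta> * X \<omega> + cos \<theta> * Y \<omega>) \<in> K}"
      by (rule nn_integral_indicator) measurable
    finally show "emeasure M {\<omega> \<in> space M. (X \<omega>, Y \<omega>) \<in> K}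
      = (\<integral>\<^sup>+\<omega>. indicator K (cos \<theta> * X \<omega> - sin \<theta> * Y \<omega>, sin \<theta> * X \<omega> + cos \<theta> * Y \<omega>) \<partial>M)"
      unfolding rot by simp
  qed
  also have "\<dots> = (\<integral>\<^sup>+\<omega>. (\<integral>\<^sup>+\<theta>. indicator K (cos \<theta> * X \<omega> - sin \<theta> * Y \<omega>, sin \<theta> * X \<omega> + cos \<theta> * Y \<omega>) \<partial>U) \<partial>M)"
    by (rule P.Fubini'[symmetric]) measurable
  also have "\<dots> = (\<integral>\<^sup>+\<omega>. k \<partial>M)"
    by (rule nn_integral_cong_AE) (use ae in eventually_elim, rule avg)
  also have "\<dots> = k" by (simp add: emeasure_space_1)
  also have "k = emeasure (distr T lborel \<Theta>) Q" unfolding k_def unif U_def ..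
  also have "\<dots> = emeasure T {\<omega> \<in> space T. (cos (\<Theta> \<omega>), sin (\<Theta> \<omega>)) \<in> K}"
    by (subst emeasure_distr) (auto simp: Q_def intro!: arg_cong[where f = "emeasure T"])
  finally show ?thesis by (simp add: measure_def)
qed

section \<open>Closeness in probability and weak convergence\<close>

text \<open>A form of Slutsky's theorem in which the probability space varies with the parameter:
  \<open>X a\<close> is compared with \<open>Z a\<close> on its own space, and all
  \<open>Z a\<close> share the law \<open>L\<close>. The distribution function of \<open>X a\<close>
  at \<open>x\<close> lies between those of \<open>L\<close> at \<open>x - d'\<close> and
  \<open>x + d'\<close>, up to the probability of a deviation of at least \<open>d'\<close>.\<close>

lemma weak_conv_along_if_close_in_prob:
  fixes X Z :: "'a \<Rightarrow> 'w \<Rightarrow> real"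
  assumes prob: "\<forall>\<^sub>F a in F. prob_space (S a)"
    and meas: "\<forall>\<^sub>F a in F. X a \<in> borel_measurable (S a) \<and> Z a \<in> borel_measurable (S a)"
    and law: "\<forall>\<^sub>F a in F. distr (S a) borel (Z a) = L"
    and close: "\<And>e. e > 0 \<Longrightarrow> ((\<lambda>a. measure (S a) {\<omega> \<in> space (S a). \<bar>X a \<omega> - Z a \<omega>\<bar> \<ge> e}) \<longlongrightarrow> 0) F"
  shows "weak_conv_along F (\<lambda>a. distr (S a) borel (X a)) L"
  unfolding weak_conv_along_def
proof (intro allI impI)
  fix x assume cont: "isCont (cdf L) x"
  show "((\<lambda>a. cdf (distr (S a) borel (X a)) x) \<longlongrightarrow> cdf L x) F"
  proof (rule tendstoI)
    fix e :: real assume e: "e > 0"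
    then obtain d where d: "d > 0" "\<And>y. dist y x < d \<Longrightarrow> dist (cdf L y) (cdf L x) < e / 2"
      using cont unfolding continuous_at_eps_delta by (meson half_gt_zero)
    define d' where "d' = d / 2"
    have d': "d' > 0" "dist (cdf L (x + d')) (cdf L x) < e / 2" "dist (cdf L (x - d')) (cdf L x) < e / 2"
      using d by (auto simp: d'_def dist_real_def)
    have "\<forall>\<^sub>F a in F. measure (S a) {\<omega> \<in> space (S a). \<bar>X a \<omega> - Z a \<omega>\<bar> \<ge> d'} < e / 2"
      by (rule order_tendstoD(2)[OF close[OF d'(1)]]) (use e in simp)
    with prob meas law show "\<forall>\<^sub>F a in F. dist (cdf (distr (S a) borel (X a)) x) (cdf L x) < e"
    proof eventually_elim
      case (elim a)
      interpret prob_space "S a" by (rule elim)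
      have [measurable]: "X a \<in> borel_measurable (S a)" "Z a \<in> borel_measurable (S a)" using elim by auto
      have cdf: "cdf (distr (S a) borel V) y = prob {\<omega> \<in> space (S a). V \<omega> \<le> y}"
        if [measurable]: "V \<in> borel_measurable (S a)" for V y
        unfolding cdf_def2 by (subst measure_distr) (auto intro!: arg_cong[where f = "measure (S a)"])
      let ?D = "{\<omega> \<in> space (S a). \<bar>X a \<omega> - Z a \<omega>\<bar> \<ge> d'}"
      have "prob {\<omega> \<in> space (S a). X a \<omega> \<le> x} \<le> prob ({\<omega> \<in> space (S a). Z a \<omega> \<le> x + d'} \<union> ?D)"
        by (rule finite_measure_mono) auto
      also have "\<dots> \<le> prob {\<omega> \<in> space (S a). Z a \<omega> \<le> x + d'} + prob ?D"
        by (rule measure_Un_le) auto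
      finally have up: "cdf (distr (S a) borel (X a)) x \<le> cdf L (x + d') + prob ?D"
        unfolding elim(3)[symmetric] by (simp add: cdf)
      have "prob {\<omega> \<in> space (S a). Z a \<omega> \<le> x - d'} \<le> prob ({\<omega> \<in> space (S a). X a \<omega> \<le> x} \<union> ?D)"
        by (rule finite_measure_mono) auto
      also have "\<dots> \<le> prob {\<omega> \<in> space (S a). X a \<omega> \<le> x} + prob ?D"
        by (rule measure_Un_le) auto
      finally have lo: "cdf L (x - d') \<le> cdf (distr (S a) borel (X a)) x + prob ?D"
        unfolding elim(3)[symmetric] by (simp add: cdf)
      show ?case using up lo d'(2,3) elim(4) unfolding dist_real_def by linarith
    qed
  qed
qed

text \<open>Continuous mapping for a function that is continuous only on an open set of full
  measure. Since the law of \<open>Z a\<close> does not depend on \<open>a\<close>, one compact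
  \<open>K\<close> inside \<open>G\<close> carries almost all its mass for every parameter at once.
  \<open>X a\<close> is merely near \<open>K\<close>, so uniform continuity is taken on a compact
  neighbourhood of \<open>K\<close> in \<open>G\<close>.\<close>

lemma close_in_prob_continuous_image:
  fixes X Z :: "'a \<Rightarrow> 'w \<Rightarrow> 'e::euclidean_space" and g :: "'e \<Rightarrow> real"
  assumes prob: "\<forall>\<^sub>F a in F. prob_space (S a)"
    and meas: "\<forall>\<^sub>F a in F. X a \<in> borel_measurable (S a) \<and> Z a \<in> borel_measurable (S a)"
    and law: "\<forall>\<^sub>F a in F. distr (S a) borel (Z a) = \<nu>"
    and \<nu>: "prob_space \<nu>" "sets \<nu> = sets borel" and G: "open G" "measure \<nu> G = 1"
    and cont: "continuous_on G g" and g[measurable]: "g \<in> borel_measurable borel"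
    and close: "\<And>e. e > 0 \<Longrightarrow> ((\<lambda>a. measure (S a) {\<omega> \<in> space (S a). dist (X a \<omega>) (Z a \<omega>) \<ge> e}) \<longlongrightarrow> 0) F"
    and e: "e > 0"
  shows "((\<lambda>a. measure (S a) {\<omega> \<in> space (S a). \<bar>g (X a \<omega>) - g (Z a \<omega>)\<bar> \<ge> e}) \<longlongrightarrow> 0) F"
proof (rule tendstoI)
  fix r :: real assume r: "r > 0"
  interpret \<nu>: prob_space \<nu> by fact
  have Gs: "G \<in> sets \<nu>" using G(1) \<nu>(2) by simp
  have "emeasure \<nu> G = (SUP K \<in> {K. K \<subseteq> G \<and> compact K}. emeasure \<nu> K)"
    by (rule inner_regular) (use \<nu> Gs in \<open>auto simp: \<nu>.emeasure_eq_measure\<close>)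
  moreover have "emeasure \<nu> G > ennreal (1 - r / 2)"
    using r by (simp add: \<nu>.emeasure_eq_measure G(2) flip: ennreal_1 add: ennreal_less_iff ennreal_lessI)
  ultimately obtain K where K: "K \<subseteq> G" "compact K" "emeasure \<nu> K > ennreal (1 - r / 2)"
    by (auto simp: less_SUP_iff)
  have Ks: "K \<in> sets borel" using K(2) by (simp add: borel_compact)
  have "measure \<nu> K > 1 - r / 2"
    using K(3) by (simp add: \<nu>.emeasure_eq_measure) (smt (verit) ennreal_leI measure_nonneg not_le)
  then have mK: "measure \<nu> (- K) < r / 2"
    using \<nu>.prob_compl[of K] Ks \<nu> by (simp add: sets_eq_imp_space_eq[OF \<nu>(2)] Compl_eq_Diff_UNIV)
  obtain c where c: "c > 0" "(\<Union>x\<in>K. cball x c) \<subseteq> G"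
    using compact_subset_open_imp_cball_epsilon_subset[OF K(2) G(1) K(1)] by metis
  have cK: "compact {x + y |x y. x \<in> K \<and> y \<in> cball 0 c}" by (rule compact_sums[OF K(2) compact_cball])
  have eqK: "{x + y |x y. x \<in> K \<and> y \<in> cball 0 c} = (\<Union>x\<in>K. cball x c)" (is "?A = ?B")
  proof
    show "?A \<subseteq> ?B" by (auto simp: dist_norm)
    show "?B \<subseteq> ?A"
    proof
      fix z assume "z \<in> ?B"
      then obtain x where "x \<in> K" "z \<in> cball x c" by auto
      then have "z = x + (z - x)" "z - x \<in> cball 0 c" by (auto simp: dist_norm norm_minus_commute)
      then show "z \<in> ?A" using \<open>x \<in> K\<close> by blast
    qed
  qed
  define N where "N = (\<Union>x\<in>K. cball x c)"
  have "compact N" "N \<subseteq> G" using cK c(2) unfolding eqK N_def .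
  then have "uniformly_continuous_on N g"
    using cont by (meson compact_uniformly_continuous continuous_on_subset)
  then obtain d0 where d0: "d0 > 0" "\<And>x y. x \<in> N \<Longrightarrow> y \<in> N \<Longrightarrow> dist y x < d0 \<Longrightarrow> dist (g y) (g x) < e"
    unfolding uniformly_continuous_on_def using e by meson
  define d where "d = min c d0"
  have d: "d > 0" "\<bar>g y - g x\<bar> < e" if "x \<in> K" "dist y x < d" for x y
  proof -
    have "y \<in> cball x c" "x \<in> cball x c" using that(2) c(1) by (auto simp: d_def dist_commute)
    then have "y \<in> N" "x \<in> N" using that(1) unfolding N_def by blast+
    then show "\<bar>g y - g x\<bar> < e" using d0(2)[of x y] that by (simp add: d_def dist_real_def)
  qed (use c d0 in \<open>auto simp: d_def\<close>)
  have dpos: "d > 0" using c d0 by (auto simp: d_def)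
  have "\<forall>\<^sub>F a in F. measure (S a) {\<omega> \<in> space (S a). dist (X a \<omega>) (Z a \<omega>) \<ge> d} < r / 2"
    by (rule order_tendstoD(2)[OF close[OF dpos]]) (use r in simp)
  with prob meas law show "\<forall>\<^sub>F a in F. dist (measure (S a) {\<omega> \<in> space (S a). \<bar>g (X a \<omega>) - g (Z a \<omega>)\<bar> \<ge> e}) 0 < r"
  proof eventually_elim
    case (elim a)
    interpret prob_space "S a" by (rule elim)
    have [measurable]: "X a \<in> borel_measurable (S a)" "Z a \<in> borel_measurable (S a)" using elim by auto
    let ?D = "{\<omega> \<in> space (S a). dist (X a \<omega>) (Z a \<omega>) \<ge> d}"
    let ?N = "{\<omega> \<in> space (S a). Z a \<omega> \<notin> K}"
    have [measurable]: "K \<in> sets borel" by fact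
    have "prob {\<omega> \<in> space (S a). \<bar>g (X a \<omega>) - g (Z a \<omega>)\<bar> \<ge> e} \<le> prob (?D \<union> ?N)"
    proof (rule finite_measure_mono)
      show "{\<omega> \<in> space (S a). \<bar>g (X a \<omega>) - g (Z a \<omega>)\<bar> \<ge> e} \<subseteq> ?D \<union> ?N"
        using d(2) by (auto simp: not_less) (meson not_le)
    qed measurable
    also have "\<dots> \<le> prob ?D + prob ?N" by (rule measure_Un_le) auto
    also have "prob ?N = measure \<nu> (- K)"
      unfolding elim(3)[symmetric] by (subst measure_distr) (auto intro!: arg_cong[where f = "measure (S a)"])
    finally show ?case using elim(4) mK by simp
  qed
qed

text \<open>The interval is read off from \<open>L\<close> alone, far enough out in both tails. Its
  endpoints must be continuity points of the distribution function; these are dense because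
  \<open>L\<close> has at most countably many atoms.\<close>

lemma tight_along_if_weak_conv_along:
  assumes L: "real_distribution L" and conv: "weak_conv_along F \<mu> L"
    and \<mu>: "\<forall>\<^sub>F t in F. real_distribution (\<mu> t)"
  shows "tight_along F \<mu>"
  unfolding tight_along_def
proof (intro allI impI)
  fix e :: real assume e: "e > 0"
  interpret L: real_distribution L by fact
  have cdense: "\<exists>x. c < x \<and> x < d \<and> isCont (cdf L) x" if cd: "c < d" for c d
  proof (rule ccontr)
    assume no: "\<not> ?thesis"
    have "{c<..<d} \<subseteq> {x. measure L {x} > 0}"
    proof
      fix x assume "x \<in> {c<..<d}"
      then have "\<not> isCont (cdf L) x" using no by auto
      then show "x \<in> {x. measure L {x} > 0}"
        using L.isCont_cdf[of x] measure_nonneg[of L "{x}"] by (auto simp: less_le)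
    qed
    then have "countable {c<..<d}" using L.countable_atoms countable_subset by blast
    then show False using uncountable_open_interval cd by blast
  qed
  have "\<forall>\<^sub>F x in at_top. cdf L x > 1 - e / 2"
    by (rule order_tendstoD(1)[OF L.cdf_lim_at_top_prob]) (use e in simp)
  then obtain b0 where b0: "\<And>x. x \<ge> b0 \<Longrightarrow> cdf L x > 1 - e / 2" by (auto simp: eventually_at_top_linorder)
  have "\<forall>\<^sub>F x in at_bot. cdf L x < e / 2"
    by (rule order_tendstoD(2)[OF L.cdf_lim_at_bot]) (use e in simp)
  then obtain a0 where a0: "\<And>x. x \<le> a0 \<Longrightarrow> cdf L x < e / 2" by (auto simp: eventually_at_bot_linorder)
  have "min a0 b0 - 1 < min a0 b0" "b0 < b0 + 1" by linarith+
  then obtain a b where a: "a < min a0 b0" "isCont (cdf L) a" and b: "b > b0" "isCont (cdf L) b"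
    using cdense by meson
  have ab: "a < b" using a b by simp
  have gap: "cdf L b - cdf L a > 1 - e" using b0[of b] a0[of a] a b by simp
  have "((\<lambda>t. cdf (\<mu> t) b - cdf (\<mu> t) a) \<longlongrightarrow> cdf L b - cdf L a) F"
    using conv a b unfolding weak_conv_along_def by (intro tendsto_diff) auto
  then have "\<forall>\<^sub>F t in F. cdf (\<mu> t) b - cdf (\<mu> t) a > 1 - e"
    using gap by (rule order_tendstoD)
  with \<mu> have "\<forall>\<^sub>F t in F. measure (\<mu> t) {a<..b} > 1 - e"
  proof eventually_elim
    case (elim t)
    interpret real_distribution "\<mu> t" by (rule elim)
    show ?case using elim(2) cdf_diff_eq[OF ab] by simp
  qed
  then show "\<exists>a b. a < b \<and> (\<forall>\<^sub>F t in F. measure (\<mu> t) {a<..b} > 1 - e)" using ab by blast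
qed

section \<open>Degenerating Gaussian vectors\<close>

lemma gaussian_vector_scaleR:
  assumes "gaussian_vector S z 0 C"
  shows "gaussian_vector S (\<lambda>\<omega>. c *\<^sub>R z \<omega>) 0 (c\<^sup>2 *\<^sub>R C)"
proof -
  have quad: "u \<bullet> ((c\<^sup>2 *\<^sub>R C) *v u) = (c *\<^sub>R u) \<bullet> (C *v (c *\<^sub>R u))" for u
    by (simp add: scaleR_matrix_vector_assoc[symmetric] matrix_vector_mult_scaleR power2_eq_square)
  have "transpose (c\<^sup>2 *\<^sub>R C) = c\<^sup>2 *\<^sub>R transpose C" by (simp add: transpose_def vec_eq_iff)
  moreover have "u \<bullet> (c *\<^sub>R z \<omega>) = (c *\<^sub>R u) \<bullet> z \<omega>" for u \<omega> by simp
  ultimately show ?thesis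
    using assms unfolding gaussian_vector_def quad inner_zero_right
    by (auto simp del: inner_scaleR_left inner_scaleR_right)
qed

text \<open>Chebyshev's inequality. Variance zero is a separate case, since there the Gaussian law
  is encoded as an almost sure equality and has no density.\<close>

lemma gaussian_vector_tail:
  assumes "prob_space S" and g: "gaussian_vector S z 0 D" and d: "d > 0"
  shows "measure S {\<omega> \<in> space S. \<bar>u \<bullet> z \<omega>\<bar> \<ge> d} \<le> (u \<bullet> (D *v u)) / d\<^sup>2"
proof -
  interpret prob_space S by fact
  have [measurable]: "z \<in> borel_measurable S" using g by (simp add: gaussian_vector_def)
  show ?thesis
  proof (cases "u \<bullet> (D *v u) = 0")
    case True
    then have "AE \<omega> in S. u \<bullet> z \<omega> = 0" using g by (auto simp: gaussian_vector_def split: if_splits)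
    then have "AE \<omega> in S. \<omega> \<notin> {\<omega> \<in> space S. \<bar>u \<bullet> z \<omega>\<bar> \<ge> d}" by eventually_elim (use d in auto)
    then have "measure S {\<omega> \<in> space S. \<bar>u \<bullet> z \<omega>\<bar> \<ge> d} = 0"
      by (subst (asm) prob_eq_0[symmetric]) auto
    then show ?thesis using True by simp
  next
    case False
    define \<sigma> where "\<sigma> = sqrt (u \<bullet> (D *v u))"
    have "u \<bullet> (D *v u) \<ge> 0" using g by (simp add: gaussian_vector_def)
    then have \<sigma>: "\<sigma> > 0" "\<sigma>\<^sup>2 = u \<bullet> (D *v u)" using False by (auto simp: \<sigma>_def)
    have dist: "distributed S lborel (\<lambda>\<omega>. u \<bullet> z \<omega>) (normal_density 0 \<sigma>)"
      using g False unfolding gaussian_vector_def \<sigma>_def by (metis inner_zero_right)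
    have "integrable lborel (\<lambda>x. normal_density 0 \<sigma> x * x ^ 2)"
      using integrable_normal_moment[OF \<sigma>(1), of 0 2] by simp
    then have int: "integrable S (\<lambda>\<omega>. (u \<bullet> z \<omega>) ^ 2)"
      by (subst distributed_integrable[OF dist, of "\<lambda>x. x ^ 2", symmetric]) auto
    have "prob {\<omega> \<in> space S. \<bar>u \<bullet> z \<omega> - expectation (\<lambda>\<omega>. u \<bullet> z \<omega>)\<bar> \<ge> d} \<le> variance (\<lambda>\<omega>. u \<bullet> z \<omega>) / d\<^sup>2"
      by (rule Chebyshev_inequality) (use int d in auto)
    then show ?thesis
      unfolding normal_distributed_variance[OF \<sigma>(1) dist] \<sigma>(2)
      unfolding normal_distributed_expectation[OF \<sigma>(1) dist] by simp
  qed
qed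

text \<open>A law with a density has no atoms.\<close>

lemma (in prob_space) AE_distributed_lborel_neq:
  assumes "distributed M lborel X f"
  shows "AE \<omega> in M. X \<omega> \<noteq> (c::real)"
proof -
  have X: "X \<in> measurable M lborel" by (rule distributed_measurable[OF assms])
  have "AE x in lborel. x \<noteq> c" by (rule AE_lborel_singleton)
  then have "AE x in density lborel f. x \<noteq> c"
    by (subst AE_density) (use distributed_borel_measurable[OF assms] in \<open>auto elim: eventually_mono\<close>)
  then have "AE x in distr M lborel X. x \<noteq> c"
    by (simp only: distributed_distr_eq_density[OF assms])
  then show ?thesis by (subst (asm) AE_distr_iff) (use X in auto)
qed

text \<open>The vectors \<open>e1 a\<close> and \<open>e2 a\<close> arise from \<open>\<alpha>\<close> and \<open>\<beta>\<close> by Gram--Schmidt with respect to \<open>D a\<close>;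
  the components of the difference are Gaussian with vanishing variance.\<close>
lemma gaussian_rank_two_limit:
  fixes D :: "'a \<Rightarrow> real^'n^'n" and z :: "'a \<Rightarrow> 'w \<Rightarrow> real^'n"
  assumes prob: "\<forall>\<^sub>F a in F. prob_space (S a)"
    and gauss: "\<forall>\<^sub>F a in F. gaussian_vector (S a) (z a) 0 (D a)"
    and D: "(D \<longlongrightarrow> s *\<^sub>R (outer_prod p p + outer_prod q q)) F" and s: "s > 0"
    and dual: "\<alpha> \<bullet> p = 1" "\<alpha> \<bullet> q = 0" "\<beta> \<bullet> p = 0" "\<beta> \<bullet> q = 1"
    and m: "(m \<longlongrightarrow> 0) F"
  obtains e1 e2 where
    "\<forall>\<^sub>F a in F. \<forall>x y. x\<^sup>2 + y\<^sup>2 = 1 \<longrightarrow>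
       distributed (S a) lborel (\<lambda>\<omega>. x * (e1 a \<bullet> z a \<omega>) + y * (e2 a \<bullet> z a \<omega>)) std_normal_density"
    "\<And>d. d > 0 \<Longrightarrow> ((\<lambda>a. measure (S a) {\<omega> \<in> space (S a). d \<le> dist (m a + z a \<omega>)
       (sqrt s *\<^sub>R ((e1 a \<bullet> z a \<omega>) *\<^sub>R p + (e2 a \<bullet> z a \<omega>) *\<^sub>R q))}) \<longlongrightarrow> 0) F"
proof -
  define \<Gamma> where "\<Gamma> = s *\<^sub>R (outer_prod p p + outer_prod q q)"
  have \<Gamma>: "x \<bullet> (\<Gamma> *v y) = s * ((x \<bullet> p) * (p \<bullet> y) + (x \<bullet> q) * (q \<bullet> y))" for x y
  proof -
    have "scalar_product v w = v \<bullet> w" for v w :: "real^'n"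
      by (simp add: scalar_product_def inner_vec_def)
    then show ?thesis
      unfolding \<Gamma>_def scaleR_matrix_vector_assoc[symmetric] matrix_vector_mult_add_rdistrib outer_prod_mult_vec
      by (simp add: inner_add_right scalar_mult_eq_scaleR algebra_simps)
  qed
  have D: "(D \<longlongrightarrow> \<Gamma>) F" using D by (simp add: \<Gamma>_def)
  define k1 where "k1 a = \<alpha> \<bullet> (D a *v \<alpha>)" for a
  \<comment> \<open>The coefficient that makes \<open>\<beta>' a\<close> orthogonal to \<alpha> for
    the form \<open>D a\<close>. It tends to 0 because \<alpha> and \<beta>, being dual to
    \<open>p\<close> and \<open>q\<close>, are orthogonal for the limiting form.\<close>
  define c where "c a = (\<alpha> \<bullet> (D a *v \<beta>)) / k1 a" for a
  define \<beta>' where "\<beta>' a = \<beta> - c a *\<^sub>R \<alpha>" for a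
  define k2 where "k2 a = \<beta>' a \<bullet> (D a *v \<beta>' a)" for a
  define e1 where "e1 a = \<alpha> /\<^sub>R sqrt (k1 a)" for a
  define e2 where "e2 a = \<beta>' a /\<^sub>R sqrt (k2 a)" for a
  note dual' = dual dual[unfolded inner_commute[of \<alpha>] inner_commute[of \<beta>]]
  have k1: "(k1 \<longlongrightarrow> s) F"
    using tendsto_inner[OF tendsto_const tendsto_matrix_vector_mult[OF D tendsto_const], of \<alpha> \<alpha>]
    unfolding k1_def by (simp add: \<Gamma> dual')
  have c: "(c \<longlongrightarrow> 0) F"
    using tendsto_divide[OF tendsto_inner[OF tendsto_const tendsto_matrix_vector_mult[OF D tendsto_const], of \<alpha> \<beta>] k1] s
    unfolding c_def by (simp add: \<Gamma> dual')
  have \<beta>': "(\<beta>' \<longlongrightarrow> \<beta>) F"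
    using tendsto_diff[OF tendsto_const tendsto_scaleR[OF c tendsto_const], of \<beta> \<alpha>]
    unfolding \<beta>'_def by simp
  have k2: "(k2 \<longlongrightarrow> s) F"
    using tendsto_inner[OF \<beta>' tendsto_matrix_vector_mult[OF D \<beta>']]
    unfolding k2_def by (simp add: \<Gamma> dual')
  have e1: "(e1 \<longlongrightarrow> \<alpha> /\<^sub>R sqrt s) F" and e2: "(e2 \<longlongrightarrow> \<beta> /\<^sub>R sqrt s) F"
    unfolding e1_def e2_def using s by (intro tendsto_intros k1 k2 \<beta>'; simp)+
  have pos: "\<forall>\<^sub>F a in F. k1 a > 0 \<and> k2 a > 0"
    using order_tendstoD(1)[OF k1 s] order_tendstoD(1)[OF k2 s] by eventually_elim simp
  have std: "\<forall>\<^sub>F a in F. \<forall>x y. x\<^sup>2 + y\<^sup>2 = 1 \<longrightarrow>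
       distributed (S a) lborel (\<lambda>\<omega>. x * (e1 a \<bullet> z a \<omega>) + y * (e2 a \<bullet> z a \<omega>)) std_normal_density"
    using pos gauss
  proof eventually_elim
    case (elim a)
    have sym: "v \<bullet> (D a *v w) = w \<bullet> (D a *v v)" for v w
      using elim unfolding gaussian_vector_def
      by (metis dot_lmul_matrix inner_commute transpose_matrix_vector)
    have 1: "e1 a \<bullet> (D a *v e1 a) = 1"
      using elim by (simp add: e1_def matrix_vector_mult_scaleR k1_def[symmetric] field_simps)
    have 2: "e2 a \<bullet> (D a *v e2 a) = 1"
      using elim by (simp add: e2_def matrix_vector_mult_scaleR k2_def[symmetric] field_simps)
    have "\<alpha> \<bullet> (D a *v \<beta>' a) = 0"
      using elim unfolding \<beta>'_def
      by (simp add: matrix_vector_mult_diff_distrib matrix_vector_mult_scaleR inner_diff_right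
          c_def k1_def[symmetric])
    then have 3: "e1 a \<bullet> (D a *v e2 a) = 0" by (simp add: e1_def e2_def matrix_vector_mult_scaleR)
    then have 4: "e2 a \<bullet> (D a *v e1 a) = 0" using sym by simp
    show ?case
    proof (intro allI impI)
      fix x y :: real assume xy: "x\<^sup>2 + y\<^sup>2 = 1"
      define u where "u = x *\<^sub>R e1 a + y *\<^sub>R e2 a"
      have u: "u \<bullet> (D a *v u) = 1"
        unfolding u_def using xy
        by (simp add: matrix_vector_right_distrib matrix_vector_mult_scaleR inner_add_left inner_add_right
            1 2 3 4 power2_eq_square)
      have "distributed (S a) lborel (\<lambda>\<omega>. u \<bullet> z a \<omega>) std_normal_density"
      proof -
        have "if u \<bullet> (D a *v u) = 0 then AE \<omega> in S a. u \<bullet> z a \<omega> = u \<bullet> 0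
          else distributed (S a) lborel (\<lambda>\<omega>. u \<bullet> z a \<omega>)
                 (normal_density (u \<bullet> 0) (sqrt (u \<bullet> (D a *v u))))"
          using elim(2) unfolding gaussian_vector_def by blast
        then show ?thesis by (simp add: u)
      qed
      then show "distributed (S a) lborel (\<lambda>\<omega>. x * (e1 a \<bullet> z a \<omega>) + y * (e2 a \<bullet> z a \<omega>)) std_normal_density"
        by (simp add: u_def inner_add_left)
    qed
  qed
  have close: "((\<lambda>a. measure (S a) {\<omega> \<in> space (S a). d \<le> dist (m a + z a \<omega>)
       (sqrt s *\<^sub>R ((e1 a \<bullet> z a \<omega>) *\<^sub>R p + (e2 a \<bullet> z a \<omega>) *\<^sub>R q))}) \<longlongrightarrow> 0) F" if d: "d > 0" for d
  proof -
    \<comment> \<open>The functional that maps \<open>z a \<omega>\<close> to the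
      \<open>j\<close>-th entry of its difference from the approximation. In the limit it
      annihilates both \<open>p\<close> and \<open>q\<close>, the only directions in which the
      limiting covariance is nonzero, so its variance tends to 0.\<close>
    define u where "u j a = axis j 1 - (sqrt s * p $ j) *\<^sub>R e1 a - (sqrt s * q $ j) *\<^sub>R e2 a" for j a
    \<comment> \<open>Half of \<open>d\<close> is reserved for the deterministic part
      \<open>m a\<close>; the other half is divided among the coordinates.\<close>
    define d' where "d' = d / (2 * CARD('n))"
    have d': "d' > 0" using d by (simp add: d'_def)
    have var: "((\<lambda>a. u j a \<bullet> (D a *v u j a)) \<longlongrightarrow> 0) F" for j
    proof -
      have u: "(u j \<longlongrightarrow> axis j 1 - (sqrt s * p $ j) *\<^sub>R (\<alpha> /\<^sub>R sqrt s) - (sqrt s * q $ j) *\<^sub>R (\<beta> /\<^sub>R sqrt s)) F"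
        unfolding u_def by (intro tendsto_intros e1 e2)
      have uc: "axis j 1 - (sqrt s * p $ j) *\<^sub>R (\<alpha> /\<^sub>R sqrt s) - (sqrt s * q $ j) *\<^sub>R (\<beta> /\<^sub>R sqrt s)
          = axis j 1 - (p $ j) *\<^sub>R \<alpha> - (q $ j) *\<^sub>R \<beta>" (is "_ = ?u")
      proof -
        have cancel: "sqrt s * x * inverse (sqrt s) = x" for x using s by (simp add: field_simps)
        show ?thesis by (simp only: scaleR_scaleR cancel)
      qed
      have "?u \<bullet> p = 0" "?u \<bullet> q = 0"
        by (simp_all add: inner_diff_left dual inner_axis')
      then have "?u \<bullet> (\<Gamma> *v ?u) = 0" by (simp only: \<Gamma> mult_zero_left mult_zero_right add_0_left)
      then show ?thesis using tendsto_inner[OF u tendsto_matrix_vector_mult[OF D u]] unfolding uc by simp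
    qed
    have "\<forall>\<^sub>F a in F. norm (m a) < d / 2"
      using order_tendstoD(2)[OF tendsto_norm[OF m], of "d / 2"] d by simp
    with prob gauss have bound: "\<forall>\<^sub>F a in F. measure (S a) {\<omega> \<in> space (S a). d \<le> dist (m a + z a \<omega>)
       (sqrt s *\<^sub>R ((e1 a \<bullet> z a \<omega>) *\<^sub>R p + (e2 a \<bullet> z a \<omega>) *\<^sub>R q))} \<le> (\<Sum>j\<in>UNIV. u j a \<bullet> (D a *v u j a) / d'\<^sup>2)"
    proof eventually_elim
      case (elim a)
      interpret prob_space "S a" by (rule elim)
      have [measurable]: "z a \<in> borel_measurable (S a)" using elim by (simp add: gaussian_vector_def)
      let ?y = "\<lambda>\<omega>. sqrt s *\<^sub>R ((e1 a \<bullet> z a \<omega>) *\<^sub>R p + (e2 a \<bullet> z a \<omega>) *\<^sub>R q)"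
      let ?A = "\<lambda>j. {\<omega> \<in> space (S a). \<bar>u j a \<bullet> z a \<omega>\<bar> \<ge> d'}"
      have sub: "{\<omega> \<in> space (S a). d \<le> dist (m a + z a \<omega>) (?y \<omega>)} \<subseteq> (\<Union>j\<in>UNIV. ?A j)"
      proof
        fix \<omega> assume \<omega>: "\<omega> \<in> {\<omega> \<in> space (S a). d \<le> dist (m a + z a \<omega>) (?y \<omega>)}"
        have "d \<le> norm (m a + (z a \<omega> - ?y \<omega>))" using \<omega> by (simp add: dist_norm add_diff_eq)
        also have "\<dots> \<le> norm (m a) + norm (z a \<omega> - ?y \<omega>)" by (rule norm_triangle_ineq)
        also have "norm (z a \<omega> - ?y \<omega>) \<le> (\<Sum>j\<in>UNIV. \<bar>(z a \<omega> - ?y \<omega>) $ j\<bar>)" by (rule norm_le_l1_cart)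
        finally have big: "d / 2 < (\<Sum>j\<in>UNIV. \<bar>(z a \<omega> - ?y \<omega>) $ j\<bar>)" using elim(3) by simp
        have "\<exists>j. \<bar>(z a \<omega> - ?y \<omega>) $ j\<bar> \<ge> d'"
        proof (rule ccontr)
          assume "\<nexists>j. \<bar>(z a \<omega> - ?y \<omega>) $ j\<bar> \<ge> d'"
          then have "(\<Sum>j\<in>UNIV. \<bar>(z a \<omega> - ?y \<omega>) $ j\<bar>) \<le> (\<Sum>j\<in>(UNIV::'n set). d')"
            by (intro sum_mono) (meson less_imp_le not_le)
          also have "\<dots> = d / 2" by (simp add: d'_def)
          finally show False using big by simp
        qed
        then obtain j where "\<bar>(z a \<omega> - ?y \<omega>) $ j\<bar> \<ge> d'" by blast
        moreover have "(z a \<omega> - ?y \<omega>) $ j = u j a \<bullet> z a \<omega>"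
          by (simp add: u_def inner_diff_left inner_axis' algebra_simps)
        ultimately show "\<omega> \<in> (\<Union>j\<in>UNIV. ?A j)" using \<omega> by auto
      qed
      have "prob {\<omega> \<in> space (S a). d \<le> dist (m a + z a \<omega>) (?y \<omega>)} \<le> prob (\<Union>j\<in>UNIV. ?A j)"
        by (rule finite_measure_mono[OF sub]) measurable
      also have "\<dots> \<le> (\<Sum>j\<in>UNIV. prob (?A j))"
        by (rule finite_measure_subadditive_finite) auto
      also have "\<dots> \<le> (\<Sum>j\<in>UNIV. u j a \<bullet> (D a *v u j a) / d'\<^sup>2)"
        by (intro sum_mono gaussian_vector_tail elim d')
      finally show ?case .
    qed
    have "((\<lambda>a. \<Sum>j\<in>UNIV. u j a \<bullet> (D a *v u j a) / d'\<^sup>2) \<longlongrightarrow> (\<Sum>j\<in>(UNIV::'n set). 0 / d'\<^sup>2)) F"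
      by (intro tendsto_sum tendsto_divide var tendsto_const) (use d' in simp)
    then have lim: "((\<lambda>a. \<Sum>j\<in>UNIV. u j a \<bullet> (D a *v u j a) / d'\<^sup>2) \<longlongrightarrow> 0) F" by simp
    show ?thesis by (rule tendsto_sandwich[OF _ bound tendsto_const lim]) simp
  qed
  show thesis using that[OF std close] .
qed

section \<open>The statistics and the critical eigenvector\<close>

lemma coord_mean_scaleR: "coord_mean (c *\<^sub>R u) = c * coord_mean u"
  by (simp add: coord_mean_def sum_distrib_left)

lemma central_moment_scaleR: "central_moment k (c *\<^sub>R u) = c ^ k * central_moment k u"
  by (simp add: central_moment_def coord_mean_scaleR sum_distrib_left flip: right_diff_distrib power_mult_distrib)

lemma sum_square_deviations: "(\<Sum>i\<in>UNIV. (u $ i - coord_mean u)\<^sup>2) = (centering *v u) \<bullet> (centering *v u)"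
  by (simp add: inner_vec_def centering_mult_nth power2_eq_square)

lemma central_moment_2_pos:
  assumes "centering *v u \<noteq> 0"
  shows "central_moment 2 u > 0"
  using assms by (simp add: central_moment_def sum_square_deviations)

lemma moran_I_centering:
  "moran_I A u = real CARD('n) / total_weight A *
     (((centering *v u) \<bullet> (A *v (centering *v u))) / ((centering *v u) \<bullet> (centering *v u)))"
  for u :: "real^'n"
proof -
  have "(\<Sum>i\<in>UNIV. \<Sum>j\<in>UNIV. A $ i $ j * (u $ i - coord_mean u) * (u $ j - coord_mean u))
      = (centering *v u) \<bullet> (A *v (centering *v u))"
    by (simp add: inner_vec_def matrix_vector_mult_def[of A] centering_mult_nth sum_distrib_left ac_simps)
  then show ?thesis by (simp add: moran_I_def sum_square_deviations)
qed

lemma skewness_scaleR: "c > 0 \<Longrightarrow> skewness (c *\<^sub>R u) = skewness u"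
proof -
  assume c: "c > 0"
  have "(c\<^sup>2 * central_moment 2 u) powr (3 / 2) = (c\<^sup>2) powr (3 / 2) * central_moment 2 u powr (3 / 2)"
    by (rule powr_mult)
  also have "(c\<^sup>2) powr (3 / 2) = c ^ 3"
  proof -
    have "(c\<^sup>2) powr (3 / 2) = (c powr 2) powr (3 / 2)" using c by simp
    also have "\<dots> = c powr 3" unfolding powr_powr by simp
    finally show ?thesis using c by simp
  qed
  finally show ?thesis using c by (simp add: skewness_def central_moment_scaleR)
qed

lemma kurtosis_scaleR: "c > 0 \<Longrightarrow> kurtosis (c *\<^sub>R u) = kurtosis u"
  by (simp add: kurtosis_def central_moment_scaleR power_mult_distrib flip: power_mult)

lemma moran_I_scaleR: "c > 0 \<Longrightarrow> moran_I A (c *\<^sub>R u) = moran_I A u"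
  by (simp add: moran_I_centering matrix_vector_mult_scaleR)

lemma continuous_on_central_moment [continuous_intros]: "continuous_on G (central_moment k)"
  unfolding central_moment_def coord_mean_def by (intro continuous_intros) auto

lemma continuous_on_matrix_vector_mult_const [continuous_intros]:
  "continuous_on G (\<lambda>u. (A :: real^'n^'m) *v u)"
  by (rule linear_continuous_on[OF matrix_vector_mul_bounded_linear])

lemma open_centering_nonzero: "open {u :: real^'n. centering *v u \<noteq> 0}"
  by (intro open_Collect_neq continuous_intros)

lemma continuous_on_statistics:
  fixes A :: "real^'n^'n"
  defines "G \<equiv> {u :: real^'n. centering *v u \<noteq> 0}"
  shows "continuous_on G skewness" and "continuous_on G kurtosis" "continuous_on G (moran_I A)"
proof -
  have pos: "central_moment 2 u > 0" if "u \<in> G" for u using that central_moment_2_pos by (auto simp: G_def)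
  show "continuous_on G skewness"
    unfolding skewness_def[abs_def] by (intro continuous_intros) (use pos in \<open>force+\<close>)
  show "continuous_on G kurtosis"
    unfolding kurtosis_def[abs_def] by (intro continuous_intros) (use pos in \<open>force+\<close>)
  show "continuous_on G (moran_I A)"
    unfolding moran_I_centering[abs_def]
    unfolding matrix_vector_mul_assoc by (intro continuous_intros) (auto simp: G_def)
qed

lemma borel_measurable_statistics [measurable]:
  "central_moment k \<in> borel_measurable borel"
  "skewness \<in> borel_measurable borel" "kurtosis \<in> borel_measurable borel" "moran_I A \<in> borel_measurable borel"
proof -
  show [measurable]: "central_moment k \<in> borel_measurable borel" for k
    by (intro borel_measurable_continuous_onI continuous_intros)
  show "skewness \<in> borel_measurable borel" unfolding skewness_def[abs_def] by measurable
  show "kurtosis \<in> borel_measurable borel" unfolding kurtosis_def[abs_def] by measurable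
  have "(\<lambda>u. (centering *v u) \<bullet> (A *v (centering *v u))) \<in> borel_measurable borel"
    unfolding matrix_vector_mul_assoc by (intro borel_measurable_continuous_onI continuous_intros)
  moreover have "(\<lambda>u::real^'n. (centering *v u) \<bullet> (centering *v u)) \<in> borel_measurable borel"
    by (intro borel_measurable_continuous_onI continuous_intros)
  ultimately show "moran_I A \<in> borel_measurable borel"
    unfolding moran_I_centering[abs_def] by (intro borel_measurable_times borel_measurable_divide) auto
qed

text \<open>If all entries of \<open>v\<close> were equal, every row sum of \<open>M\<close> would be the non-real eigenvalue.\<close>
lemma centering_eigenvector_nonzero:
  fixes M :: "real^'n^'n" and v :: "complex^'n"
  assumes ev: "complex_matrix M *v v = (\<i> * of_real \<omega>) *s v" and "\<omega> \<noteq> 0" "v \<noteq> 0"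
  shows "\<exists>j. (centering *v Re_vec v) $ j \<noteq> 0 \<or> (centering *v Im_vec v) $ j \<noteq> 0"
proof (rule ccontr)
  assume "\<not> ?thesis"
  then have const: "Re_vec v $ j = coord_mean (Re_vec v)" "Im_vec v $ j = coord_mean (Im_vec v)" for j
    by (auto simp: centering_mult_nth)
  define c where "c = Complex (coord_mean (Re_vec v)) (coord_mean (Im_vec v))"
  have v: "v $ j = c" for j
  proof -
    have "v $ j = Complex (Re_vec v $ j) (Im_vec v $ j)" by (simp add: Re_vec_def Im_vec_def)
    then show ?thesis by (simp only: const c_def)
  qed
  have c: "c \<noteq> 0" using \<open>v \<noteq> 0\<close> v by (metis vec_eq_iff zero_index)
  fix i :: 'n
  have "(\<Sum>j\<in>UNIV. complex_of_real (M $ i $ j) * v $ j) = \<i> * of_real \<omega> * v $ i"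
    using arg_cong[OF ev, of "\<lambda>x. x $ i"] by (simp add: matrix_vector_mult_def map_matrix_def)
  then have "of_real (\<Sum>j\<in>UNIV. M $ i $ j) * c = \<i> * of_real \<omega> * c"
    unfolding v by (simp add: sum_distrib_right)
  then have "of_real (\<Sum>j\<in>UNIV. M $ i $ j) = \<i> * of_real \<omega>" using c by (metis mult_right_cancel)
  then have "Im (of_real (\<Sum>j\<in>UNIV. M $ i $ j)) = \<omega>" by (simp only:) simp
  then show False using \<open>\<omega> \<noteq> 0\<close> by simp
qed

text \<open>The real and imaginary parts of the two relations are four real equations; adding and
  subtracting them isolates the four inner products and produces the factor 2. The vectors obtained
  are dual to the real and imaginary parts of \<open>v\<close>, which are therefore linearly
  independent.\<close>

lemma biorthogonal_dual_vectors:
  fixes v w :: "complex^'n"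
  assumes "scalar_product w v = 1" "scalar_product w (cnj_vec v) = 0"
  shows "(2 *\<^sub>R Re_vec w) \<bullet> Re_vec v = 1" "(2 *\<^sub>R Re_vec w) \<bullet> Im_vec v = 0"
    "(- 2 *\<^sub>R Im_vec w) \<bullet> Re_vec v = 0" "(- 2 *\<^sub>R Im_vec w) \<bullet> Im_vec v = 1"
proof -
  have 1: "scalar_product w v = Complex (Re_vec w \<bullet> Re_vec v - Im_vec w \<bullet> Im_vec v)
      (Re_vec w \<bullet> Im_vec v + Im_vec w \<bullet> Re_vec v)"
    by (simp add: scalar_product_def complex_eq_iff inner_vec_def Re_vec_def Im_vec_def sum_subtractf sum.distrib)
  have 2: "scalar_product w (cnj_vec v) = Complex (Re_vec w \<bullet> Re_vec v + Im_vec w \<bullet> Im_vec v)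
      (Im_vec w \<bullet> Re_vec v - Re_vec w \<bullet> Im_vec v)"
    by (simp add: scalar_product_def cnj_vec_def complex_eq_iff inner_vec_def Re_vec_def Im_vec_def sum_subtractf sum.distrib sum_negf)
  show "(2 *\<^sub>R Re_vec w) \<bullet> Re_vec v = 1" "(2 *\<^sub>R Re_vec w) \<bullet> Im_vec v = 0"
    "(- 2 *\<^sub>R Im_vec w) \<bullet> Re_vec v = 0" "(- 2 *\<^sub>R Im_vec w) \<bullet> Im_vec v = 1"
    using assms[unfolded 1 2] by (simp_all add: complex_eq_iff)
qed

text \<open>The joint derivative is itself differentiable at the endpoint of the branch, hence
  continuous there. The spatial Jacobian is its restriction to directions
  \<open>(h, 0)\<close>.\<close>

lemma stability_matrix_tendsto:
  fixes F :: "real^'n \<Rightarrow> real \<Rightarrow> real^'n"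
  assumes lim: "(xs \<longlongrightarrow> xc) (at_left ac)" and U: "\<forall>\<^sub>F a in at_left ac. (xs a, a) \<in> U" "(xc, ac) \<in> U"
    and smooth: "C2_on U (\<lambda>(y, a). F y a)"
  obtains Mc where "(stability_matrix F xs \<longlongrightarrow> Mc) (at_left ac)"
proof -
  obtain f' :: "(real^'n) \<times> real \<Rightarrow> ((real^'n) \<times> real) \<Rightarrow>\<^sub>L (real^'n)" and f''
    where f': "\<forall>x\<in>U. ((\<lambda>(y, a). F y a) has_derivative blinfun_apply (f' x)) (at x)"
      and f'': "\<forall>x\<in>U. (f' has_derivative blinfun_apply (f'' x)) (at x)"
    using smooth unfolding C2_on_def by blast
  have cont: "isCont f' (xc, ac)"
    using f'' U(2) has_derivative_continuous by blast
  have "((\<lambda>a. (xs a, a)) \<longlongrightarrow> (xc, ac)) (at_left ac)"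
    by (intro tendsto_Pair lim) (rule tendsto_ident_at)
  then have f'lim: "((\<lambda>a. f' (xs a, a)) \<longlongrightarrow> f' (xc, ac)) (at_left ac)"
    using cont isCont_tendsto_compose by blast
  define J where "J L = - matrix (\<lambda>h. blinfun_apply L (h, 0))" for L :: "((real^'n) \<times> real) \<Rightarrow>\<^sub>L (real^'n)"
  have Jlim: "((\<lambda>a. J (f' (xs a, a))) \<longlongrightarrow> J (f' (xc, ac))) (at_left ac)"
    unfolding J_def matrix_def
    by (intro tendsto_minus vec_tendstoI) (auto intro!: tendsto_vec_nth blinfun.tendsto f'lim)
  have "\<forall>\<^sub>F a in at_left ac. stability_matrix F xs a = J (f' (xs a, a))"
    using U(1)
  proof eventually_elim
    case (elim a)
    have "((\<lambda>y. (y, a)) has_derivative (\<lambda>h. (h, 0))) (at (xs a))"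
      by (intro derivative_eq_intros) auto
    from has_derivative_compose[OF this f'[rule_format, OF elim]]
    have "((\<lambda>y. F y a) has_derivative (\<lambda>h. blinfun_apply (f' (xs a, a)) (h, 0))) (at (xs a))" by simp
    then show ?case
      unfolding stability_matrix_def jacobian_def J_def by (metis frechet_derivative_at)
  qed
  then have "(stability_matrix F xs \<longlongrightarrow> J (f' (xc, ac))) (at_left ac)"
    using Jlim tendsto_cong by force
  then show thesis by (rule that)
qed

section \<open>The limit theorem\<close>

text \<open>That no statistic diverges is expressed as tightness of its laws. The denominators are
  shown to be nonzero for \<open>x\<close> as well as for \<open>u\<close>, since division is total
  and a quotient by zero would silently be zero.\<close>

theorem theoremE5:
  fixes F :: "real^'n \<Rightarrow> real \<Rightarrow> real^'n"
    and B :: "real^'m^'n"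
    and a0 ac :: real
    and xs :: "real \<Rightarrow> real^'n" and xc :: "real^'n"
    and U :: "((real^'n) \<times> real) set"
    and C :: "real \<Rightarrow> real^'n^'n"
    and \<eta> \<Omega> :: "real \<Rightarrow> real"
    and vH wH :: "real \<Rightarrow> complex^'n" and vHc wHc :: "complex^'n"
    and \<sigma>2 :: real
    and A :: "real^'n^'n"
    and S :: "real \<Rightarrow> 'w measure" and z :: "real \<Rightarrow> 'w \<Rightarrow> real^'n"
    and T :: "'t measure" and \<Theta> :: "'t \<Rightarrow> real"
  defines "x \<equiv> \<lambda>a \<omega>. xs a + z a \<omega>"
    and "u \<equiv> \<lambda>\<omega>. cos (\<Theta> \<omega>) *\<^sub>R Re_vec vHc + sin (\<Theta> \<omega>) *\<^sub>R Im_vec vHc"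
  assumes dim: "CARD('n) \<ge> 2"
    and interval: "a0 < ac"
    \<comment> \<open>the equilibrium branch\<close>
    and branch_cont: "continuous_on {a0<..<ac} xs"
    and equilibria: "\<And>a. a \<in> {a0<..<ac} \<Longrightarrow> F (xs a) a = 0"
    and stable: "\<And>a. a \<in> {a0<..<ac} \<Longrightarrow> asymptotically_stable (\<lambda>y. F y a) (xs a)"
    and branch_limit: "(xs \<longlongrightarrow> xc) (at_left ac)"
    and nbhd: "open U" "(\<lambda>a. (xs a, a)) ` {a0<..<ac} \<subseteq> U" "(xc, ac) \<in> U"
    and smooth: "C2_on U (\<lambda>(y, a). F y a)"
    \<comment> \<open>spectral assumption and Lyapunov equation\<close>
    and hopf: "simple_hopf_pair (stability_matrix F xs) ac \<eta> \<Omega> vH wH vHc wHc"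
    and lyapunov: "\<And>a. a \<in> {a0<..<ac} \<Longrightarrow>
      stability_matrix F xs a ** C a + C a ** transpose (stability_matrix F xs a)
        = B ** transpose B"
    and noise: "((\<lambda>a. (norm (transpose (complex_matrix B) *v wH a))\<^sup>2) \<longlongrightarrow> \<sigma>2) (at_left ac)"
      "\<sigma>2 > 0"
    \<comment> \<open>network and random variables\<close>
    and weight: "total_weight A > 0"
    and prob_S: "\<And>a. a \<in> {a0<..<ac} \<Longrightarrow> prob_space (S a)"
    and gauss: "\<And>a. a \<in> {a0<..<ac} \<Longrightarrow> gaussian_vector (S a) (z a) 0 (C a)"
    and prob_T: "prob_space T"
    and unif: "\<Theta> \<in> borel_measurable T" "distr T lborel \<Theta> = uniform_measure lborel {0..<2 * pi}"
  shows "(weak_conv_along (at_left ac) (\<lambda>a. distr (S a) borel (\<lambda>\<omega>. skewness (x a \<omega>)))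
        (distr T borel (\<lambda>\<omega>. central_moment 3 (u \<omega>) / central_moment 2 (u \<omega>) powr (3/2)))) \<and>
    (weak_conv_along (at_left ac) (\<lambda>a. distr (S a) borel (\<lambda>\<omega>. kurtosis (x a \<omega>)))
        (distr T borel (\<lambda>\<omega>. central_moment 4 (u \<omega>) / (central_moment 2 (u \<omega>))\<^sup>2))) \<and>
    (weak_conv_along (at_left ac) (\<lambda>a. distr (S a) borel (\<lambda>\<omega>. moran_I A (x a \<omega>)))
        (distr T borel (\<lambda>\<omega>. real CARD('n) / total_weight A *
           (((centering *v u \<omega>) \<bullet> (A *v (centering *v u \<omega>))) /
            ((centering *v u \<omega>) \<bullet> (centering *v u \<omega>)))))) \<and>
    (AE \<omega> in T. central_moment 2 (u \<omega>) powr (3/2) \<noteq> 0 \<and> (central_moment 2 (u \<omega>))\<^sup>2 \<noteq> 0 \<and>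
        (centering *v u \<omega>) \<bullet> (centering *v u \<omega>) \<noteq> 0) \<and>
    (\<forall>\<^sub>F a in at_left ac. AE \<omega> in S a.
        central_moment 2 (x a \<omega>) powr (3/2) \<noteq> 0 \<and> (central_moment 2 (x a \<omega>))\<^sup>2 \<noteq> 0 \<and>
        (\<Sum>i\<in>UNIV. (x a \<omega> $ i - coord_mean (x a \<omega>))\<^sup>2) \<noteq> 0) \<and>
    (tight_along (at_left ac) (\<lambda>a. distr (S a) borel (\<lambda>\<omega>. skewness (x a \<omega>)))) \<and>
    (tight_along (at_left ac) (\<lambda>a. distr (S a) borel (\<lambda>\<omega>. kurtosis (x a \<omega>)))) \<and>
    (tight_along (at_left ac) (\<lambda>a. distr (S a) borel (\<lambda>\<omega>. moran_I A (x a \<omega>))))"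
proof -
  let ?F = "at_left ac"
  have near: "\<forall>\<^sub>F a in ?F. a \<in> {a0<..<ac}"
    using interval by (auto simp: eventually_at_left_field)
  have prob: "\<forall>\<^sub>F a in ?F. prob_space (S a)"
    using near by eventually_elim (rule prob_S)
  have inU: "\<forall>\<^sub>F a in ?F. (xs a, a) \<in> U"
    using near by eventually_elim (use nbhd(2) in blast)
  obtain Mc where Mc: "(stability_matrix F xs \<longlongrightarrow> Mc) ?F"
    by (rule stability_matrix_tendsto[OF branch_limit inU nbhd(3) smooth])
  have lyap: "\<forall>\<^sub>F a in ?F. stability_matrix F xs a ** C a + C a ** transpose (stability_matrix F xs a)
      = B ** transpose B"
    using near by eventually_elim (rule lyapunov)
  have sym: "\<forall>\<^sub>F a in ?F. transpose (C a) = C a"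
    using near by eventually_elim (use gauss in \<open>auto simp: gaussian_vector_def\<close>)
  define p where "p = Re_vec vHc"
  define q where "q = Im_vec vHc"
  note cov = scaled_covariance_tendsto[OF hopf Mc lyap sym noise(1), folded p_def q_def]
  have \<eta>pos: "\<forall>\<^sub>F a in ?F. \<eta> a > 0" and \<eta>0: "(\<eta> \<longlongrightarrow> 0) ?F"
    using hopf unfolding simple_hopf_pair_def by (auto elim: eventually_mono)
  \<comment> \<open>Multiplication by \<open>sqrt (\<eta> a)\<close> turns the covariance into the
    convergent \<open>\<eta> a *\<^sub>R C a\<close> and makes the mean vanish in the limit, while
    the statistics do not see it.\<close>
  define y where "y a \<omega> = sqrt (\<eta> a) *\<^sub>R z a \<omega>" for a \<omega>
  define m where "m a = sqrt (\<eta> a) *\<^sub>R xs a" for a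
  have gy: "\<forall>\<^sub>F a in ?F. gaussian_vector (S a) (y a) 0 (\<eta> a *\<^sub>R C a)"
    using near \<eta>pos
  proof eventually_elim
    case (elim a)
    then show ?case using gaussian_vector_scaleR[OF gauss, of a "sqrt (\<eta> a)"] by (simp add: y_def[abs_def])
  qed
  have "(m \<longlongrightarrow> sqrt 0 *\<^sub>R xc) ?F"
    unfolding m_def by (intro tendsto_intros \<eta>0 branch_limit)
  then have m: "(m \<longlongrightarrow> 0) ?F" by simp
  note dual = biorthogonal_dual_vectors[OF cov(3,4), folded p_def q_def]
  obtain e1 e2 where
    e: "\<forall>\<^sub>F a in ?F. \<forall>s t. s\<^sup>2 + t\<^sup>2 = 1 \<longrightarrow>
       distributed (S a) lborel (\<lambda>\<omega>. s * (e1 a \<bullet> y a \<omega>) + t * (e2 a \<bullet> y a \<omega>)) std_normal_density"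
    and close: "\<And>d. d > 0 \<Longrightarrow> ((\<lambda>a. measure (S a) {\<omega> \<in> space (S a). d \<le> dist (m a + y a \<omega>)
       (sqrt \<sigma>2 *\<^sub>R ((e1 a \<bullet> y a \<omega>) *\<^sub>R p + (e2 a \<bullet> y a \<omega>) *\<^sub>R q))}) \<longlongrightarrow> 0) ?F"
    using gaussian_rank_two_limit[OF prob gy cov(1) noise(2) dual m] by blast
  define h where "h = (\<lambda>(s, t). sqrt \<sigma>2 *\<^sub>R (s *\<^sub>R p + t *\<^sub>R q))"
  define Z where "Z a \<omega> = h (e1 a \<bullet> y a \<omega>, e2 a \<bullet> y a \<omega>)" for a \<omega>
  define G where "G = {w :: real^'n. centering *v w \<noteq> 0}"
  have h_meas[measurable]: "h \<in> borel_measurable borel"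
    unfolding h_def case_prod_beta by (intro borel_measurable_continuous_onI continuous_intros)
  have [measurable]: "G \<in> sets borel" unfolding G_def by (intro borel_open open_centering_nonzero)
  have h_scale: "h (c * s, c * t) = c *\<^sub>R h (s, t)" for c s t
    by (simp add: h_def scaleR_add_right ac_simps)
  have hu: "h (cos (\<Theta> \<omega>), sin (\<Theta> \<omega>)) = sqrt \<sigma>2 *\<^sub>R u \<omega>" for \<omega>
    by (simp add: h_def u_def p_def q_def)

  \<comment> \<open>The properties that hold eventually are collected so that what follows can be
    said about a single parameter. Some good \<open>a1\<close> then serves as reference for the
    common law of all \<open>Z a\<close>.\<close>
  define good where "good a \<longleftrightarrow> prob_space (S a) \<and> y a \<in> borel_measurable (S a) \<and> \<eta> a > 0 \<and>
    x a \<in> borel_measurable (S a) \<and> (\<forall>s t. s\<^sup>2 + t\<^sup>2 = 1 \<longrightarrow>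
       distributed (S a) lborel (\<lambda>\<omega>. s * (e1 a \<bullet> y a \<omega>) + t * (e2 a \<bullet> y a \<omega>)) std_normal_density)" for a
  have good: "\<forall>\<^sub>F a in ?F. good a"
    using prob gy \<eta>pos e near
  proof eventually_elim
    case (elim a)
    have [measurable]: "z a \<in> borel_measurable (S a)" using gauss[OF elim(5)] by (simp add: gaussian_vector_def)
    have "x a \<in> borel_measurable (S a)" unfolding x_def by measurable
    then show ?case using elim by (simp add: good_def gaussian_vector_def)
  qed
  obtain a1 where a1: "good a1"
    using eventually_happens'[OF _ good] by auto
  have gprob: "prob_space (S a)" and gy_meas: "y a \<in> borel_measurable (S a)"
    and gx_meas: "x a \<in> borel_measurable (S a)"
    and gstd: "\<And>s t. s\<^sup>2 + t\<^sup>2 = 1 \<Longrightarrow>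
       distributed (S a) lborel (\<lambda>\<omega>. s * (e1 a \<bullet> y a \<omega>) + t * (e2 a \<bullet> y a \<omega>)) std_normal_density"
    if "good a" for a
    using that by (auto simp: good_def)
  have Z_meas: "Z a \<in> borel_measurable (S a)" if "good a" for a
  proof -
    note [measurable] = gy_meas[OF that]
    have "(\<lambda>\<omega>. (e1 a \<bullet> y a \<omega>, e2 a \<bullet> y a \<omega>)) \<in> borel_measurable (S a)" by measurable
    from measurable_compose[OF this h_meas] show ?thesis by (simp add: Z_def[abs_def])
  qed

  \<comment> \<open>On cones neither the Gaussian radius nor the factor
    \<open>sqrt \<sigma>2\<close> matters, so the standard normal pair may be replaced by the point
    at angle \<Theta>.\<close>
  have angle: "measure (S a) {\<omega> \<in> space (S a). Z a \<omega> \<in> V} = measure T {\<omega> \<in> space T. u \<omega> \<in> V}"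
    if a: "good a" and V[measurable]: "V \<in> sets borel" and cone: "\<And>c w. c > 0 \<Longrightarrow> c *\<^sub>R w \<in> V \<longleftrightarrow> w \<in> V" for a V
  proof -
    have K: "h -` V \<in> sets borel" using measurable_sets[OF h_meas V] by simp
    have "measure (S a) {\<omega> \<in> space (S a). (e1 a \<bullet> y a \<omega>, e2 a \<bullet> y a \<omega>) \<in> h -` V}
        = measure T {\<omega> \<in> space T. (cos (\<Theta> \<omega>), sin (\<Theta> \<omega>)) \<in> h -` V}"
      by (rule std_normal_pair_angle[OF gprob[OF a] gstd[OF a] unif K]) (auto simp: h_scale cone)
    then show ?thesis using noise(2) by (simp add: Z_def hu cone)
  qed

  \<comment> \<open>One coordinate of the centered vector is enough to witness nonconstancy. The
    same \<open>j\<close> serves for \<open>Z a\<close> and, further below, for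
    \<open>x a\<close>.\<close>
  obtain j where j: "(centering *v p) $ j \<noteq> 0 \<or> (centering *v q) $ j \<noteq> 0"
  proof -
    have "vHc \<noteq> 0" using cov(2) by auto
    moreover obtain \<omega> where "\<omega> > 0" "complex_matrix Mc *v vHc = (\<i> * of_real \<omega>) *s vHc" using cov(5) by blast
    ultimately show thesis
      using that centering_eigenvector_nonzero[of Mc vHc \<omega>] unfolding p_def q_def by auto
  qed
  have centered_comp: "(centering *v w) $ j = centering $ j \<bullet> w" for w :: "real^'n"
    by (simp add: matrix_vector_mult_def inner_vec_def)
  have AEZ: "AE \<omega> in S a. Z a \<omega> \<in> G" if a: "good a" for a
  proof -
    interpret prob_space "S a" by (rule gprob[OF a])
    define b where "b = (centering *v p) $ j"
    define c where "c = (centering *v q) $ j"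
    \<comment> \<open>Dividing by \<open>r\<close> gives a unit vector of coefficients, for which
      the combination of the pair is standard normal and hence almost surely nonzero.\<close>
    define r where "r = sqrt (b\<^sup>2 + c\<^sup>2)"
    have "b\<^sup>2 + c\<^sup>2 > 0" using j by (simp add: b_def c_def sum_power2_gt_zero_iff)
    then have r: "r > 0" and "(b / r)\<^sup>2 + (c / r)\<^sup>2 = 1"
      unfolding power_divide add_divide_distrib[symmetric] r_def by auto
    then have "AE \<omega> in S a. b / r * (e1 a \<bullet> y a \<omega>) + c / r * (e2 a \<bullet> y a \<omega>) \<noteq> 0"
      by (intro AE_distributed_lborel_neq[OF gstd[OF a]])
    then show ?thesis
    proof eventually_elim
      case (elim \<omega>)
      have "(centering *v Z a \<omega>) $ j = sqrt \<sigma>2 * (b * (e1 a \<bullet> y a \<omega>) + c * (e2 a \<bullet> y a \<omega>))"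
        unfolding centered_comp b_def c_def by (simp add: Z_def h_def inner_add_right algebra_simps)
      moreover have "b * (e1 a \<bullet> y a \<omega>) + c * (e2 a \<bullet> y a \<omega>) \<noteq> 0" using elim r by (auto simp: field_simps)
      ultimately have "(centering *v Z a \<omega>) $ j \<noteq> 0" using noise(2) by simp
      then show ?case by (auto simp: G_def)
    qed
  qed
  interpret T: prob_space T by (rule prob_T)
  have u_meas[measurable]: "u \<in> borel_measurable T" unfolding u_def using unif(1) by measurable
  have measZ: "measure (S a) {\<omega> \<in> space (S a). Z a \<omega> \<in> G} = 1" if a: "good a" for a
  proof -
    interpret prob_space "S a" by (rule gprob[OF a])
    note [measurable] = Z_meas[OF a]
    show ?thesis using AEZ[OF a] by (subst prob_eq_1) auto
  qed
  \<comment> \<open>The nonconstant vectors form a cone, so their full probability is transferred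
    from \<open>Z a1\<close> to \<open>u\<close> by \<open>angle\<close>.\<close>
  have AET: "AE \<omega> in T. u \<omega> \<in> G"
  proof -
    have "measure T {\<omega> \<in> space T. u \<omega> \<in> G} = 1"
      unfolding measZ[OF a1, symmetric]
      by (rule angle[OF a1, symmetric]) (auto simp: G_def matrix_vector_mult_scaleR open_centering_nonzero)
    then show ?thesis by (subst (asm) T.prob_eq_1) auto
  qed

  define \<nu> where "\<nu> = distr (S a1) borel (Z a1)"
  have law: "distr (S a) borel (Z a) = \<nu>" if a: "good a" for a
  proof -
    define \<gamma> where "\<gamma> = distr std_normal_distribution borel (\<lambda>x. x) \<Otimes>\<^sub>M distr std_normal_distribution borel (\<lambda>x. x)"
    have "distr (S a) borel (Z a) = distr \<gamma> borel h" if a: "good a" for a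
    proof -
      interpret prob_space "S a" by (rule gprob[OF a])
      note [measurable] = gy_meas[OF a]
      have pair: "distr (S a) (borel \<Otimes>\<^sub>M borel) (\<lambda>\<omega>. (e1 a \<bullet> y a \<omega>, e2 a \<bullet> y a \<omega>)) = \<gamma>"
        unfolding \<gamma>_def by (rule std_normal_pair_law(3)) (rule gstd[OF a])
      have "h \<in> measurable (borel \<Otimes>\<^sub>M borel) borel" using h_meas unfolding borel_prod .
      then show ?thesis
        unfolding pair[symmetric] by (subst distr_distr) (auto simp: Z_def[abs_def] comp_def)
    qed
    from this[OF a] this[OF a1] show ?thesis by (simp add: \<nu>_def)
  qed
  have \<nu>: "prob_space \<nu>" "sets \<nu> = sets borel" "measure \<nu> G = 1"
  proof -
    interpret prob_space "S a1" by (rule gprob[OF a1])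
    note [measurable] = Z_meas[OF a1]
    show "prob_space \<nu>" unfolding \<nu>_def by (rule prob_space_distr) measurable
    show "sets \<nu> = sets borel" by (simp add: \<nu>_def)
    have "measure \<nu> G = measure (S a1) {\<omega> \<in> space (S a1). Z a1 \<omega> \<in> G}"
      unfolding \<nu>_def by (subst measure_distr) (auto intro!: arg_cong[where f = "measure (S a1)"])
    then show "measure \<nu> G = 1" using measZ[OF a1] by simp
  qed

  \<comment> \<open>Preimages under a function invariant under positive scaling are cones. Hence
    \<open>g (Z a \<omega>)\<close> and \<open>g (u \<omega>)\<close> have exactly the same law,
    although \<open>Z a\<close> and \<open>u\<close> do not, and only the comparison of
    \<open>x a\<close> with \<open>Z a\<close> involves a limit.\<close>
  have conv: "weak_conv_along ?F (\<lambda>a. distr (S a) borel (\<lambda>\<omega>. g (x a \<omega>))) (distr T borel (\<lambda>\<omega>. g (u \<omega>)))"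
    and tight: "tight_along ?F (\<lambda>a. distr (S a) borel (\<lambda>\<omega>. g (x a \<omega>)))"
    if g[measurable]: "g \<in> borel_measurable borel" and cont: "continuous_on G g"
      and scale: "\<And>c w. c > 0 \<Longrightarrow> g (c *\<^sub>R w) = g w" for g :: "real^'n \<Rightarrow> real"
  proof -
    show conv: "weak_conv_along ?F (\<lambda>a. distr (S a) borel (\<lambda>\<omega>. g (x a \<omega>))) (distr T borel (\<lambda>\<omega>. g (u \<omega>)))"
    proof (rule weak_conv_along_if_close_in_prob[where Z = "\<lambda>a \<omega>. g (Z a \<omega>)", OF prob])
      show "\<forall>\<^sub>F a in ?F. (\<lambda>\<omega>. g (x a \<omega>)) \<in> borel_measurable (S a) \<and> (\<lambda>\<omega>. g (Z a \<omega>)) \<in> borel_measurable (S a)"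
        using good by eventually_elim (auto intro!: measurable_compose[OF _ g] gx_meas Z_meas)
      show "\<forall>\<^sub>F a in ?F. distr (S a) borel (\<lambda>\<omega>. g (Z a \<omega>)) = distr T borel (\<lambda>\<omega>. g (u \<omega>))"
        using good
      proof eventually_elim
        case (elim a)
        interpret prob_space "S a" by (rule gprob[OF elim])
        note [measurable] = Z_meas[OF elim]
        show ?case
        proof (rule measure_eqI)
          fix A assume "A \<in> sets (distr (S a) borel (\<lambda>\<omega>. g (Z a \<omega>)))"
          then have A[measurable]: "A \<in> sets borel" by simp
          have "g -` A \<in> sets borel" using measurable_sets[OF g A] by simp
          then have eq: "measure (S a) {\<omega> \<in> space (S a). Z a \<omega> \<in> g -` A} = measure T {\<omega> \<in> space T. u \<omega> \<in> g -` A}"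
            by (rule angle[OF elim]) (simp add: scale)
          have "emeasure (distr (S a) borel (\<lambda>\<omega>. g (Z a \<omega>))) A = emeasure (S a) {\<omega> \<in> space (S a). Z a \<omega> \<in> g -` A}"
            by (subst emeasure_distr) (auto intro!: arg_cong[where f = "emeasure (S a)"])
          also have "\<dots> = emeasure T {\<omega> \<in> space T. u \<omega> \<in> g -` A}"
            unfolding emeasure_eq_measure T.emeasure_eq_measure eq ..
          also have "\<dots> = emeasure (distr T borel (\<lambda>\<omega>. g (u \<omega>))) A"
            by (subst emeasure_distr) (auto intro!: arg_cong[where f = "emeasure T"])
          finally show "emeasure (distr (S a) borel (\<lambda>\<omega>. g (Z a \<omega>))) A = emeasure (distr T borel (\<lambda>\<omega>. g (u \<omega>))) A" .
        qed simp
      qed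
      fix d :: real assume d: "d > 0"
      have "((\<lambda>a. measure (S a) {\<omega> \<in> space (S a). \<bar>g (m a + y a \<omega>) - g (Z a \<omega>)\<bar> \<ge> d}) \<longlongrightarrow> 0) ?F"
      proof (rule close_in_prob_continuous_image[OF prob _ _ \<nu>(1,2) _ \<nu>(3) cont g _ d])
        show "\<forall>\<^sub>F a in ?F. (\<lambda>\<omega>. m a + y a \<omega>) \<in> borel_measurable (S a) \<and> Z a \<in> borel_measurable (S a)"
          using good by eventually_elim (auto intro!: borel_measurable_add gy_meas Z_meas)
        show "\<forall>\<^sub>F a in ?F. distr (S a) borel (Z a) = \<nu>"
          using good by eventually_elim (rule law)
        show "open G" unfolding G_def by (rule open_centering_nonzero)
        show "((\<lambda>a. measure (S a) {\<omega> \<in> space (S a). d' \<le> dist (m a + y a \<omega>) (Z a \<omega>)}) \<longlongrightarrow> 0) ?F"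
          if "d' > 0" for d'
          using close[OF that] by (simp add: Z_def h_def)
      qed
      moreover have "\<forall>\<^sub>F a in ?F. measure (S a) {\<omega> \<in> space (S a). \<bar>g (m a + y a \<omega>) - g (Z a \<omega>)\<bar> \<ge> d}
          = measure (S a) {\<omega> \<in> space (S a). \<bar>g (x a \<omega>) - g (Z a \<omega>)\<bar> \<ge> d}"
        using \<eta>pos
      proof eventually_elim
        case (elim a)
        have "m a + y a \<omega> = sqrt (\<eta> a) *\<^sub>R x a \<omega>" for \<omega>
          by (simp add: m_def y_def x_def scaleR_add_right)
        then show ?case using scale[of "sqrt (\<eta> a)"] elim by simp
      qed
      ultimately show "((\<lambda>a. measure (S a) {\<omega> \<in> space (S a). \<bar>g (x a \<omega>) - g (Z a \<omega>)\<bar> \<ge> d}) \<longlongrightarrow> 0) ?F"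
        using tendsto_cong by force
    qed
    show "tight_along ?F (\<lambda>a. distr (S a) borel (\<lambda>\<omega>. g (x a \<omega>)))"
    proof (rule tight_along_if_weak_conv_along[OF _ conv])
      show "real_distribution (distr T borel (\<lambda>\<omega>. g (u \<omega>)))"
        by (rule T.real_distribution_distr) measurable
      show "\<forall>\<^sub>F a in ?F. real_distribution (distr (S a) borel (\<lambda>\<omega>. g (x a \<omega>)))"
        using good
        by eventually_elim (auto intro!: prob_space.real_distribution_distr gprob measurable_compose[OF _ g] gx_meas)
    qed
  qed

  have pos: "central_moment 2 w powr (3/2) \<noteq> 0" "(central_moment 2 w)\<^sup>2 \<noteq> 0"
      "(centering *v w) \<bullet> (centering *v w) \<noteq> 0" "(\<Sum>i\<in>UNIV. (w $ i - coord_mean w)\<^sup>2) \<noteq> 0"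
    if "w \<in> G" for w :: "real^'n"
    using that central_moment_2_pos[of w] unfolding G_def sum_square_deviations by auto
  \<comment> \<open>Near the critical point the \<open>j\<close>-th centered coordinate has positive
    variance: \<eta> times this variance tends to \<open>\<sigma>2 * ((w \<bullet> p)\<^sup>2 + (w
    \<bullet> q)\<^sup>2)\<close>, which is positive by the choice of \<open>j\<close>. The
    coordinate therefore has a density and misses 0 almost surely, whatever the mean is.\<close>
  have AEx: "\<forall>\<^sub>F a in ?F. AE \<omega> in S a. x a \<omega> \<in> G"
  proof -
    define w where "w = centering $ j"
    have "((\<lambda>a. w \<bullet> ((\<eta> a *\<^sub>R C a) *v w)) \<longlongrightarrow> w \<bullet> ((\<sigma>2 *\<^sub>R (outer_prod p p + outer_prod q q)) *v w)) ?F"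
      by (intro tendsto_intros cov(1))
    moreover have "w \<bullet> ((\<sigma>2 *\<^sub>R (outer_prod p p + outer_prod q q)) *v w) = \<sigma>2 * ((w \<bullet> p)\<^sup>2 + (w \<bullet> q)\<^sup>2)"
    proof -
      have "scalar_product v w = v \<bullet> w" for v w :: "real^'n" by (simp add: scalar_product_def inner_vec_def)
      then show ?thesis
        unfolding scaleR_matrix_vector_assoc[symmetric] matrix_vector_mult_add_rdistrib outer_prod_mult_vec
        by (simp add: inner_add_right scalar_mult_eq_scaleR power2_eq_square inner_commute[of w])
    qed
    moreover have "(w \<bullet> p)\<^sup>2 + (w \<bullet> q)\<^sup>2 > 0"
      using j by (simp add: w_def centered_comp sum_power2_gt_zero_iff)
    ultimately have "\<forall>\<^sub>F a in ?F. w \<bullet> ((\<eta> a *\<^sub>R C a) *v w) > 0"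
      using noise(2) by (simp add: order_tendstoD(1))
    then show ?thesis
      using near
    proof eventually_elim
      case (elim a)
      interpret prob_space "S a" by (rule prob_S[OF elim(2)])
      have "w \<bullet> (C a *v w) \<noteq> 0" using elim(1) by (auto simp: scaleR_matrix_vector_assoc[symmetric])
      then have "distributed (S a) lborel (\<lambda>\<omega>. w \<bullet> z a \<omega>) (normal_density (w \<bullet> 0) (sqrt (w \<bullet> (C a *v w))))"
        using gauss[OF elim(2)] unfolding gaussian_vector_def by metis
      then have "AE \<omega> in S a. w \<bullet> z a \<omega> \<noteq> - (w \<bullet> xs a)" by (rule AE_distributed_lborel_neq)
      then show ?case
      proof eventually_elim
        case (elim \<omega>)
        then have "(centering *v x a \<omega>) $ j \<noteq> 0"
          unfolding centered_comp w_def[symmetric] by (simp add: x_def inner_add_right)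
        then show ?case by (auto simp: G_def)
      qed
    qed
  qed
  have stat_cont: "continuous_on G skewness" "continuous_on G kurtosis" "continuous_on G (moran_I A)"
    unfolding G_def by (rule continuous_on_statistics)+
  note skew = conv[OF _ stat_cont(1) skewness_scaleR] tight[OF _ stat_cont(1) skewness_scaleR]
  note kurt = conv[OF _ stat_cont(2) kurtosis_scaleR] tight[OF _ stat_cont(2) kurtosis_scaleR]
  note moran = conv[OF _ stat_cont(3) moran_I_scaleR] tight[OF _ stat_cont(3) moran_I_scaleR]
  show ?thesis
  proof (intro conjI)
    show "weak_conv_along ?F (\<lambda>a. distr (S a) borel (\<lambda>\<omega>. skewness (x a \<omega>)))
        (distr T borel (\<lambda>\<omega>. central_moment 3 (u \<omega>) / central_moment 2 (u \<omega>) powr (3/2)))"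
      using skew(1) by (simp add: skewness_def)
    show "weak_conv_along ?F (\<lambda>a. distr (S a) borel (\<lambda>\<omega>. kurtosis (x a \<omega>)))
        (distr T borel (\<lambda>\<omega>. central_moment 4 (u \<omega>) / (central_moment 2 (u \<omega>))\<^sup>2))"
      using kurt(1) by (simp add: kurtosis_def)
    show "weak_conv_along ?F (\<lambda>a. distr (S a) borel (\<lambda>\<omega>. moran_I A (x a \<omega>)))
        (distr T borel (\<lambda>\<omega>. real CARD('n) / total_weight A *
           (((centering *v u \<omega>) \<bullet> (A *v (centering *v u \<omega>))) /
            ((centering *v u \<omega>) \<bullet> (centering *v u \<omega>)))))"
      unfolding moran_I_centering[of A "u _", symmetric] by (rule moran(1)) measurable
    show "AE \<omega> in T. central_moment 2 (u \<omega>) powr (3/2) \<noteq> 0 \<and> (central_moment 2 (u \<omega>))\<^sup>2 \<noteq> 0 \<and>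
        (centering *v u \<omega>) \<bullet> (centering *v u \<omega>) \<noteq> 0"
      using AET by eventually_elim (intro conjI pos)
    show "\<forall>\<^sub>F a in ?F. AE \<omega> in S a.
        central_moment 2 (x a \<omega>) powr (3/2) \<noteq> 0 \<and> (central_moment 2 (x a \<omega>))\<^sup>2 \<noteq> 0 \<and>
        (\<Sum>i\<in>UNIV. (x a \<omega> $ i - coord_mean (x a \<omega>))\<^sup>2) \<noteq> 0"
      using AEx
    proof eventually_elim
      case (elim a)
      then show ?case by eventually_elim (intro conjI pos)
    qed
    show "tight_along ?F (\<lambda>a. distr (S a) borel (\<lambda>\<omega>. skewness (x a \<omega>)))" by (rule skew(2)) measurable
    show "tight_along ?F (\<lambda>a. distr (S a) borel (\<lambda>\<omega>. kurtosis (x a \<omega>)))" by (rule kurt(2)) measurable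
    show "tight_along ?F (\<lambda>a. distr (S a) borel (\<lambda>\<omega>. moran_I A (x a \<omega>)))" by (rule moran(2)) measurable
  qed
qed

end
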